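(* Let $T:\mathbb{R}^2\to\mathbb{R}^2$ be an invertible linear transformation with inverse $$T^{-1}=\begin{pmatrix} a & b\\ c & d\end{pmatrix},\qquad ab\neq 0.$$ Let $\mu,\nu\in\mathcal{S}'(\mathbb{R})\setminus\{0\}$ satisfy $$W_T(\mu,\nu)=\sum_{(r,s)\in A\times B}c_{r,s}\,\delta_{(r,s)},$$ where $A,B\subset\mathbb{R}$ are uniformly discrete sets and $c_{r,s}\in\mathbb{C}$. Then the Fourier transforms $\widehat{\mu}$ and $\widehat{\nu}$ are measures supported on uniformly discrete sets.
   Context: A set $A\subset\mathbb{R}$ is uniformly discrete if there is $\delta>0$ such that $|r-s|\ge\delta$ for all $r,s\in A$ with $r\ne s$. $\delta_\xi$ denotes the point mass at $\xi$; the series is understood as an identity of tempered distributions on $\mathbb{R}^2$. A tempered distribution is called a measure if it is given by a locally finite complex Borel measure. The Fourier transform is $\widehat f(\omega)=\int_{\mathbb{R}}f(t)e^{-2\pi i\omega t}\,dt$, extended to $\mathcal{S}'(\mathbb{R})$. For an invertible linear map $T:\mathbb{R}^2\to\mathbb{R}^2$ the same letter denotes the change of coordinate operator $TF=F\circ T$, extended to $\mathcal{S}'(\mathbb{R}^2)$ in the natural way (pull-back). $\mathcal{F}_2$ is the partial Fourier transform $\mathcal{F}_2F(x,\omega)=\int_{\mathbb{R}}F(x,t)e^{-2\pi i\omega t}\,dt$, extended to $\mathcal{S}'(\mathbb{R}^2)$. The matrix-Wigner transform of $\mu,\nu\in\mathcal{S}'(\mathbb{R})$ is $W_T(\mu,\nu)=\mathcal{F}_2\left(T(\mu\otimes\overline{\nu})\right)\in\mathcal{S}'(\mathbb{R}^2)$,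 where $\overline{\nu}$ is the complex conjugate distribution of $\nu$. *)

theory Defs
  imports "HOL-Analysis.Analysis"
begin

subsection \<open>Schwartz functions and tempered distributions\<close>

primrec partial_derivs ::
  "'a::euclidean_space list \<Rightarrow> ('a \<Rightarrow> complex) \<Rightarrow> 'a \<Rightarrow> complex" where
  "partial_derivs [] f = f"
| "partial_derivs (v # vs) f = (\<lambda>x. frechet_derivative (partial_derivs vs f) (at x) v)"

text \<open>Multi-indices are represented by lists of basis vectors. If all iterated partial
  derivatives are differentiable, they are continuous, so this is \<open>C\<^sup>\<infinity>\<close>.\<close>

definition smooth :: "('a::euclidean_space \<Rightarrow> complex) \<Rightarrow> bool" where
  "smooth f \<longleftrightarrow> (\<forall>vs. set vs \<subseteq> Basis \<longrightarrow> partial_derivs vs f differentiable_on UNIV)"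

definition schwartz :: "('a::euclidean_space \<Rightarrow> complex) set" where
  "schwartz = {f. smooth f \<and>
     (\<forall>k vs. set vs \<subseteq> Basis \<longrightarrow>
        bounded (range (\<lambda>x. norm x ^ k *\<^sub>R partial_derivs vs f x)))}"

definition schwartz_seminorm ::
  "nat \<Rightarrow> 'a::euclidean_space list \<Rightarrow> ('a \<Rightarrow> complex) \<Rightarrow> real" where
  "schwartz_seminorm k vs f = (SUP x. norm x ^ k * norm (partial_derivs vs f x))"

definition test_functions :: "('a::euclidean_space \<Rightarrow> complex) set" where
  "test_functions = {f. smooth f \<and> compact (closure {x. f x \<noteq> 0})}"

text \<open>Distributions are total functions in HOL, but only their values on \<^const>\<open>schwartz\<close>
  are meaningful; all statements about them, including equality and being nonzero,
  must be restricted to Schwartz functions.\<close>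

type_synonym 'a functional = "('a \<Rightarrow> complex) \<Rightarrow> complex"

definition tempered_distribution :: "'a::euclidean_space functional \<Rightarrow> bool" where
  "tempered_distribution u \<longleftrightarrow>
     (\<forall>f\<in>schwartz. \<forall>g\<in>schwartz. u (\<lambda>x. f x + g x) = u f + u g) \<and>
     (\<forall>f\<in>schwartz. \<forall>z. u (\<lambda>x. z * f x) = z * u f) \<and>
     (\<exists>C N. \<forall>f\<in>schwartz. norm (u f) \<le>
        C * (\<Sum>k\<le>N. \<Sum>vs | set vs \<subseteq> Basis \<and> length vs \<le> N. schwartz_seminorm k vs f))"

definition dirac :: "'a \<Rightarrow> 'a functional" where
  "dirac p \<phi> = \<phi> p"

text \<open>Unconditional convergence in the weak sense, i.e.\ tested on each Schwartz function.\<close>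

definition dist_has_sum ::
  "('i \<Rightarrow> 'a::euclidean_space functional) \<Rightarrow> 'a functional \<Rightarrow> 'i set \<Rightarrow> bool" where
  "dist_has_sum U V I \<longleftrightarrow> (\<forall>\<phi>\<in>schwartz. ((\<lambda>i. U i \<phi>) has_sum V \<phi>) I)"

subsection \<open>Operations on tempered distributions\<close>

definition fourier :: "(real \<Rightarrow> complex) \<Rightarrow> real \<Rightarrow> complex" where
  "fourier f \<omega> = (LINT t|lborel. f t * exp (- 2 * pi * \<i> * \<omega> * t))"

definition fourier_dist :: "real functional \<Rightarrow> real functional" where
  "fourier_dist u \<phi> = u (fourier \<phi>)"

definition cnj_dist :: "'a functional \<Rightarrow> 'a functional" where
  "cnj_dist u \<phi> = cnj (u (\<lambda>x. cnj (\<phi> x)))"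

definition tensor_dist :: "real functional \<Rightarrow> real functional \<Rightarrow> (real^2) functional" where
  "tensor_dist u v \<Phi> = u (\<lambda>x. v (\<lambda>y. \<Phi> (vector [x, y])))"

text \<open>The extension of \<open>F \<mapsto> F \<circ> T\<close>, by the substitution
  \<open>\<integral> F (T x) \<Phi> x dx = \<bar>det T\<bar>\<^sup>-\<^sup>1 \<integral> F y \<Phi> (T\<^sup>-\<^sup>1 y) dy\<close>.\<close>

definition pullback_dist :: "(real^2 \<Rightarrow> real^2) \<Rightarrow> (real^2) functional \<Rightarrow> (real^2) functional" where
  "pullback_dist T u \<Phi> = u (\<Phi> \<circ> inv T) / of_real \<bar>det (matrix T)\<bar>"

definition partial_fourier :: "(real^2 \<Rightarrow> complex) \<Rightarrow> real^2 \<Rightarrow> complex" where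
  "partial_fourier F p = fourier (\<lambda>t. F (vector [p $ 1, t])) (p $ 2)"

definition partial_fourier_dist :: "(real^2) functional \<Rightarrow> (real^2) functional" where
  "partial_fourier_dist u \<Phi> = u (partial_fourier \<Phi>)"

definition matrix_wigner ::
  "(real^2 \<Rightarrow> real^2) \<Rightarrow> real functional \<Rightarrow> real functional \<Rightarrow> (real^2) functional" where
  "matrix_wigner T \<mu> \<nu> =
     partial_fourier_dist (pullback_dist T (tensor_dist \<mu> (cnj_dist \<nu>)))"

subsection \<open>Locally finite complex Borel measures\<close>

text \<open>A locally finite complex measure need not be defined on unbounded sets;
  only the values of \<open>\<kappa>\<close> on bounded Borel sets are meaningful.\<close>

definition locally_finite_complex_measure :: "(real set \<Rightarrow> complex) \<Rightarrow> bool" where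
  "locally_finite_complex_measure \<kappa> \<longleftrightarrow>
     (\<forall>E :: nat \<Rightarrow> real set. range E \<subseteq> sets borel \<and> disjoint_family E \<and> bounded (\<Union>i. E i) \<longrightarrow>
        (\<lambda>i. \<kappa> (E i)) sums \<kappa> (\<Union>i. E i))"

text \<open>Polar decomposition \<open>d\<kappa> = h d\<bar>\<kappa>\<bar>\<close>: these conditions force \<open>m = \<bar>\<kappa>\<bar>\<close> and determine
  \<open>h\<close> up to \<open>m\<close>-null sets. Integration against \<open>\<kappa>\<close> is defined through it.\<close>

definition polar_decomposition ::
  "(real set \<Rightarrow> complex) \<Rightarrow> real measure \<Rightarrow> (real \<Rightarrow> complex) \<Rightarrow> bool" where
  "polar_decomposition \<kappa> m h \<longleftrightarrow>
     sets m = sets borel \<and> h \<in> borel_measurable borel \<and> (\<forall>x. norm (h x) = 1) \<and>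
     (\<forall>E\<in>sets borel. bounded E \<longrightarrow>
        emeasure m E < \<infinity> \<and> \<kappa> E = (LINT x|m. indicator E x * h x))"

definition has_complex_measure_integral ::
  "(real \<Rightarrow> complex) \<Rightarrow> complex \<Rightarrow> (real set \<Rightarrow> complex) \<Rightarrow> bool" where
  "has_complex_measure_integral f I \<kappa> \<longleftrightarrow>
     (\<exists>m h. polar_decomposition \<kappa> m h \<and> integrable m (\<lambda>x. f x * h x) \<and>
            I = (LINT x|m. f x * h x))"

text \<open>Only test functions of compact support are used, since a Schwartz function need not be
  integrable with respect to a locally finite measure. They are dense in the Schwartz space.\<close>

definition given_by_measure :: "real functional \<Rightarrow> (real set \<Rightarrow> complex) \<Rightarrow> bool" where
  "given_by_measure u \<kappa> \<longleftrightarrow>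
     locally_finite_complex_measure \<kappa> \<and>
     (\<forall>\<phi>\<in>test_functions. has_complex_measure_integral \<phi> (u \<phi>) \<kappa>)"

definition measure_supported_on :: "(real set \<Rightarrow> complex) \<Rightarrow> real set \<Rightarrow> bool" where
  "measure_supported_on \<kappa> \<Lambda> \<longleftrightarrow>
     (\<forall>E\<in>sets borel. bounded E \<and> E \<inter> \<Lambda> = {} \<longrightarrow> \<kappa> E = 0)"

end

theory Submission
  imports Defs "HOL-Probability.Sinc_Integral" "HOL-Probability.Characteristic_Functions"
begin

text \<open>
  Write \<open>S\<close> for the Fourier transform of \<open>\<mu>\<close> and \<open>R\<close> for that of the conjugate of \<open>\<nu>\<close>.  Up to
  a linear change of coordinates, \<open>S \<otimes> R\<close> is the Fourier transform of the matrix-Wigner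
  distribution in its first variable.  The latter is a sum of point masses with second
  coordinates in \<open>B\<close>, so \<open>S \<otimes> R\<close> is carried by the lines \<open>(a q - b p) / D = s\<close> with
  \<open>s \<in> B\<close>, where \<open>D = a d - b c\<close>, and it has no derivatives across these lines.  In terms of
  test functions: if \<open>f p * g1 q = f1 p * g q\<close> on all these lines, then
  \<open>S f * R g1 = S f1 * R g\<close>.  To prove this, \<open>fourier f u * fourier g v\<close> is written, up to a
  constant, as the image under the transpose of the matrix-Wigner operator of an explicit
  Schwartz function on the plane
  (\<open>wigner_test\<close>, \<open>wigner_test_schwartz\<close>, \<open>fourier_wigner_test\<close>), whose values at points
  \<open>(r, s)\<close> depend on \<open>f p * g q\<close> along the line \<open>(a q - b p) / D = s\<close> only.

  As \<open>a\<close> and \<open>b\<close> are nonzero, the lines are parallel to neither axis.  Fix \<open>g\<close> of small support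
  with \<open>R g \<noteq> 0\<close>.  When \<open>p\<close> is confined to a short window, at most one of the lines matters,
  because \<open>B\<close> is uniformly discrete, and on it \<open>p\<close> is an affine function of \<open>q\<close>.  Therefore
  \<open>S (p f) = \<kappa> S f\<close> for some constant \<open>\<kappa>\<close> and all \<open>f\<close> supported in the window
  (\<open>local_eigenvalue\<close>).  By Hadamard's lemma \<open>S\<close> is then a multiple of a point mass on each window
  (\<open>local_point_mass\<close>), and since the length of the windows is fixed, \<open>S\<close> is a measure on a
  uniformly discrete set (\<open>discrete_representation\<close>, \<open>given_by_atomic_measure\<close>).  The roles of
  \<open>S\<close> and \<open>R\<close> are interchangeable.

  The argument needs test functions on which \<open>S\<close> and \<open>R\<close> do not vanish.  They exist because the
  Fourier transform is onto on Schwartz functions (\<open>fourier_surj\<close>) and test functions are dense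
  in a topology for which it is continuous (\<open>fourier_dist_nonzero\<close>).
\<close>

section \<open>Criteria for smoothness and rapid decay\<close>

inductive_set lin_span :: "('i \<Rightarrow> complex) set \<Rightarrow> ('i \<Rightarrow> complex) set"
  for X :: "('i \<Rightarrow> complex) set" where
  base: "f \<in> X \<Longrightarrow> f \<in> lin_span X"
| scale: "f \<in> lin_span X \<Longrightarrow> (\<lambda>x. z * f x) \<in> lin_span X"
| add: "f \<in> lin_span X \<Longrightarrow> g \<in> lin_span X \<Longrightarrow> (\<lambda>x. f x + g x) \<in> lin_span X"

lemma lin_span_combine:
  assumes "f \<in> X" "g \<in> X"
  shows "(\<lambda>x. y * f x + z * g x) \<in> lin_span X"
  using assms by (intro lin_span.intros)

text \<open>A set of differentiable functions whose first partial derivatives are linear combinations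
  of its own members consists of smooth functions, because all iterated derivatives stay in its span.  To
  prove a function smooth it is enough to find such a set around it, for example all products or
  quotients of one fixed shape.\<close>

lemma lin_span_partials:
  fixes X :: "('a::euclidean_space \<Rightarrow> complex) set"
  assumes diff: "\<And>f. f \<in> X \<Longrightarrow> f differentiable_on UNIV"
    and deriv: "\<And>f b. f \<in> X \<Longrightarrow> b \<in> Basis \<Longrightarrow>
      (\<lambda>x. frechet_derivative f (at x) b) \<in> lin_span X"
    and f: "f \<in> lin_span X"
  shows "f differentiable_on UNIV \<and>
    (\<forall>b\<in>Basis. (\<lambda>x. frechet_derivative f (at x) b) \<in> lin_span X)"
  using f
proof induction
  case (base f)
  then show ?case using diff deriv by auto
next
  case (scale f z)
  have d: "f differentiable (at x)" for x
    using scale by (auto simp: differentiable_on_def)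
  have der: "((\<lambda>x. z * f x) has_derivative (\<lambda>h. z * frechet_derivative f (at x) h)) (at x)" for x
    using d[of x] by (intro has_derivative_mult_right) (simp add: frechet_derivative_works)
  have "frechet_derivative (\<lambda>x. z * f x) (at x) = (\<lambda>h. z * frechet_derivative f (at x) h)" for x
    using frechet_derivative_at[OF der] by simp
  moreover have "(\<lambda>x. z * f x) differentiable_on UNIV"
    using der by (auto simp: differentiable_on_def differentiable_def)
  ultimately show ?case
    using scale by (auto intro: lin_span.scale)
next
  case (add f g)
  have d: "f differentiable (at x)" "g differentiable (at x)" for x
    using add by (auto simp: differentiable_on_def)
  have der: "((\<lambda>x. f x + g x) has_derivative
      (\<lambda>h. frechet_derivative f (at x) h + frechet_derivative g (at x) h)) (at x)" for x
    using d[of x] by (intro has_derivative_add) (simp_all add: frechet_derivative_works)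
  have "frechet_derivative (\<lambda>x. f x + g x) (at x)
      = (\<lambda>h. frechet_derivative f (at x) h + frechet_derivative g (at x) h)" for x
    using frechet_derivative_at[OF der] by simp
  moreover have "(\<lambda>x. f x + g x) differentiable_on UNIV"
    using der by (auto simp: differentiable_on_def differentiable_def)
  ultimately show ?case
    using add by (auto intro: lin_span.add)
qed

lemma lin_span_partial_derivs:
  fixes X :: "('a::euclidean_space \<Rightarrow> complex) set"
  assumes "\<And>f. f \<in> X \<Longrightarrow> f differentiable_on UNIV"
    and "\<And>f b. f \<in> X \<Longrightarrow> b \<in> Basis \<Longrightarrow>
      (\<lambda>x. frechet_derivative f (at x) b) \<in> lin_span X"
    and f: "f \<in> lin_span X" and "set vs \<subseteq> Basis"
  shows "partial_derivs vs f \<in> lin_span X"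
  using assms(4)
proof (induction vs)
  case (Cons v vs)
  then show ?case
    using lin_span_partials[OF assms(1,2), of "partial_derivs vs f"] by auto
qed (simp add: f)

lemma smooth_lin_span:
  fixes X :: "('a::euclidean_space \<Rightarrow> complex) set"
  assumes "\<And>f. f \<in> X \<Longrightarrow> f differentiable_on UNIV"
    and "\<And>f b. f \<in> X \<Longrightarrow> b \<in> Basis \<Longrightarrow>
      (\<lambda>x. frechet_derivative f (at x) b) \<in> lin_span X"
    and "f \<in> lin_span X"
  shows "smooth f"
  unfolding smooth_def
  using lin_span_partial_derivs[OF assms] lin_span_partials[OF assms(1,2)] by blast

text \<open>The generators absorb coordinate factors one at a time, and
  \<open>norm x \<le> (\<Sum>b\<in>Basis. \<bar>x \<bullet> b\<bar>)\<close>, so boundedness of the generators alone already bounds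
  every product \<open>norm x ^ k * f x\<close>.  No formula for an iterated derivative has to be written
  down.\<close>

lemma schwartz_lin_span:
  fixes X :: "('a::euclidean_space \<Rightarrow> complex) set"
  assumes diff: "\<And>f. f \<in> X \<Longrightarrow> f differentiable_on UNIV"
    and deriv: "\<And>f b. f \<in> X \<Longrightarrow> b \<in> Basis \<Longrightarrow>
      (\<lambda>x. frechet_derivative f (at x) b) \<in> lin_span X"
    and bdd: "\<And>f. f \<in> X \<Longrightarrow> bounded (range f)"
    and mult: "\<And>f b. f \<in> X \<Longrightarrow> b \<in> Basis \<Longrightarrow>
      (\<lambda>x. of_real (x \<bullet> b) * f x) \<in> lin_span X"
    and f: "f \<in> lin_span X"
  shows "f \<in> schwartz"
proof -
  have mult': "(\<lambda>x. of_real (x \<bullet> b) * g x) \<in> lin_span X" if "g \<in> lin_span X" "b \<in> Basis" for g b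
    using that(1)
  proof induction
    case (base f)
    then show ?case using mult that by auto
  next
    case (scale f z)
    then show ?case using lin_span.scale[OF scale.IH, of z] by (simp add: mult_ac)
  next
    case (add f g)
    then show ?case using lin_span.add[OF add.IH] by (simp add: algebra_simps)
  qed
  have bdd': "\<exists>K. \<forall>x. norm (g x) \<le> K" if "g \<in> lin_span X" for g
    using that
  proof induction
    case (base f)
    then show ?case using bdd[of f] by (auto simp: bounded_iff)
  next
    case (scale f z)
    then obtain K where K: "\<forall>x. norm (f x) \<le> K" by blast
    then show ?case
      by (intro exI[of _ "norm z * K"]) (simp add: norm_mult mult_left_mono)
  next
    case (add f g)
    then obtain K L where "\<forall>x. norm (f x) \<le> K" "\<forall>x. norm (g x) \<le> L" by blast
    then show ?case
      by (intro exI[of _ "K + L"]) (meson add_mono norm_triangle_le)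
  qed
  have decay: "\<exists>K. \<forall>x. norm x ^ k * norm (g x) \<le> K" if "g \<in> lin_span X" for g k
    using that
  proof (induction k arbitrary: g)
    case 0
    then show ?case using bdd' by simp
  next
    case (Suc k)
    have "\<exists>K. \<forall>x. norm x ^ k * norm (of_real (x \<bullet> b) * g x) \<le> K" if "b \<in> Basis" for b
      using Suc.IH[OF mult'[OF Suc.prems that]] .
    then obtain K where K: "norm x ^ k * norm (of_real (x \<bullet> b) * g x) \<le> K b"
      if "b \<in> Basis" for b x by metis
    show ?case
    proof (intro exI[of _ "\<Sum>b\<in>Basis. K b"] allI)
      fix x :: 'a
      have "norm x ^ Suc k * norm (g x) \<le> (\<Sum>b\<in>Basis. \<bar>x \<bullet> b\<bar>) * (norm x ^ k * norm (g x))"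
        using mult_right_mono[OF norm_le_l1[of x], of "norm x ^ k * norm (g x)"]
        by (simp add: mult_ac)
      also have "\<dots> = (\<Sum>b\<in>Basis. norm x ^ k * norm (of_real (x \<bullet> b) * g x))"
        by (simp add: sum_distrib_left sum_distrib_right norm_mult mult_ac)
      also have "\<dots> \<le> (\<Sum>b\<in>Basis. K b)"
        by (intro sum_mono K)
      finally show "norm x ^ Suc k * norm (g x) \<le> (\<Sum>b\<in>Basis. K b)" .
    qed
  qed
  show ?thesis
    unfolding schwartz_def
    using smooth_lin_span[OF diff deriv f] decay lin_span_partial_derivs[OF diff deriv f]
    by (fastforce simp: bounded_iff)
qed

section \<open>Smooth functions of one real variable\<close>

definition vderiv :: "(real \<Rightarrow> complex) \<Rightarrow> real \<Rightarrow> complex" where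
  "vderiv f x = vector_derivative f (at x)"

lemma vderiv_eqI:
  assumes "\<And>x. (f has_vector_derivative f' x) (at x)"
  shows "vderiv f = f'"
  using assms by (auto simp: vderiv_def vector_derivative_at)

lemma frechet_derivative_vderiv:
  assumes "f differentiable_on UNIV"
  shows "(\<lambda>x. frechet_derivative f (at x) 1) = vderiv f"
proof
  fix x
  have "(f has_derivative (\<lambda>h. h *\<^sub>R vderiv f x)) (at x)"
    using assms by (auto simp: vderiv_def vector_derivative_works[symmetric]
        has_vector_derivative_def[symmetric] differentiable_on_def)
  from frechet_derivative_at[OF this]
  show "frechet_derivative f (at x) 1 = vderiv f x"
    by (metis scaleR_one)
qed

lemma differentiable_on_UNIV_real:
  fixes f :: "real \<Rightarrow> complex"
  assumes "\<And>x. (f has_vector_derivative f' x) (at x)"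
  shows "f differentiable_on UNIV"
  using assms by (auto simp: differentiable_on_def intro: differentiableI_vector)

lemma smooth_real_span:
  fixes X :: "(real \<Rightarrow> complex) set"
  assumes "\<And>f. f \<in> X \<Longrightarrow>
      \<exists>f'\<in>lin_span X. \<forall>x. (f has_vector_derivative f' x) (at x)"
    and "f \<in> lin_span X"
  shows "smooth f"
proof (rule smooth_lin_span[of X])
  show *: "f differentiable_on UNIV" if "f \<in> X" for f
    using assms(1)[OF that] differentiable_on_UNIV_real by blast
  show "(\<lambda>x. frechet_derivative f (at x) b) \<in> lin_span X" if "f \<in> X" "b \<in> Basis" for f b
    using assms(1)[OF that(1)] that(2) vderiv_eqI
    by (auto simp: frechet_derivative_vderiv[OF *[OF that(1)]])
qed fact

lemma schwartz_real_span:
  fixes X :: "(real \<Rightarrow> complex) set"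
  assumes "\<And>f. f \<in> X \<Longrightarrow>
      \<exists>f'\<in>lin_span X. \<forall>x. (f has_vector_derivative f' x) (at x)"
    and "\<And>f. f \<in> X \<Longrightarrow> bounded (range f)"
    and "\<And>f. f \<in> X \<Longrightarrow> (\<lambda>x. of_real x * f x) \<in> lin_span X"
    and "f \<in> lin_span X"
  shows "f \<in> schwartz"
proof (rule schwartz_lin_span[of X])
  show *: "f differentiable_on UNIV" if "f \<in> X" for f
    using assms(1)[OF that] differentiable_on_UNIV_real by blast
  show "(\<lambda>x. frechet_derivative f (at x) b) \<in> lin_span X" if "f \<in> X" "b \<in> Basis" for f b
    using assms(1)[OF that(1)] that(2) vderiv_eqI
    by (auto simp: frechet_derivative_vderiv[OF *[OF that(1)]])
qed (use assms in auto)

lemma smooth_differentiable: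
  assumes "smooth f"
  shows "f differentiable_on UNIV"
  using assms[unfolded smooth_def, rule_format, of "[]"] by simp

lemma partial_derivs_append: "partial_derivs (vs @ ws) f = partial_derivs vs (partial_derivs ws f)"
  by (induction vs) auto

lemma smooth_has_vderiv:
  assumes "smooth f"
  shows "(f has_vector_derivative vderiv f x) (at x)"
  using smooth_differentiable[OF assms]
  by (auto simp: vderiv_def vector_derivative_works[symmetric] differentiable_on_def)

lemma smooth_vderiv:
  assumes "smooth f"
  shows "smooth (vderiv f)"
proof -
  have "vderiv f = partial_derivs [1] f"
    using frechet_derivative_vderiv[OF smooth_differentiable[OF assms]] by simp
  moreover have "partial_derivs vs (partial_derivs [1] f) differentiable_on UNIV"
    if "set vs \<subseteq> Basis" for vs
    using assms[unfolded smooth_def, rule_format, of "vs @ [1]"] that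
    by (simp only: partial_derivs_append) auto
  ultimately show ?thesis by (simp only: smooth_def) blast
qed

lemma partial_derivs_real:
  assumes "smooth f" "set vs \<subseteq> (Basis :: real set)"
  shows "partial_derivs vs f = (vderiv ^^ length vs) f \<and> smooth ((vderiv ^^ length vs) f)"
  using assms(2)
proof (induction vs)
  case (Cons v vs)
  then show ?case
    using frechet_derivative_vderiv[OF smooth_differentiable[of "(vderiv ^^ length vs) f"]]
    by (auto intro: smooth_vderiv)
qed (simp add: assms)

lemma smooth_continuous: "smooth f \<Longrightarrow> continuous_on S f"
  using differentiable_imp_continuous_on[OF smooth_differentiable, of f]
  by (auto intro: continuous_on_subset)

lemma smooth_continuous_compose:
  "smooth f \<Longrightarrow> continuous_on S g \<Longrightarrow> continuous_on S (\<lambda>x. f (g x))"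
  using continuous_on_compose2[OF smooth_continuous[of f UNIV]] by auto

lemma smooth_measurable [measurable]: "smooth f \<Longrightarrow> f \<in> borel_measurable borel"
  for f :: "real \<Rightarrow> complex"
  by (intro borel_measurable_continuous_onI smooth_continuous)

lemma smooth_const [simp]: "smooth (\<lambda>x::real. c)"
  by (rule smooth_real_span[of "range (\<lambda>c x. c)"])
     (auto intro!: bexI[of _ "\<lambda>x. 0"] lin_span.base)

lemma smooth_of_real [simp]: "smooth (of_real :: real \<Rightarrow> complex)"
proof (rule smooth_real_span[of "insert of_real (range (\<lambda>c x. c))"])
  let ?X = "insert of_real (range (\<lambda>(c::complex) (x::real). c))"
  fix f :: "real \<Rightarrow> complex"
  assume "f \<in> ?X"
  then have "\<exists>c. \<forall>x. (f has_vector_derivative c) (at x)"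
    using has_vector_derivative_of_real[OF DERIV_ident] has_vector_derivative_const
    by blast
  then obtain c where "\<forall>x. (f has_vector_derivative c) (at x)" ..
  then show "\<exists>f'\<in>lin_span ?X. \<forall>x. (f has_vector_derivative f' x) (at x)"
    by (intro bexI[of _ "\<lambda>x. c"] lin_span.base) auto
qed (auto intro!: lin_span.base)

lemma smooth_add:
  assumes "smooth f" "smooth g"
  shows "smooth (\<lambda>x::real. f x + g x)"
proof (rule smooth_real_span[of "{f. smooth f}"])
  show "(\<lambda>x. f x + g x) \<in> lin_span {f. smooth f}"
    using assms by (intro lin_span.add lin_span.base) auto
qed (use smooth_has_vderiv smooth_vderiv in \<open>auto intro!: lin_span.base\<close>)

lemma smooth_mult:
  assumes "smooth f" "smooth g"
  shows "smooth (\<lambda>x::real. f x * g x)"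
proof (rule smooth_real_span[of "{\<lambda>x. f x * g x |f g. smooth f \<and> smooth g}"])
  fix h :: "real \<Rightarrow> complex"
  assume "h \<in> {\<lambda>x. f x * g x |f g. smooth f \<and> smooth g}"
  then obtain f g where h: "h = (\<lambda>x. f x * g x)" and fg: "smooth f" "smooth g" by auto
  show "\<exists>h'\<in>lin_span {\<lambda>x. f x * g x |f g. smooth f \<and> smooth g}.
      \<forall>x. (h has_vector_derivative h' x) (at x)"
  proof (intro bexI[of _ "\<lambda>x. f x * vderiv g x + vderiv f x * g x"] allI)
    show "(h has_vector_derivative f x * vderiv g x + vderiv f x * g x) (at x)" for x
      unfolding h using fg by (intro has_vector_derivative_mult smooth_has_vderiv)
    show "(\<lambda>x. f x * vderiv g x + vderiv f x * g x)
        \<in> lin_span {\<lambda>x. f x * g x |f g. smooth f \<and> smooth g}"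
      using fg smooth_vderiv by (intro lin_span.add lin_span.base) blast+
  qed
qed (use assms in \<open>auto intro!: lin_span.base\<close>)

lemma smooth_cmult: "smooth f \<Longrightarrow> smooth (\<lambda>x::real. c * f x)"
  by (intro smooth_mult smooth_const)

lemma smooth_diff:
  assumes "smooth f" "smooth g"
  shows "smooth (\<lambda>x::real. f x - g x)"
  using smooth_add[OF assms(1) smooth_cmult[OF assms(2), of "-1"]] by simp

lemma affine_has_vderiv:
  assumes "smooth f"
  shows "((\<lambda>x. f (s * x + t)) has_vector_derivative of_real s * vderiv f (s * x + t)) (at x)"
proof -
  have "((\<lambda>x. s * x + t) has_vector_derivative s) (at x)"
    by (auto intro!: derivative_eq_intros)
  from vector_diff_chain_at[OF this smooth_has_vderiv[OF assms]]
  show ?thesis by (simp add: o_def scaleR_conv_of_real)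
qed

lemma smooth_affine:
  assumes "smooth f"
  shows "smooth (\<lambda>x::real. f (s * x + t))"
proof (rule smooth_real_span[of "{\<lambda>x. f (s * x + t) |f. smooth f}"])
  fix h :: "real \<Rightarrow> complex"
  assume "h \<in> {\<lambda>x. f (s * x + t) |f. smooth f}"
  then obtain f where h: "h = (\<lambda>x. f (s * x + t))" and f: "smooth f" by auto
  show "\<exists>h'\<in>lin_span {\<lambda>x. f (s * x + t) |f. smooth f}.
      \<forall>x. (h has_vector_derivative h' x) (at x)"
    using affine_has_vderiv[OF f] f smooth_vderiv h
    by (intro bexI[of _ "\<lambda>x. of_real s * vderiv f (s * x + t)"] lin_span.intros) auto
qed (use assms in \<open>auto intro!: lin_span.base\<close>)

lemma smooth_cnj:
  assumes "smooth f"
  shows "smooth (\<lambda>x::real. cnj (f x))"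
proof (rule smooth_real_span[of "{\<lambda>x. cnj (f x) |f. smooth f}"])
  fix h :: "real \<Rightarrow> complex"
  assume "h \<in> {\<lambda>x. cnj (f x) |f. smooth f}"
  then obtain f where h: "h = (\<lambda>x. cnj (f x))" and f: "smooth f" by auto
  show "\<exists>h'\<in>lin_span {\<lambda>x. cnj (f x) |f. smooth f}.
      \<forall>x. (h has_vector_derivative h' x) (at x)"
    using smooth_has_vderiv[OF f] f smooth_vderiv h
    by (intro bexI[of _ "\<lambda>x. cnj (vderiv f x)"] lin_span.intros)
       (auto intro: has_vector_derivative_cnj)
qed (use assms in \<open>auto intro!: lin_span.base\<close>)

text \<open>The quotients \<open>f / g ^ n\<close>, for all smooth \<open>f\<close> and all \<open>n\<close>, have derivatives among
  their linear combinations, whereas the quotients \<open>f / g\<close> alone do not.\<close>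

lemma smooth_divide:
  assumes "smooth f" "smooth g" and nz: "\<And>x. g x \<noteq> 0"
  shows "smooth (\<lambda>x::real. f x / g x)"
proof (rule smooth_real_span[of "{\<lambda>x. f x / g x ^ n |f n. smooth f}"])
  let ?X = "{\<lambda>x. f x / g x ^ n |f n. smooth f}"
  fix h :: "real \<Rightarrow> complex"
  assume "h \<in> ?X"
  then obtain f n where h: "h = (\<lambda>x. f x / g x ^ n)" and f: "smooth f" by auto
  let ?h' = "\<lambda>x. 1 * (vderiv f x / g x ^ n) + (- of_nat n) * (f x * vderiv g x / g x ^ Suc n)"
  have power: "((\<lambda>x. inverse (g x ^ n)) has_vector_derivative
      - of_nat n * vderiv g x / g x ^ Suc n) (at x)" for x
  proof -
    have "((\<lambda>z. inverse (z ^ n)) has_field_derivative (- of_nat n / g x ^ Suc n)) (at (g x))"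
    proof (cases n)
      case (Suc m)
      have "((\<lambda>z. inverse (z ^ n)) has_field_derivative
          - (inverse (g x ^ n) * (of_nat n * g x ^ m) * inverse (g x ^ n))) (at (g x))"
        using nz[of x] DERIV_power[OF DERIV_ident, where n = n and x = "g x"]
        by (intro DERIV_inverse') (auto simp: Suc)
      moreover have "inverse (g x ^ n) * (of_nat n * g x ^ m) * inverse (g x ^ n)
          = of_nat n / g x ^ Suc n"
        using nz[of x] by (simp add: Suc field_simps)
      ultimately show ?thesis by simp
    qed simp
    from field_vector_diff_chain_at[OF smooth_has_vderiv[OF assms(2)] this]
    show ?thesis by (simp add: o_def mult_ac)
  qed
  show "\<exists>h'\<in>lin_span ?X. \<forall>x. (h has_vector_derivative h' x) (at x)"
  proof (intro bexI[of _ ?h'] allI)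
    fix x
    have "?h' x = f x * (- of_nat n * vderiv g x / g x ^ Suc n) + vderiv f x * inverse (g x ^ n)"
      by (simp add: divide_inverse)
    moreover have "h = (\<lambda>x. f x * inverse (g x ^ n))"
      by (simp add: h divide_inverse)
    ultimately show "(h has_vector_derivative ?h' x) (at x)"
      using has_vector_derivative_mult[OF smooth_has_vderiv[OF f] power[of x]] by metis
  next
    show "?h' \<in> lin_span ?X"
    proof (rule lin_span_combine)
      show "(\<lambda>x. vderiv f x / g x ^ n) \<in> ?X"
        using smooth_vderiv[OF f] by blast
      show "(\<lambda>x. f x * vderiv g x / g x ^ Suc n) \<in> ?X"
        using smooth_mult[OF f smooth_vderiv[OF assms(2)]]
        by (intro CollectI exI[of _ "\<lambda>x. f x * vderiv g x"] exI[of _ "Suc n"]) simp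
    qed
  qed
next
  have "(\<lambda>x. f x / g x) \<in> {\<lambda>x. f x / g x ^ n |f n. smooth f}"
    using assms(1) by (auto intro!: exI[of _ f] exI[of _ "Suc 0"])
  then show "(\<lambda>x. f x / g x) \<in> lin_span {\<lambda>x. f x / g x ^ n |f n. smooth f}"
    by (rule lin_span.base)
qed

section \<open>Schwartz functions of one real variable\<close>

lemma schwartz_smooth: "f \<in> schwartz \<Longrightarrow> smooth f"
  by (simp add: schwartz_def)

lemma schwartz_real_iff:
  "f \<in> schwartz \<longleftrightarrow> smooth f \<and>
     (\<forall>k j. \<exists>K. \<forall>x. \<bar>x\<bar> ^ k * norm ((vderiv ^^ j) f x) \<le> K)"
proof (intro iffI conjI allI; (elim conjE)?)
  fix k j
  assume f: "f \<in> schwartz"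
  have "set (replicate j (1::real)) \<subseteq> Basis" by (auto split: if_splits)
  with f have "bounded (range (\<lambda>x. norm x ^ k *\<^sub>R partial_derivs (replicate j 1) f x))"
    by (simp add: schwartz_def)
  then show "\<exists>K. \<forall>x. \<bar>x\<bar> ^ k * norm ((vderiv ^^ j) f x) \<le> K"
    using partial_derivs_real[OF schwartz_smooth[OF f] \<open>set (replicate j 1) \<subseteq> Basis\<close>]
    by (auto simp: bounded_iff)
next
  assume "smooth f" and *: "\<forall>k j. \<exists>K. \<forall>x. \<bar>x\<bar> ^ k * norm ((vderiv ^^ j) f x) \<le> K"
  moreover have "bounded (range (\<lambda>x. norm x ^ k *\<^sub>R partial_derivs vs f x))"
    if "set vs \<subseteq> Basis" for k vs
    using partial_derivs_real[OF \<open>smooth f\<close> that] *[rule_format, of k "length vs"]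
    by (auto simp: bounded_iff)
  ultimately show "f \<in> schwartz" by (auto simp: schwartz_def)
qed (auto simp: schwartz_smooth)

lemma schwartz_decay:
  assumes "f \<in> schwartz"
  shows "\<exists>K. \<forall>x::real. \<bar>x\<bar> ^ k * norm (f x) \<le> K"
  using assms[unfolded schwartz_real_iff] by (metis funpow_0)

lemma schwartz_vderiv: "f \<in> schwartz \<Longrightarrow> vderiv f \<in> schwartz"
proof -
  assume f: "f \<in> schwartz"
  have "(vderiv ^^ j) (vderiv f) = (vderiv ^^ Suc j) f" for j
    by (simp add: funpow_swap1)
  with f show "vderiv f \<in> schwartz"
    unfolding schwartz_real_iff by (metis smooth_vderiv)
qed

lemma schwartz_monom_mult:
  assumes "f \<in> schwartz"
  shows "(\<lambda>x::real. of_real x ^ j * f x) \<in> schwartz"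
proof (rule schwartz_real_span[of "{\<lambda>x. of_real x ^ j * f x |f j. f \<in> schwartz}"])
  let ?X = "{\<lambda>x::real. of_real x ^ j * f x |f j. f \<in> schwartz}"
  fix h :: "real \<Rightarrow> complex"
  assume "h \<in> ?X"
  then obtain f j where h: "h = (\<lambda>x. of_real x ^ j * f x)" and f: "f \<in> schwartz" by auto
  have "((\<lambda>x. complex_of_real x ^ j) has_vector_derivative of_nat j * of_real x ^ (j - 1)) (at x)"
    for x
    using has_vector_derivative_of_real[OF DERIV_pow[of j x UNIV], where 'a=complex] by simp
  from has_vector_derivative_mult[OF this smooth_has_vderiv[OF schwartz_smooth[OF f]]]
  have "(h has_vector_derivative
      1 * (of_real x ^ j * vderiv f x) + of_nat j * (of_real x ^ (j - 1) * f x)) (at x)" for x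
    by (simp add: h mult_ac)
  moreover have "(\<lambda>x. 1 * (of_real x ^ j * vderiv f x) + of_nat j * (of_real x ^ (j - 1) * f x))
      \<in> lin_span ?X"
    using f schwartz_vderiv[OF f] by (intro lin_span_combine) blast+
  ultimately show "\<exists>h'\<in>lin_span ?X. \<forall>x. (h has_vector_derivative h' x) (at x)"
    by (intro bexI) auto
  show "bounded (range h)"
    using schwartz_decay[OF f, of j] by (auto simp: h bounded_iff norm_mult norm_power)
  have "(\<lambda>x. of_real x * h x) \<in> ?X"
    using f by (intro CollectI exI[of _ f] exI[of _ "Suc j"]) (simp add: h mult_ac)
  then show "(\<lambda>x. of_real x * h x) \<in> lin_span ?X"
    by (rule lin_span.base)
qed (use assms in \<open>auto intro!: lin_span.base\<close>)

lemma schwartz_times_x: "f \<in> schwartz \<Longrightarrow> (\<lambda>x::real. of_real x * f x) \<in> schwartz"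
  using schwartz_monom_mult[of f 1] by simp

lemma schwartz_span:
  assumes "f \<in> lin_span schwartz"
  shows "f \<in> (schwartz :: (real \<Rightarrow> complex) set)"
proof (rule schwartz_real_span[of schwartz])
  show "\<exists>f'\<in>lin_span schwartz. \<forall>x. (f has_vector_derivative f' x) (at x)"
    if "f \<in> schwartz" for f
    using schwartz_vderiv[OF that] smooth_has_vderiv[OF schwartz_smooth[OF that]]
    by (intro bexI[of _ "vderiv f"]) (auto intro: lin_span.base)
  show "bounded (range f)" if "f \<in> schwartz" for f :: "real \<Rightarrow> complex"
    using schwartz_decay[OF that, of 0] by (auto simp: bounded_iff)
  show "(\<lambda>x. of_real x * f x) \<in> lin_span schwartz" if "f \<in> schwartz" for f
    using that by (intro lin_span.base schwartz_times_x)
qed fact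

lemma schwartz_add:
  "f \<in> schwartz \<Longrightarrow> g \<in> schwartz \<Longrightarrow> (\<lambda>x::real. f x + g x) \<in> schwartz"
  by (rule schwartz_span) (intro lin_span.add lin_span.base)

lemma schwartz_cmult: "f \<in> schwartz \<Longrightarrow> (\<lambda>x::real. c * f x) \<in> schwartz"
  by (rule schwartz_span) (intro lin_span.scale lin_span.base)

lemma schwartz_diff:
  assumes "f \<in> schwartz" "g \<in> schwartz"
  shows "(\<lambda>x::real. f x - g x) \<in> schwartz"
  using schwartz_add[OF assms(1) schwartz_cmult[OF assms(2), of "-1"]] by simp

lemma schwartz_affine:
  assumes "f \<in> schwartz" "s \<noteq> 0"
  shows "(\<lambda>x::real. f (s * x + t)) \<in> schwartz"
proof (rule schwartz_real_span[of "{\<lambda>x. f (s * x + t) |f. f \<in> schwartz}"])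
  let ?X = "{\<lambda>x::real. f (s * x + t) |f. f \<in> schwartz}"
  fix h :: "real \<Rightarrow> complex"
  assume "h \<in> ?X"
  then obtain f where h: "h = (\<lambda>x. f (s * x + t))" and f: "f \<in> schwartz" by auto
  show "\<exists>h'\<in>lin_span ?X. \<forall>x. (h has_vector_derivative h' x) (at x)"
    using affine_has_vderiv[OF schwartz_smooth[OF f]] f schwartz_vderiv[OF f] h
    by (intro bexI[of _ "\<lambda>x. of_real s * vderiv f (s * x + t)"] lin_span.intros) auto
  show "bounded (range h)"
    using schwartz_decay[OF f, of 0] by (auto simp: h bounded_iff)
  have "(\<lambda>x. of_real x * h x) = (\<lambda>x. of_real (1 / s) * (of_real (s * x + t) * f (s * x + t))
      + of_real (- t / s) * f (s * x + t))"
    using \<open>s \<noteq> 0\<close> by (auto simp: h field_simps)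
  also have "\<dots> \<in> lin_span ?X"
  proof (rule lin_span_combine)
    show "(\<lambda>x. of_real (s * x + t) * f (s * x + t)) \<in> ?X"
      using schwartz_times_x[OF f] by (intro CollectI exI[of _ "\<lambda>x. of_real x * f x"]) simp
    show "(\<lambda>x. f (s * x + t)) \<in> ?X"
      using f by blast
  qed
  finally show "(\<lambda>x. of_real x * h x) \<in> lin_span ?X" .
qed (use assms in \<open>auto intro!: lin_span.base\<close>)

lemma schwartz_cnj:
  assumes "f \<in> schwartz"
  shows "(\<lambda>x::real. cnj (f x)) \<in> schwartz"
proof (rule schwartz_real_span[of "{\<lambda>x. cnj (f x) |f. f \<in> schwartz}"])
  let ?X = "{\<lambda>x::real. cnj (f x) |f. f \<in> schwartz}"
  fix h :: "real \<Rightarrow> complex"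
  assume "h \<in> ?X"
  then obtain f where h: "h = (\<lambda>x. cnj (f x))" and f: "f \<in> schwartz" by auto
  show "\<exists>h'\<in>lin_span ?X. \<forall>x. (h has_vector_derivative h' x) (at x)"
    using smooth_has_vderiv[OF schwartz_smooth[OF f]] f schwartz_vderiv[OF f] h
    by (intro bexI[of _ "\<lambda>x. cnj (vderiv f x)"] lin_span.intros)
       (auto intro: has_vector_derivative_cnj)
  show "bounded (range h)"
    using schwartz_decay[OF f, of 0] by (auto simp: h bounded_iff)
  have "(\<lambda>x. of_real x * h x) \<in> ?X"
    using schwartz_times_x[OF f] by (intro CollectI exI[of _ "\<lambda>x. of_real x * f x"]) (simp add: h)
  then show "(\<lambda>x. of_real x * h x) \<in> lin_span ?X"
    by (rule lin_span.base)
qed (use assms in \<open>auto intro!: lin_span.base\<close>)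

text \<open>Membership in \<^const>\<open>schwartz\<close> is insensitive to division by a power of the variable,
  as long as the quotient stays smooth: the class of these quotients is closed under
  differentiation, because \<open>x ^ (m + 1) * h'\<close> is \<open>x * (x ^ m * h)' - m * (x ^ m * h)\<close>.\<close>

lemma schwartz_cancel_monom:
  assumes "smooth h" "(\<lambda>x::real. of_real x ^ m * h x) \<in> schwartz"
  shows "h \<in> schwartz"
proof (rule schwartz_real_span[of "{h. smooth h \<and> (\<exists>m. (\<lambda>x. of_real x ^ m * h x) \<in> schwartz)}"])
  let ?X = "{h. smooth h \<and> (\<exists>m. (\<lambda>x::real. of_real x ^ m * h x) \<in> schwartz)}"
  fix h :: "real \<Rightarrow> complex"
  assume "h \<in> ?X"
  then obtain m where h: "smooth h" and m: "(\<lambda>x. of_real x ^ m * h x) \<in> schwartz" (is "?g \<in> _")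
    by auto
  have "((\<lambda>x. complex_of_real x ^ m) has_vector_derivative of_nat m * of_real x ^ (m - 1)) (at x)"
    for x
    using has_vector_derivative_of_real[OF DERIV_pow[of m x UNIV], where 'a=complex] by simp
  from has_vector_derivative_mult[OF this smooth_has_vderiv[OF h]]
  have der: "vderiv ?g = (\<lambda>x. of_real x ^ m * vderiv h x + of_nat m * of_real x ^ (m - 1) * h x)"
    by (intro vderiv_eqI)
  have "(\<lambda>x. of_real x ^ Suc m * vderiv h x) = (\<lambda>x. of_real x * vderiv ?g x - of_nat m * ?g x)"
    unfolding der by (cases m) (auto simp: algebra_simps)
  also have "\<dots> \<in> schwartz"
    by (intro schwartz_diff schwartz_times_x schwartz_vderiv schwartz_cmult m)
  finally have "vderiv h \<in> ?X"
    using smooth_vderiv[OF h] by blast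
  then show "\<exists>h'\<in>lin_span ?X. \<forall>x. (h has_vector_derivative h' x) (at x)"
    using smooth_has_vderiv[OF h] by (intro bexI[of _ "vderiv h"] lin_span.base) auto
  have "(\<lambda>x. of_real x ^ m * (of_real x * h x)) = (\<lambda>x. of_real x * ?g x)"
    by (simp add: mult_ac)
  then have "(\<lambda>x. of_real x * h x) \<in> ?X"
    using schwartz_times_x[OF m] smooth_mult[OF smooth_of_real h]
    by (intro CollectI conjI exI[of _ m]) simp_all
  then show "(\<lambda>x. of_real x * h x) \<in> lin_span ?X"
    by (rule lin_span.base)
  obtain K where K: "norm (?g x) \<le> K" for x
    using schwartz_decay[OF m, of 0] by auto
  have "bounded (h ` {-1..1})"
    using h by (intro compact_imp_bounded compact_continuous_image smooth_continuous) auto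
  then obtain L where L: "norm (h x) \<le> L" if "x \<in> {-1..1}" for x
    unfolding bounded_iff by blast
  have "norm (h x) \<le> max K L" for x
  proof (cases "x \<in> {-1..1}")
    case False
    then have "1 \<le> \<bar>x\<bar> ^ m" by (intro one_le_power) auto
    then have "1 * norm (h x) \<le> \<bar>x\<bar> ^ m * norm (h x)" by (intro mult_right_mono) auto
    also have "\<dots> \<le> K" using K[of x] by (simp add: norm_mult norm_power)
    finally show ?thesis by simp
  qed (use L in force)
  then show "bounded (range h)" by (auto simp: bounded_iff)
qed (use assms in \<open>auto intro!: lin_span.base\<close>)

subsection \<open>Test functions\<close>

lemma test_functions_iff:
  "f \<in> test_functions \<longleftrightarrow> smooth f \<and> (\<exists>M. \<forall>x::real. \<bar>x\<bar> > M \<longrightarrow> f x = 0)"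
proof -
  have "bounded {x. f x \<noteq> 0} \<longleftrightarrow> (\<exists>M. \<forall>x::real. \<bar>x\<bar> > M \<longrightarrow> f x = 0)"
    by (fastforce simp: bounded_iff not_less[symmetric])
  then show ?thesis
    by (simp add: test_functions_def compact_closure)
qed

lemma test_smooth: "f \<in> test_functions \<Longrightarrow> smooth f"
  by (simp add: test_functions_def)

lemma test_bound:
  assumes "f \<in> test_functions"
  obtains M where "M > 0" "\<And>x::real. \<bar>x\<bar> > M \<Longrightarrow> f x = 0"
proof -
  from assms obtain M where "\<And>x. \<bar>x\<bar> > M \<Longrightarrow> f x = 0"
    by (auto simp: test_functions_iff)
  then show ?thesis by (intro that[of "max M 1"]) auto
qed

lemma test_mult_smooth:
  assumes "smooth g" "f \<in> test_functions"
  shows "(\<lambda>x::real. g x * f x) \<in> test_functions"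
  using assms by (force simp: test_functions_iff intro: smooth_mult)

lemma test_add:
  assumes "f \<in> test_functions" "g \<in> test_functions"
  shows "(\<lambda>x::real. f x + g x) \<in> test_functions"
proof -
  obtain M N where "\<And>x. \<bar>x\<bar> > M \<Longrightarrow> f x = 0" "\<And>x. \<bar>x\<bar> > N \<Longrightarrow> g x = 0"
    using test_bound[OF assms(1)] test_bound[OF assms(2)] by metis
  then show ?thesis
    using assms by (auto simp: test_functions_iff intro!: smooth_add exI[of _ "max M N"])
qed

lemma vderiv_eq_0:
  assumes "open S" "x \<in> S" "\<And>y. y \<in> S \<Longrightarrow> f y = c"
  shows "vderiv f x = 0"
proof -
  have "(f has_vector_derivative 0) (at x)"
    by (rule has_vector_derivative_transform_within_open[of "\<lambda>_. c" _ _ S]) (use assms in auto)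
  then show ?thesis by (simp add: vderiv_def vector_derivative_at)
qed

lemma test_vderiv:
  assumes "f \<in> test_functions"
  shows "vderiv f \<in> test_functions"
proof -
  obtain M where M: "\<And>x. \<bar>x\<bar> > M \<Longrightarrow> f x = 0"
    using test_bound[OF assms] by metis
  have "vderiv f x = 0" if "\<bar>x\<bar> > M" for x
    using that M
    by (intro vderiv_eq_0[of "{y. \<bar>y\<bar> > M}" x f 0]) (auto intro!: open_Collect_less continuous_intros)
  then show ?thesis
    using assms smooth_vderiv by (auto simp: test_functions_iff)
qed

lemma test_affine:
  assumes "f \<in> test_functions" "s \<noteq> 0"
  shows "(\<lambda>x::real. f (s * x + t)) \<in> test_functions"
proof -
  obtain M where M: "\<And>x. \<bar>x\<bar> > M \<Longrightarrow> f x = 0"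
    using test_bound[OF assms(1)] by metis
  have "f (s * x + t) = 0" if "\<bar>x\<bar> > (M + \<bar>t\<bar>) / \<bar>s\<bar>" for x
  proof (rule M)
    have "M + \<bar>t\<bar> < \<bar>s\<bar> * \<bar>x\<bar>"
      using that \<open>s \<noteq> 0\<close> by (simp add: field_simps)
    then show "M < \<bar>s * x + t\<bar>" by (simp add: abs_mult[symmetric])
  qed
  then show ?thesis
    using assms smooth_affine by (auto simp: test_functions_iff)
qed

lemma test_cnj: "f \<in> test_functions \<Longrightarrow> (\<lambda>x::real. cnj (f x)) \<in> test_functions"
  by (auto simp: test_functions_iff intro: smooth_cnj)

lemma test_schwartz:
  assumes "f \<in> test_functions"
  shows "f \<in> (schwartz :: (real \<Rightarrow> complex) set)"
proof (rule schwartz_real_span[of test_functions])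
  fix f :: "real \<Rightarrow> complex"
  assume f: "f \<in> test_functions"
  show "\<exists>f'\<in>lin_span test_functions. \<forall>x. (f has_vector_derivative f' x) (at x)"
    using test_vderiv[OF f] smooth_has_vderiv[OF test_smooth[OF f]]
    by (intro bexI[of _ "vderiv f"]) (auto intro: lin_span.base)
  obtain M where M: "\<And>x. \<bar>x\<bar> > M \<Longrightarrow> f x = 0"
    using test_bound[OF f] by metis
  have "bounded (f ` {-M..M})"
    using f by (intro compact_imp_bounded compact_continuous_image smooth_continuous test_smooth) auto
  then obtain K where K: "norm (f x) \<le> K" if "x \<in> {-M..M}" for x
    unfolding bounded_iff by blast
  have "norm (f x) \<le> max K 0" for x
  proof (cases "x \<in> {-M..M}")
    case False
    then show ?thesis using M[of x] by auto
  qed (use K in force)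
  then show "bounded (range f)" by (auto simp: bounded_iff)
  show "(\<lambda>x. of_real x * f x) \<in> lin_span test_functions"
    using f by (intro lin_span.base test_mult_smooth) auto
qed (use assms in \<open>auto intro: lin_span.base\<close>)

subsection \<open>Integration over the line\<close>

lemma inverse_1_plus_square_lborel:
  "integrable lborel (\<lambda>x::real. inverse (1 + x\<^sup>2))"
  "(LINT x|lborel. inverse (1 + x\<^sup>2)) = pi"
  using integrable_inverse_1_plus_square LBINT_inverse_1_plus_square
  by (simp_all add: set_integrable_def einterval_def interval_lebesgue_integral_def
      set_lebesgue_integral_def)

text \<open>The weight \<open>1 + x\<^sup>2\<close> converts the pointwise bounds that define \<^const>\<open>schwartz\<close> into
  bounds for integrals.\<close>

lemma integral_weighted_bound:
  assumes f: "f \<in> borel_measurable borel"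
    and K: "\<And>x::real. (1 + x\<^sup>2) * norm (f x :: complex) \<le> K"
  shows "integrable lborel f" "(LINT x|lborel. norm (f x)) \<le> K * pi"
proof -
  have le: "norm (f x) \<le> K * inverse (1 + x\<^sup>2)" for x
    using K[of x] by (simp add: field_simps add_pos_nonneg)
  have int: "integrable lborel (\<lambda>x::real. K * inverse (1 + x\<^sup>2))"
    by (intro integrable_mult_right inverse_1_plus_square_lborel)
  show *: "integrable lborel f"
  proof (rule Bochner_Integration.integrable_bound[OF int])
    show "AE x in lborel. norm (f x) \<le> norm (K * inverse (1 + x\<^sup>2))"
      using le by (intro AE_I2) (smt (verit) real_norm_def)
  qed (use f in simp)
  have "(LINT x|lborel. norm (f x)) \<le> (LINT x|lborel. K * inverse (1 + x\<^sup>2))"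
    using le * int by (intro integral_mono) auto
  then show "(LINT x|lborel. norm (f x)) \<le> K * pi"
    by (simp add: inverse_1_plus_square_lborel)
qed

lemma schwartz_weighted:
  assumes "f \<in> schwartz"
  obtains K where "\<And>x::real. (1 + x\<^sup>2) * norm (f x) \<le> K"
proof -
  obtain K L where "\<And>x. \<bar>x\<bar> ^ 0 * norm (f x) \<le> K" "\<And>x. \<bar>x\<bar> ^ 2 * norm (f x) \<le> L"
    using schwartz_decay[OF assms, of 0] schwartz_decay[OF assms, of 2] by blast
  then have "(1 + x\<^sup>2) * norm (f x) \<le> K + L" for x
    using add_mono[of "norm (f x)" K "\<bar>x\<bar> ^ 2 * norm (f x)" L] by (simp add: algebra_simps)
  then show ?thesis by (rule that)
qed

lemma schwartz_measurable [measurable]: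
  "f \<in> schwartz \<Longrightarrow> f \<in> borel_measurable borel" for f :: "real \<Rightarrow> complex"
  using smooth_measurable[OF schwartz_smooth] .

lemma schwartz_integrable:
  assumes "f \<in> schwartz"
  shows "integrable lborel (f :: real \<Rightarrow> complex)"
  using schwartz_weighted[OF assms] integral_weighted_bound(1)[OF schwartz_measurable[OF assms]]
  by metis

lemma schwartz_tendsto_0:
  assumes "f \<in> schwartz"
  shows "(f \<longlongrightarrow> 0) (at_infinity :: real filter)"
proof -
  obtain K where K: "\<And>x. \<bar>x\<bar> ^ 1 * norm (f x) \<le> K"
    using schwartz_decay[OF assms, of 1] by blast
  have "((\<lambda>x::real. K * norm (inverse x)) \<longlongrightarrow> 0) at_infinity"
    using tendsto_inverse_0 by (rule tendsto_mult_right_zero[OF tendsto_norm_zero])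
  moreover have "norm (f x) \<le> K * norm (inverse x)" if "norm x \<ge> 1" for x
    using K[of x] that by (simp add: field_simps)
  then have "eventually (\<lambda>x. norm (f x) \<le> K * norm (inverse x)) at_infinity"
    by (auto simp: eventually_at_infinity intro!: exI[of _ 1])
  ultimately show ?thesis
    by (rule Lim_null_comparison[rotated])
qed

lemma integral_vderiv_eq_0:
  assumes "f \<in> schwartz"
  shows "(LINT x|lborel. vderiv f x) = 0"
proof -
  have "(LBINT x=-\<infinity>..\<infinity>. vderiv f x) = 0 - 0"
  proof (rule interval_integral_FTC_integrable)
    have "set_integrable lborel UNIV (vderiv f)"
      using schwartz_integrable[OF schwartz_vderiv[OF assms]] by (simp add: set_integrable_def)
    then show "set_integrable lborel (einterval (-\<infinity>) \<infinity>) (vderiv f)"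
      by (simp add: einterval_def)
    show "(f has_vector_derivative vderiv f x) (at x)" for x
      using smooth_has_vderiv[OF schwartz_smooth[OF assms]] .
    show "isCont (vderiv f) x" for x
      using smooth_continuous[OF smooth_vderiv[OF schwartz_smooth[OF assms]], of UNIV]
      by (simp add: continuous_on_eq_continuous_at)
    have "(f \<longlongrightarrow> 0) at_bot" "(f \<longlongrightarrow> 0) at_top"
      using schwartz_tendsto_0[OF assms] at_top_le_at_infinity at_bot_le_at_infinity
      by (auto intro: tendsto_mono)
    then show "((f \<circ> real_of_ereal) \<longlongrightarrow> 0) (at_right (-\<infinity>))"
      "((f \<circ> real_of_ereal) \<longlongrightarrow> 0) (at_left \<infinity>)"
      by (simp_all add: ereal_tendsto_simps)
  qed auto
  then show ?thesis
    by (simp add: interval_lebesgue_integral_def einterval_def set_lebesgue_integral_def)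
qed

section \<open>Cut-off functions and division by a linear factor\<close>

text \<open>Powers of \<open>1 / x\<close> are allowed as factors of \<open>exp (- 1 / x)\<close> because this makes the
  family closed under differentiation, also at 0.\<close>

definition flat :: "nat \<Rightarrow> real \<Rightarrow> real" where
  "flat n x = (if x > 0 then (1 / x) ^ n * exp (- (1 / x)) else 0)"

lemma flat_tendsto_0: "(flat n \<longlongrightarrow> 0) (at 0)"
proof (rule filterlim_split_at)
  have "eventually (\<lambda>x. flat n x = 0) (at_left 0)"
    by (simp add: eventually_at_filter flat_def)
  then show "(flat n \<longlongrightarrow> 0) (at_left 0)"
    by (rule tendsto_eventually)
  have "((\<lambda>x. inverse x ^ n / exp (inverse x)) \<longlongrightarrow> 0) (at_right (0::real))"
    using tendsto_power_div_exp_0 filterlim_inverse_at_top_right by (rule filterlim_compose)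
  moreover have "eventually (\<lambda>x. inverse x ^ n / exp (inverse x) = flat n x) (at_right 0)"
    by (simp add: eventually_at_filter flat_def exp_minus divide_inverse)
  ultimately show "(flat n \<longlongrightarrow> 0) (at_right 0)"
    by (rule Lim_transform_eventually)
qed

lemma flat_deriv:
  "(flat n has_field_derivative - real n * flat (Suc n) x + flat (n + 2) x) (at x)"
proof (cases x "0 :: real" rule: linorder_cases)
  case less
  then have "((\<lambda>_. 0) has_field_derivative - real n * flat (Suc n) x + flat (n + 2) x) (at x)"
    by (simp add: flat_def)
  then show ?thesis
    by (rule has_field_derivative_transform_within_open[of _ _ _ "{..<0}"])
       (use less in \<open>auto simp: flat_def\<close>)
next
  case equal
  have "((\<lambda>h. (flat n (0 + h) - flat n 0) / h) \<longlongrightarrow> 0) (at 0)"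
  proof (rule Lim_transform_eventually[OF flat_tendsto_0[of "Suc n"]])
    show "eventually (\<lambda>h. flat (Suc n) h = (flat n (0 + h) - flat n 0) / h) (at 0)"
      by (simp add: eventually_at_filter flat_def)
  qed
  then show ?thesis
    using equal by (simp add: DERIV_def flat_def)
next
  case greater
  have "((\<lambda>x. (1 / x) ^ n * exp (- (1 / x))) has_field_derivative
      - real n * flat (Suc n) x + flat (n + 2) x) (at x)"
  proof -
    have inv: "((\<lambda>x. 1 / x) has_field_derivative - ((1 / x) ^ 2)) (at x)"
      using greater by (auto intro!: derivative_eq_intros simp: power2_eq_square)
    have exp: "((\<lambda>x. exp (- (1 / x))) has_field_derivative exp (- (1 / x)) * (1 / x) ^ 2) (at x)"
      using DERIV_fun_exp[OF DERIV_minus[OF inv]] by simp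
    define y where "y = 1 / x"
    have "real n * (- (y ^ 2) * y ^ (n - Suc 0)) * exp (- y) + exp (- y) * y ^ 2 * y ^ n
        = - real n * flat (Suc n) x + flat (n + 2) x"
      using greater
      by (cases n) (simp_all add: flat_def y_def[symmetric] power2_eq_square algebra_simps)
    then show ?thesis
      using DERIV_mult[OF DERIV_power[OF inv, of n] exp] by (simp only: y_def)
  qed
  then show ?thesis
    by (rule has_field_derivative_transform_within_open[of _ _ _ "{0<..}"])
       (use greater in \<open>auto simp: flat_def\<close>)
qed

lemma flat_smooth: "smooth (\<lambda>x. complex_of_real (flat n x))"
proof (rule smooth_real_span[of "range (\<lambda>n x. complex_of_real (flat n x))"])
  let ?X = "range (\<lambda>n x. complex_of_real (flat n x))"
  fix f
  assume "f \<in> ?X"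
  then obtain n where f: "f = (\<lambda>x. of_real (flat n x))" by auto
  let ?f' = "\<lambda>x. (- of_nat n) * complex_of_real (flat (Suc n) x)
      + 1 * complex_of_real (flat (n + 2) x)"
  have "(f has_vector_derivative ?f' x) (at x)" for x
    using has_vector_derivative_of_real[OF flat_deriv[of n x], where 'a=complex] by (simp add: f)
  moreover have "?f' \<in> lin_span ?X"
    by (rule lin_span_combine) auto
  ultimately show "\<exists>f'\<in>lin_span ?X. \<forall>x. (f has_vector_derivative f' x) (at x)"
    by (intro bexI[of _ ?f'] allI)
qed (auto intro: lin_span.base)

text \<open>Since \<open>x\<close> and \<open>1 - x\<close> are never both nonpositive, the denominator has no zero.\<close>

definition step :: "real \<Rightarrow> real" where
  "step x = flat 0 x / (flat 0 x + flat 0 (1 - x))"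

lemma step_denominator: "flat 0 x + flat 0 (1 - x) > 0"
  by (cases "x > 0") (auto simp: flat_def intro: add_pos_nonneg)

lemma step_smooth: "smooth (\<lambda>x. complex_of_real (step x))"
proof -
  have "complex_of_real (flat 0 x + flat 0 (- 1 * x + 1)) \<noteq> 0" for x
    using step_denominator[of x] by (subst of_real_eq_0_iff) simp
  then have "smooth (\<lambda>x. of_real (flat 0 x) / (complex_of_real (flat 0 x) + of_real (flat 0 (- 1 * x + 1))))"
    unfolding of_real_add by (intro smooth_divide smooth_add flat_smooth smooth_affine[OF flat_smooth])
  then show ?thesis by (simp add: step_def)
qed

lemma step_nonneg: "step x \<ge> 0"
  using step_denominator[of x] by (simp add: step_def flat_def)

lemma step_eq: "x \<le> 0 \<Longrightarrow> step x = 0" "x \<ge> 1 \<Longrightarrow> step x = 1"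
  by (auto simp: step_def flat_def)

lemma bump_exists:
  assumes "\<eta> > 0"
  obtains p :: "real \<Rightarrow> real" where "(\<lambda>y. complex_of_real (p y)) \<in> test_functions"
    "p x = 1" "\<And>y. p y \<ge> 0" "\<And>y. \<bar>y - x\<bar> \<ge> \<eta> \<Longrightarrow> p y = 0"
proof -
  define p where
    "p y = step ((1 / \<eta>) * y + (1 - x / \<eta>)) * step ((- 1 / \<eta>) * y + (1 + x / \<eta>))" for y
  have p: "p y = step (1 + (y - x) / \<eta>) * step (1 - (y - x) / \<eta>)" for y
    by (simp add: p_def diff_divide_distrib algebra_simps)
  have van: "p y = 0" if "\<bar>y - x\<bar> \<ge> \<eta>" for y
  proof -
    have "(y - x) / \<eta> \<ge> 1 \<or> (y - x) / \<eta> \<le> -1"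
      using that assms by (auto simp: field_simps abs_le_iff abs_if split: if_splits)
    then show ?thesis by (auto simp: p step_eq)
  qed
  show thesis
  proof (rule that[of p])
    have "p y = 0" if "\<bar>y\<bar> > \<bar>x\<bar> + \<eta>" for y
      using that by (intro van) auto
    moreover have "smooth (\<lambda>y. complex_of_real (p y))"
      unfolding p_def of_real_mult by (intro smooth_mult smooth_affine[OF step_smooth])
    ultimately show "(\<lambda>y. complex_of_real (p y)) \<in> test_functions"
      by (auto simp: test_functions_iff)
    show "p x = 1" by (simp add: p step_eq)
    show "p y \<ge> 0" for y by (simp add: p step_nonneg)
  qed (rule van)
qed

lemma cutoff_exists:
  obtains \<theta> :: "real \<Rightarrow> complex" where "\<theta> \<in> test_functions" "\<And>x. \<bar>x\<bar> \<le> 1 \<Longrightarrow> \<theta> x = 1"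
proof -
  define \<theta> where
    "\<theta> x = complex_of_real (step (1 * x + 2)) * complex_of_real (step (- 1 * x + 2))" for x
  have "\<theta> x = 0" if "\<bar>x\<bar> > 2" for x
    using that by (cases "x \<ge> 0") (auto simp: step_eq \<theta>_def)
  moreover have "smooth \<theta>"
    unfolding \<theta>_def by (intro smooth_mult smooth_affine[OF step_smooth])
  ultimately have "\<theta> \<in> test_functions"
    by (auto simp: test_functions_iff)
  moreover have "\<theta> x = 1" if "\<bar>x\<bar> \<le> 1" for x
    using that by (simp add: step_eq abs_le_iff \<theta>_def)
  ultimately show thesis by (intro that[of \<theta>])
qed

text \<open>Hadamard's lemma: if \<open>f\<close> vanishes at 0, then \<open>f x / x\<close> is the average of \<open>f'\<close> over the
  segment from 0 to \<open>x\<close>, which is visibly smooth in \<open>x\<close>.\<close>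

lemma smooth_average:
  assumes "smooth g"
  shows "smooth (\<lambda>x. integral {0..1} (\<lambda>s. of_real s ^ k * g (s * x)))"
proof (rule smooth_real_span[of
      "{\<lambda>x. integral {0..1} (\<lambda>s. of_real s ^ k * g (s * x)) |g k. smooth g}"])
  let ?X = "{\<lambda>x. integral {0..1} (\<lambda>s. of_real s ^ k * g (s * x)) |g k. smooth g}"
  fix h
  assume "h \<in> ?X"
  then obtain g k where h: "h = (\<lambda>x. integral {0..1} (\<lambda>s. of_real s ^ k * g (s * x)))"
    and g: "smooth g" by auto
  let ?h' = "\<lambda>x. integral {0..1} (\<lambda>s. of_real s ^ Suc k * vderiv g (s * x))"
  have "(h has_vector_derivative ?h' x) (at x)" for x
  proof -
    have "((\<lambda>x. integral (cbox 0 1) (\<lambda>s. of_real s ^ k * g (s * x))) has_vector_derivative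
        integral (cbox 0 1) (\<lambda>s. of_real s ^ Suc k * vderiv g (s * x))) (at x within UNIV)"
    proof (rule leibniz_rule_vector_derivative[where U = UNIV
          and f = "\<lambda>x s. of_real s ^ k * g (s * x)"
          and fx = "\<lambda>x s. of_real s ^ Suc k * vderiv g (s * x)"])
      fix x s :: real
      have "((\<lambda>x. g (s * x)) has_vector_derivative of_real s * vderiv g (s * x)) (at x)"
        using affine_has_vderiv[OF g, of s 0 x] by simp
      then show "((\<lambda>x. of_real s ^ k * g (s * x)) has_vector_derivative
          of_real s ^ Suc k * vderiv g (s * x)) (at x within UNIV)"
        by (auto intro!: derivative_eq_intros simp: mult_ac)
      show "(\<lambda>s. of_real s ^ k * g (s * x)) integrable_on cbox 0 1"
        by (intro integrable_continuous continuous_intros smooth_continuous_compose[OF g])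
      show "continuous_on (UNIV \<times> cbox 0 1)
          (\<lambda>(x, s). of_real s ^ Suc k * vderiv g (s * x))"
        unfolding split_beta
        by (intro continuous_intros smooth_continuous_compose[OF smooth_vderiv[OF g]])
    qed auto
    then show ?thesis by (simp add: h)
  qed
  moreover have "?h' \<in> lin_span ?X"
    using smooth_vderiv[OF g] by (intro lin_span.base) blast
  ultimately show "\<exists>h'\<in>lin_span ?X. \<forall>x. (h has_vector_derivative h' x) (at x)"
    by (intro bexI[of _ ?h'] allI)
qed (use assms in \<open>auto intro!: lin_span.base\<close>)

lemma hadamard:
  assumes f: "smooth f" and "f c = 0"
  obtains h where "smooth h" "\<And>x. f x = of_real (x - c) * h x"
proof -
  define g where "g x = f (1 * x + c)" for x
  define h where "h x = integral {0..1} (\<lambda>s. of_real s ^ 0 * vderiv g (s * x))" for x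
  have g: "smooth g" unfolding g_def by (rule smooth_affine[OF f])
  have factor: "g x = of_real x * h x" for x
  proof -
    have der: "((\<lambda>s. g (x * s + 0)) has_vector_derivative of_real x * vderiv g (x * s + 0))
        (at s within {0..1})" for s
      by (rule has_vector_derivative_at_within[OF affine_has_vderiv[OF g]])
    have "((\<lambda>s. of_real x * vderiv g (x * s + 0)) has_integral
        (\<lambda>s. g (x * s + 0)) 1 - (\<lambda>s. g (x * s + 0)) 0) {0..1}"
      using der by (intro fundamental_theorem_of_calculus) auto
    then have "integral {0..1} (\<lambda>s. of_real x * vderiv g (x * s + 0)) = g x"
      using \<open>f c = 0\<close> by (subst integral_unique) (auto simp: g_def)
    then show ?thesis by (simp add: mult.commute h_def)
  qed
  show thesis
  proof (rule that[of "\<lambda>x. h (1 * x + (- c))"])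
    have "smooth h"
      unfolding h_def by (rule smooth_average[OF smooth_vderiv[OF g]])
    then show "smooth (\<lambda>x. h (1 * x + - c))"
      by (rule smooth_affine)
    show "f x = of_real (x - c) * h (1 * x + - c)" for x
      using factor[of "x - c"] by (simp add: g_def)
  qed
qed

section \<open>The Fourier transform on Schwartz functions\<close>

lemma fourier_cis: "fourier f \<omega> = (LINT t|lborel. f t * cis (- (2 * pi * \<omega> * t)))"
  by (simp add: fourier_def cis_conv_exp mult_ac)

lemma continuous_on_cis [continuous_intros]:
  "continuous_on S f \<Longrightarrow> continuous_on S (\<lambda>x. cis (f x))"
  unfolding cis_conv_exp by (intro continuous_intros)

lemma cis_measurable [measurable]: "f \<in> borel_measurable M \<Longrightarrow> (\<lambda>x. cis (f x)) \<in> borel_measurable M"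
  by (rule measurable_compose[OF _ borel_measurable_continuous_onI])
     (auto intro!: continuous_intros)

lemma integrable_mult_cis:
  assumes "integrable M f" "\<theta> \<in> borel_measurable M"
  shows "integrable M (\<lambda>t. f t * cis (\<theta> t))"
  by (rule Bochner_Integration.integrable_bound[OF assms(1)])
     (use assms in \<open>auto simp: norm_mult\<close>)

lemma fourier_integrable:
  assumes "integrable lborel f"
  shows "integrable lborel (\<lambda>t. f t * cis (- (2 * pi * \<omega> * t)))"
  by (rule integrable_mult_cis[OF assms]) measurable

lemma fourier_cmult: "fourier (\<lambda>t. c * f t) \<omega> = c * fourier f \<omega>"
  by (simp add: fourier_cis mult.assoc)

lemma fourier_add:
  assumes "f \<in> schwartz" "g \<in> schwartz"
  shows "fourier (\<lambda>t. f t + g t) \<omega> = fourier f \<omega> + fourier g \<omega>"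
  using assms[THEN schwartz_integrable, THEN fourier_integrable]
  by (simp add: fourier_cis distrib_right)

lemma fourier_diff:
  assumes "f \<in> schwartz" "g \<in> schwartz"
  shows "fourier (\<lambda>t. f t - g t) \<omega> = fourier f \<omega> - fourier g \<omega>"
  using assms[THEN schwartz_integrable, THEN fourier_integrable]
  by (simp add: fourier_cis left_diff_distrib)

lemma norm_fourier_le: "norm (fourier f \<omega>) \<le> (LINT t|lborel. norm (f t))"
  unfolding fourier_cis by (rule order_trans[OF integral_norm_bound]) (simp add: norm_mult)

lemma norm_cis_second_order: "norm (cis \<theta> - 1 - \<i> * of_real \<theta>) \<le> \<theta>\<^sup>2"
proof -
  have "cmod (iexp \<theta> - (\<Sum>k\<le>1. (\<i> * of_real \<theta>) ^ k / fact k)) \<le> \<bar>\<theta>\<bar> ^ Suc 1 / fact (Suc 1)"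
    by (rule iexp_approx1)
  also have "\<dots> \<le> \<theta>\<^sup>2" by (simp add: power2_eq_square)
  finally show ?thesis by (simp add: cis_conv_exp diff_diff_eq)
qed

text \<open>Differentiation under the integral sign: by the second-order estimate for the
  exponential, the remainder of the difference quotient is controlled by the second moment.\<close>

lemma fourier_has_vderiv:
  assumes f: "f \<in> schwartz"
  shows "(fourier f has_vector_derivative
    fourier (\<lambda>t. (- 2 * pi * \<i>) * (of_real t * f t)) \<omega>) (at \<omega>)"
proof -
  define f1 where "f1 t = (- 2 * pi * \<i>) * (of_real t * f t)" for t
  define f2 where "f2 t = of_real t * (of_real t * f t)" for t
  have f1: "f1 \<in> schwartz" and f2: "f2 \<in> schwartz"
    unfolding f1_def f2_def
    by (rule schwartz_cmult[OF schwartz_times_x[OF f]],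
        rule schwartz_times_x[OF schwartz_times_x[OF f]])
  define K where "K = (LINT t|lborel. (2 * pi)\<^sup>2 * norm (f2 t))"
  have bound: "norm (fourier f y - fourier f \<omega> - (y - \<omega>) *\<^sub>R fourier f1 \<omega>) \<le> K * (y - \<omega>)\<^sup>2" for y
  proof -
    define e where "e y t = cis (- (2 * pi * y * t))" for y t
    define \<theta> where "\<theta> t = - (2 * pi * (y - \<omega>) * t)" for t
    define g where "g t = f t * e y t - f t * e \<omega> t - (y - \<omega>) *\<^sub>R (f1 t * e \<omega> t)" for t
    have int: "integrable lborel (\<lambda>t. f t * e y t)" "integrable lborel (\<lambda>t. f t * e \<omega> t)"
      "integrable lborel (\<lambda>t. f1 t * e \<omega> t)"
      unfolding e_def by (intro fourier_integrable schwartz_integrable[OF f] schwartz_integrable[OF f1])+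
    then have g_int: "integrable lborel g"
      unfolding g_def by simp
    have "fourier f y - fourier f \<omega> - (y - \<omega>) *\<^sub>R fourier f1 \<omega> = (LINT t|lborel. g t)"
      using int unfolding fourier_cis g_def by (simp add: e_def)
    also have "norm \<dots> \<le> (LINT t|lborel. norm (g t))"
      by (rule integral_norm_bound)
    also have "\<dots> \<le> (LINT t|lborel. (y - \<omega>)\<^sup>2 * ((2 * pi)\<^sup>2 * norm (f2 t)))"
    proof (rule integral_mono)
      show "integrable lborel (\<lambda>t. norm (g t))"
        using g_int by (rule integrable_norm)
      show "integrable lborel (\<lambda>t. (y - \<omega>)\<^sup>2 * ((2 * pi)\<^sup>2 * norm (f2 t)))"
        using schwartz_integrable[OF f2] by simp
      fix t
      have "- (2 * pi * y * t) = \<theta> t + - (2 * pi * \<omega> * t)"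
        by (simp add: \<theta>_def algebra_simps)
      then have e: "e y t = cis (\<theta> t) * e \<omega> t"
        by (simp only: cis_mult e_def)
      have "g t = f t * e \<omega> t * (cis (\<theta> t) - 1 - \<i> * of_real (\<theta> t))"
        by (simp add: g_def e f1_def \<theta>_def algebra_simps scaleR_conv_of_real)
      then have "norm (g t) = norm (f t) * norm (cis (\<theta> t) - 1 - \<i> * of_real (\<theta> t))"
        by (simp add: norm_mult e_def)
      also have "\<dots> \<le> norm (f t) * (\<theta> t)\<^sup>2"
        by (intro mult_left_mono norm_cis_second_order) simp
      also have "\<dots> = (y - \<omega>)\<^sup>2 * ((2 * pi)\<^sup>2 * norm (f2 t))"
        by (simp add: norm_mult power2_eq_square \<theta>_def f2_def)
      finally show "norm (g t) \<le> (y - \<omega>)\<^sup>2 * ((2 * pi)\<^sup>2 * norm (f2 t))" .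
    qed
    also have "\<dots> = K * (y - \<omega>)\<^sup>2"
      by (simp add: K_def)
    finally show ?thesis .
  qed
  have "((\<lambda>y. K * \<bar>y - \<omega>\<bar>) \<longlongrightarrow> K * \<bar>\<omega> - \<omega>\<bar>) (at \<omega>)"
    by (intro tendsto_intros)
  then have lim: "((\<lambda>y. K * \<bar>y - \<omega>\<bar>) \<longlongrightarrow> 0) (at \<omega>)"
    by simp
  have "norm ((fourier f y - fourier f \<omega> - (y - \<omega>) *\<^sub>R fourier f1 \<omega>) /\<^sub>R norm (y - \<omega>))
      \<le> K * \<bar>y - \<omega>\<bar>" if "y \<noteq> \<omega>" for y
  proof -
    have "norm ((fourier f y - fourier f \<omega> - (y - \<omega>) *\<^sub>R fourier f1 \<omega>) /\<^sub>R norm (y - \<omega>))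
      = norm (fourier f y - fourier f \<omega> - (y - \<omega>) *\<^sub>R fourier f1 \<omega>) / \<bar>y - \<omega>\<bar>"
      by (simp add: divide_inverse mult.commute)
    also have "\<dots> \<le> K * (y - \<omega>)\<^sup>2 / \<bar>y - \<omega>\<bar>"
      by (intro divide_right_mono bound) simp
    also have "\<dots> = K * \<bar>y - \<omega>\<bar>"
    proof -
      have "K * (a * a) / a = K * a" if "a \<noteq> 0" for a :: real using that by simp
      from this[of "\<bar>y - \<omega>\<bar>"] show ?thesis
        using that by (simp add: power2_eq_square)
    qed
    finally show ?thesis .
  qed
  then have "eventually (\<lambda>y. norm ((fourier f y - fourier f \<omega> - (y - \<omega>) *\<^sub>R fourier f1 \<omega>) /\<^sub>R norm (y - \<omega>))
      \<le> K * \<bar>y - \<omega>\<bar>) (at \<omega>)"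
    by (simp add: eventually_at_filter)
  from Lim_null_comparison[OF this lim]
  have "(fourier f has_vector_derivative fourier f1 \<omega>) (at \<omega>)"
    unfolding has_vector_derivative_def has_derivative_at_within
    by (simp add: bounded_linear_scaleR_left)
  then show ?thesis unfolding f1_def .
qed

lemma vderiv_fourier:
  assumes "f \<in> schwartz"
  shows "vderiv (fourier f) = fourier (\<lambda>t. (- 2 * pi * \<i>) * (of_real t * f t))"
  by (rule vderiv_eqI[OF fourier_has_vderiv[OF assms]])

lemma cis_has_vderiv:
  "((\<lambda>t. cis (s * t)) has_vector_derivative \<i> * of_real s * cis (s * t)) (at t)"
proof -
  have "((\<lambda>z. exp (\<i> * of_real s * z)) has_field_derivative
      exp (\<i> * of_real s * of_real t) * (\<i> * of_real s)) (at (of_real t))"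
    by (auto intro!: derivative_eq_intros)
  from has_vector_derivative_real_field[OF this]
  show ?thesis by (simp add: cis_conv_exp o_def mult_ac)
qed

lemma schwartz_modulate:
  assumes "f \<in> schwartz"
  shows "(\<lambda>t::real. f t * cis (s * t)) \<in> schwartz"
    and "vderiv (\<lambda>t. f t * cis (s * t)) =
      (\<lambda>t. f t * (\<i> * of_real s * cis (s * t)) + vderiv f t * cis (s * t))"
proof -
  let ?X = "{\<lambda>t::real. f t * cis (s * t) |f. f \<in> schwartz}"
  have der: "((\<lambda>t. f t * cis (s * t)) has_vector_derivative
      f t * (\<i> * of_real s * cis (s * t)) + vderiv f t * cis (s * t)) (at t)"
    if "f \<in> schwartz" for f t
    by (rule has_vector_derivative_mult[OF smooth_has_vderiv[OF schwartz_smooth[OF that]]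
          cis_has_vderiv])
  then show "vderiv (\<lambda>t. f t * cis (s * t)) =
      (\<lambda>t. f t * (\<i> * of_real s * cis (s * t)) + vderiv f t * cis (s * t))"
    using assms by (intro vderiv_eqI) auto
  show "(\<lambda>t. f t * cis (s * t)) \<in> schwartz"
  proof (rule schwartz_real_span[of ?X])
    fix h
    assume "h \<in> ?X"
    then obtain f where h: "h = (\<lambda>t. f t * cis (s * t))" and f: "f \<in> schwartz" by auto
    let ?h' = "\<lambda>t. (\<i> * of_real s) * (f t * cis (s * t)) + 1 * (vderiv f t * cis (s * t))"
    have "(h has_vector_derivative ?h' t) (at t)" for t
      using der[OF f, of t] by (simp add: h mult_ac)
    moreover have "?h' \<in> lin_span ?X"
      using f schwartz_vderiv[OF f] by (intro lin_span_combine) blast+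
    ultimately show "\<exists>h'\<in>lin_span ?X. \<forall>x. (h has_vector_derivative h' x) (at x)"
      by (intro bexI[of _ ?h'] allI)
    show "bounded (range h)"
      using schwartz_decay[OF f, of 0] by (auto simp: h bounded_iff norm_mult)
    have "(\<lambda>t. of_real t * h t) \<in> ?X"
      using schwartz_times_x[OF f]
      by (intro CollectI exI[of _ "\<lambda>t. of_real t * f t"]) (simp add: h mult_ac)
    then show "(\<lambda>t. of_real t * h t) \<in> lin_span ?X"
      by (rule lin_span.base)
  qed (use assms in \<open>auto intro!: lin_span.base\<close>)
qed

lemma fourier_vderiv:
  assumes f: "f \<in> schwartz"
  shows "fourier (vderiv f) \<omega> = (2 * pi * \<i>) * of_real \<omega> * fourier f \<omega>"
proof -
  let ?s = "- (2 * pi * \<omega>)"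
  let ?e = "\<lambda>t. cis (?s * t)"
  have int: "integrable lborel (\<lambda>t. f t * ?e t)" "integrable lborel (\<lambda>t. vderiv f t * ?e t)"
    using schwartz_integrable[OF schwartz_modulate(1)[OF f]]
      schwartz_integrable[OF schwartz_modulate(1)[OF schwartz_vderiv[OF f]]] by blast+
  have "0 = (LINT t|lborel. vderiv (\<lambda>t. f t * ?e t) t)"
    using integral_vderiv_eq_0[OF schwartz_modulate(1)[OF f, of ?s]] by (simp only:)
  also have "\<dots> = (LINT t|lborel. (\<i> * of_real ?s) * (f t * ?e t) + vderiv f t * ?e t)"
    unfolding schwartz_modulate(2)[OF f] by (intro Bochner_Integration.integral_cong) (auto simp: mult_ac)
  also have "\<dots> = (\<i> * of_real ?s) * (LINT t|lborel. f t * ?e t) + (LINT t|lborel. vderiv f t * ?e t)"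
    using int by (subst Bochner_Integration.integral_add) auto
  finally show ?thesis
    by (simp add: fourier_cis algebra_simps)
qed

lemma fourier_schwartz:
  assumes "f \<in> schwartz"
  shows "fourier f \<in> schwartz"
proof (rule schwartz_real_span[of "fourier ` schwartz"])
  fix h
  assume "h \<in> fourier ` schwartz"
  then obtain f where h: "h = fourier f" and f: "f \<in> schwartz" by auto
  have "(\<lambda>t. (- 2 * pi * \<i>) * (of_real t * f t)) \<in> schwartz"
    using f by (intro schwartz_cmult schwartz_times_x)
  then have "fourier (\<lambda>t. (- 2 * pi * \<i>) * (of_real t * f t)) \<in> lin_span (fourier ` schwartz)"
    by (intro lin_span.base imageI)
  then show "\<exists>h'\<in>lin_span (fourier ` schwartz). \<forall>x. (h has_vector_derivative h' x) (at x)"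
    using fourier_has_vderiv[OF f] unfolding h by blast
  show "bounded (range h)"
    unfolding h bounded_iff using norm_fourier_le by blast
  have "of_real \<omega> * h \<omega> = fourier (\<lambda>t. 1 / (2 * pi * \<i>) * vderiv f t) \<omega>" for \<omega>
    by (simp only: fourier_cmult fourier_vderiv[OF f] h) simp
  then have "(\<lambda>\<omega>. of_real \<omega> * h \<omega>) = fourier (\<lambda>t. 1 / (2 * pi * \<i>) * vderiv f t)" by blast
  moreover have "(\<lambda>t. 1 / (2 * pi * \<i>) * vderiv f t) \<in> schwartz"
    by (intro schwartz_cmult schwartz_vderiv f)
  ultimately show "(\<lambda>\<omega>. of_real \<omega> * h \<omega>) \<in> lin_span (fourier ` schwartz)"
    by (auto intro: lin_span.base)
qed (use assms in \<open>auto intro: lin_span.base\<close>)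

lemma schwartz_funpow_vderiv: "f \<in> schwartz \<Longrightarrow> (vderiv ^^ k) f \<in> schwartz"
  by (induction k) (auto intro: schwartz_vderiv)

lemma fourier_funpow_vderiv:
  assumes "f \<in> schwartz"
  shows "fourier ((vderiv ^^ k) f) \<omega> = (2 * pi * \<i> * of_real \<omega>) ^ k * fourier f \<omega>"
proof (induction k)
  case (Suc k)
  then show ?case
    using fourier_vderiv[OF schwartz_funpow_vderiv[OF assms, of k], of \<omega>] by (simp add: mult_ac)
qed simp

lemma funpow_vderiv_fourier:
  assumes "f \<in> schwartz"
  shows "(vderiv ^^ l) (fourier f) = (\<lambda>\<omega>. (- 2 * pi * \<i>) ^ l * fourier (\<lambda>t. of_real t ^ l * f t) \<omega>)"
  using assms
proof (induction l)
  case (Suc l)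
  let ?g = "\<lambda>t. of_real t ^ l * f t"
  have g: "?g \<in> schwartz" by (rule schwartz_monom_mult[OF Suc.prems])
  have "((\<lambda>\<omega>. (- 2 * pi * \<i>) ^ l * fourier ?g \<omega>) has_vector_derivative
      (- 2 * pi * \<i>) ^ l * fourier (\<lambda>t. (- 2 * pi * \<i>) * (of_real t * ?g t)) \<omega>) (at \<omega>)" for \<omega>
    by (rule has_vector_derivative_mult_right[OF fourier_has_vderiv[OF g]])
  from vderiv_eqI[OF this]
  have "vderiv (\<lambda>\<omega>. (- 2 * pi * \<i>) ^ l * fourier ?g \<omega>) =
      (\<lambda>\<omega>. (- 2 * pi * \<i>) ^ Suc l * fourier (\<lambda>t. of_real t * ?g t) \<omega>)"
    by (simp only: fourier_cmult power_Suc2 mult.assoc)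
  moreover have "(\<lambda>t. of_real t * ?g t) = (\<lambda>t. of_real t ^ Suc l * f t)"
    by (simp add: mult_ac)
  ultimately show ?case
    using Suc.IH[OF Suc.prems] by (simp only: funpow.simps o_apply)
qed simp

subsection \<open>Interchange of integrals\<close>

text \<open>The sheared argument \<open>k * x + m * y\<close> of \<open>g\<close> arises when one of two linear forms is taken
  as the new variable of integration; a single substitution in \<open>y\<close> bounds the double integral by
  a product.\<close>

lemma schwartz_fubini:
  fixes f g :: "real \<Rightarrow> complex" and E :: "real \<Rightarrow> real \<Rightarrow> complex"
  assumes f: "f \<in> schwartz" and g: "g \<in> schwartz" and "m \<noteq> 0"
    and E: "continuous_on UNIV (\<lambda>z. E (fst z) (snd z))" "\<And>x y. norm (E x y) = 1"
  shows "(LINT y|lborel. LINT x|lborel. f x * g (k * x + m * y) * E x y)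
    = (LINT x|lborel. LINT y|lborel. f x * g (k * x + m * y) * E x y)"
proof (rule lborel_pair.Fubini_integral)
  let ?F = "\<lambda>z::real \<times> real. f (fst z) * g (k * fst z + m * snd z) * E (fst z) (snd z)"
  have "continuous_on UNIV ?F"
    by (intro continuous_intros E smooth_continuous_compose[OF schwartz_smooth[OF f]]
        smooth_continuous_compose[OF schwartz_smooth[OF g]])
  then have meas: "?F \<in> borel_measurable (lborel \<Otimes>\<^sub>M lborel)"
    unfolding lborel_prod by (simp add: borel_measurable_continuous_onI)
  have g_int: "integrable lborel (\<lambda>y. norm (g (k * x + m * y)))" for x
    using lborel_integrable_real_affine[OF schwartz_integrable[OF g] \<open>m \<noteq> 0\<close>]
    by (rule integrable_norm)
  have g_val: "(LINT y|lborel. norm (g (k * x + m * y))) = (LINT y|lborel. norm (g y)) / \<bar>m\<bar>" for x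
    using lborel_integral_real_affine[OF \<open>m \<noteq> 0\<close>, of "\<lambda>y. norm (g y)" "k * x"] \<open>m \<noteq> 0\<close>
    by simp
  have "integrable (lborel \<Otimes>\<^sub>M lborel) ?F"
  proof (rule lborel_pair.Fubini_integrable[OF meas])
    have "(LINT y|lborel. norm (?F (x, y))) = norm (f x) * ((LINT y|lborel. norm (g y)) / \<bar>m\<bar>)" for x
      by (simp add: norm_mult E g_val)
    then show "integrable lborel (\<lambda>x. LINT y|lborel. norm (?F (x, y)))"
      using integrable_mult_left[OF integrable_norm[OF schwartz_integrable[OF f]]] by simp
    have "integrable lborel (\<lambda>y. ?F (x, y))" for x
    proof (rule Bochner_Integration.integrable_bound[OF integrable_mult_right[OF g_int]])
      have "continuous_on UNIV (\<lambda>y. ?F (x, y))"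
        by (intro continuous_on_compose2[OF \<open>continuous_on UNIV ?F\<close>] continuous_intros) auto
      then show "(\<lambda>y. ?F (x, y)) \<in> borel_measurable lborel"
        by (simp add: borel_measurable_continuous_onI)
      show "AE y in lborel. norm (?F (x, y)) \<le> norm (norm (f x) * norm (g (k * x + m * y)))"
        by (simp add: norm_mult E)
    qed
    then show "AE x in lborel. integrable lborel (\<lambda>y. ?F (x, y))" by simp
  qed
  moreover have "?F = (\<lambda>(x, y). f x * g (k * x + m * y) * E x y)"
    by auto
  ultimately show "integrable (lborel \<Otimes>\<^sub>M lborel) (\<lambda>(x, y). f x * g (k * x + m * y) * E x y)"
    by simp
qed

lemma fourier_multiplication:
  assumes "f \<in> schwartz" "g \<in> schwartz"
  shows "(LINT y|lborel. fourier f y * g y) = (LINT x|lborel. f x * fourier g x)"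
proof -
  have "(LINT y|lborel. LINT x|lborel. f x * g (0 * x + 1 * y) * cis (- (2 * pi * y * x)))
      = (LINT x|lborel. LINT y|lborel. f x * g (0 * x + 1 * y) * cis (- (2 * pi * y * x)))"
    using assms by (intro schwartz_fubini continuous_intros) auto
  also have "\<dots> = (LINT x|lborel. f x * fourier g x)"
    unfolding fourier_cis integral_mult_right_zero[symmetric]
    by (intro Bochner_Integration.integral_cong refl) (simp add: mult_ac)
  also have "(LINT y|lborel. LINT x|lborel. f x * g (0 * x + 1 * y) * cis (- (2 * pi * y * x)))
      = (LINT y|lborel. fourier f y * g y)"
    unfolding fourier_cis integral_mult_left_zero[symmetric]
    by (intro Bochner_Integration.integral_cong refl) (simp add: mult_ac)
  finally show ?thesis .
qed

subsection \<open>Fourier inversion\<close>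

lemma integral_fourier_eq_0:
  assumes f: "f \<in> schwartz" and "f 0 = 0"
  shows "(LINT \<omega>|lborel. fourier f \<omega>) = 0"
proof -
  obtain h where h: "smooth h" "\<And>x. f x = of_real (x - 0) * h x"
    using hadamard[OF schwartz_smooth[OF f] \<open>f 0 = 0\<close>] by blast
  then have f_eq: "f = (\<lambda>x. of_real x ^ 1 * h x)" by auto
  have hs: "h \<in> schwartz"
    using f unfolding f_eq by (rule schwartz_cancel_monom[OF h(1)])
  have "fourier f \<omega> = - 1 / (2 * pi * \<i>) * vderiv (fourier h) \<omega>" for \<omega>
    unfolding vderiv_fourier[OF hs] f_eq fourier_cmult by simp
  then show ?thesis
    using integral_vderiv_eq_0[OF fourier_schwartz[OF hs]] by simp
qed

lemma fourier_translate:
  "fourier (\<lambda>t. f (t + y)) \<omega> = cis (2 * pi * \<omega> * y) * fourier f \<omega>"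
proof -
  have "fourier f \<omega> = (LINT t|lborel. f (y + 1 * t) * cis (- (2 * pi * \<omega> * (y + 1 * t))))"
    unfolding fourier_cis by (subst lborel_integral_real_affine[of 1 _ y]) auto
  also have "\<dots> = (LINT t|lborel. cis (- (2 * pi * \<omega> * y)) * (f (t + y) * cis (- (2 * pi * \<omega> * t))))"
  proof (intro Bochner_Integration.integral_cong refl)
    fix t
    have "cis (- (2 * pi * \<omega> * (y + 1 * t))) = cis (- (2 * pi * \<omega> * y)) * cis (- (2 * pi * \<omega> * t))"
      by (simp add: cis_mult algebra_simps)
    then show "f (y + 1 * t) * cis (- (2 * pi * \<omega> * (y + 1 * t)))
        = cis (- (2 * pi * \<omega> * y)) * (f (t + y) * cis (- (2 * pi * \<omega> * t)))"
      by (simp add: mult_ac add.commute)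
  qed
  finally have "fourier f \<omega> = cis (- (2 * pi * \<omega> * y)) * fourier (\<lambda>t. f (t + y)) \<omega>"
    by (simp add: fourier_cis)
  then show ?thesis by (simp add: cis_mult flip: mult.assoc)
qed

lemma fourier_cnj_reflect: "fourier (\<lambda>t. cnj (f (- t))) \<omega> = cnj (fourier f \<omega>)"
proof -
  have "cnj (fourier f \<omega>) = (LINT t|lborel. cnj (f t * cis (- (2 * pi * \<omega> * t))))"
    unfolding fourier_cis by (rule Bochner_Integration.integral_cnj[symmetric])
  also have "\<dots> = (LINT t|lborel. cnj (f (0 + (- 1) * t) * cis (- (2 * pi * \<omega> * (0 + (- 1) * t)))))"
    by (subst lborel_integral_real_affine[of "- 1" _ 0]) auto
  finally show ?thesis
    by (simp add: fourier_cis cis_cnj)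
qed

text \<open>The functional \<open>f \<mapsto> \<integral> fourier f\<close> annihilates the functions vanishing at 0, since
  \<open>fourier (\<lambda>x. x * h x)\<close> is a derivative; hence it is a multiple of the evaluation at 0.
  The multiple cannot be zero, as otherwise the multiplication formula would force
  \<open>\<integral> \<bar>fourier p\<bar>\<^sup>2 = 0\<close> for a bump \<open>p\<close>.\<close>

lemma fourier_inversion:
  obtains C where "C \<noteq> 0"
    and "\<And>f y. f \<in> schwartz \<Longrightarrow> fourier (fourier f) y = C * f (- y)"
proof -
  obtain p :: "real \<Rightarrow> real" where p: "(\<lambda>y. complex_of_real (p y)) \<in> test_functions"
    "p 0 = 1" "\<And>y. p y \<ge> 0" "\<And>y. \<bar>y - 0\<bar> \<ge> 1 \<Longrightarrow> p y = 0"
    using bump_exists[of 1 0] by auto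
  let ?p = "\<lambda>y. complex_of_real (p y)"
  have ps: "?p \<in> schwartz" by (rule test_schwartz[OF p(1)])
  define C where "C = (LINT \<omega>|lborel. fourier ?p \<omega>)"
  have const: "(LINT \<omega>|lborel. fourier f \<omega>) = f 0 * C" if f: "f \<in> schwartz" for f
  proof -
    have fp: "(\<lambda>x. f 0 * ?p x) \<in> schwartz" by (rule schwartz_cmult[OF ps])
    have "0 = (LINT \<omega>|lborel. fourier (\<lambda>x. f x - f 0 * ?p x) \<omega>)"
      using p f fp by (intro integral_fourier_eq_0[symmetric] schwartz_diff) auto
    also have "\<dots> = (LINT \<omega>|lborel. fourier f \<omega> - f 0 * fourier ?p \<omega>)"
      by (simp only: fourier_diff[OF f fp] fourier_cmult)
    also have "\<dots> = (LINT \<omega>|lborel. fourier f \<omega>) - f 0 * C"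
      using f ps by (simp add: C_def schwartz_integrable fourier_schwartz)
    finally show ?thesis by simp
  qed
  have inv: "fourier (fourier f) y = C * f (- y)" if f: "f \<in> schwartz" for f y
  proof -
    have "(\<lambda>t. f (1 * t + (- y))) \<in> schwartz" by (rule schwartz_affine[OF f]) simp
    from const[OF this] have "(LINT \<omega>|lborel. fourier (\<lambda>t. f (t + (- y))) \<omega>) = f (- y) * C"
      by simp
    then show ?thesis
      unfolding fourier_translate by (simp add: fourier_cis[of "fourier f"] mult_ac)
  qed
  have "C \<noteq> 0"
  proof
    assume "C = 0"
    define q where "q = (\<lambda>t. cnj (?p (- t)))"
    have q: "q \<in> schwartz"
      using schwartz_affine[OF schwartz_cnj[OF ps], of "- 1" 0] by (simp add: q_def)
    have q_hat: "fourier q \<omega> = cnj (fourier ?p \<omega>)" for \<omega>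
      unfolding q_def by (rule fourier_cnj_reflect)
    have "(LINT \<omega>|lborel. of_real ((cmod (fourier ?p \<omega>))\<^sup>2)) = (LINT \<omega>|lborel. fourier ?p \<omega> * fourier q \<omega>)"
      unfolding q_hat by (simp only: complex_norm_square)
    also have "\<dots> = (LINT x|lborel. ?p x * fourier (fourier q) x)"
      by (rule fourier_multiplication[OF ps fourier_schwartz[OF q]])
    also have "\<dots> = 0"
      using inv[OF q] \<open>C = 0\<close> by simp
    finally have zero: "(LINT \<omega>|lborel. (cmod (fourier ?p \<omega>))\<^sup>2) = 0"
      by (simp only: integral_complex_of_real of_real_eq_0_iff)
    have pos: "integral\<^sup>L lborel r > 0" if r: "continuous_on UNIV r" "\<And>x. r x \<ge> 0" "r 0 > 0"
      "integrable lborel r" for r :: "real \<Rightarrow> real"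
    proof -
      have "isCont r 0" using r(1) by (simp add: continuous_on_eq_continuous_at)
      then have "eventually (\<lambda>x. r x > r 0 / 2) (at 0)"
        using r(3) by (intro order_tendstoD(1)[OF isContD]) auto
      then obtain d where d: "d > 0" "\<And>x. x \<noteq> 0 \<Longrightarrow> \<bar>x\<bar> < d \<Longrightarrow> r x > r 0 / 2"
        by (auto simp: eventually_at dist_real_def)
      have "0 < d * (r 0 / 2)" using d r by simp
      also have "\<dots> = (LINT x|lborel. indicator {0<..<d} x * (r 0 / 2))"
        using d by simp
      also have "\<dots> \<le> integral\<^sup>L lborel r"
      proof (rule integral_mono)
        show "integrable lborel (\<lambda>x. indicator {0<..<d} x * (r 0 / 2))"
          using d by (intro integrable_mult_left) (auto intro!: integrable_real_indicator)
        show "indicator {0<..<d} x * (r 0 / 2) \<le> r x" for x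
          using d(2)[of x] r(2)[of x] by (auto simp: indicator_def)
      qed (rule r)
      finally show ?thesis .
    qed
    have "fourier ?p 0 = of_real (LINT x|lborel. p x)"
      by (simp add: fourier_cis)
    moreover have "(LINT x|lborel. p x) > 0"
    proof (rule pos)
      have "continuous_on UNIV (\<lambda>x. Re (?p x))"
        by (intro continuous_intros smooth_continuous[OF test_smooth[OF p(1)]])
      then show "continuous_on UNIV p" by simp
      show "integrable lborel p"
        using integrable_Re[OF schwartz_integrable[OF ps]] by simp
    qed (use p in auto)
    ultimately have nz: "(cmod (fourier ?p 0))\<^sup>2 > 0" by simp
    obtain K where K: "\<And>\<omega>. norm (fourier q \<omega>) \<le> K"
      using norm_fourier_le by blast
    have "integrable lborel (\<lambda>\<omega>. cmod (fourier ?p \<omega> * fourier q \<omega>))"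
    proof (intro integrable_norm Bochner_Integration.integrable_bound[OF
          integrable_mult_right[OF schwartz_integrable[OF fourier_schwartz[OF ps]], of "of_real K"]])
      show "AE \<omega> in lborel. norm (fourier ?p \<omega> * fourier q \<omega>) \<le> norm (of_real K * fourier ?p \<omega>)"
        using K order_trans[OF K abs_ge_self]
        by (intro AE_I2) (simp add: norm_mult mult.commute mult_right_mono)
    qed (use fourier_schwartz[OF ps] fourier_schwartz[OF q] in measurable)
    then have "integrable lborel (\<lambda>\<omega>. (cmod (fourier ?p \<omega>))\<^sup>2)"
      unfolding q_hat by (simp add: norm_mult power2_eq_square)
    then have "(LINT \<omega>|lborel. (cmod (fourier ?p \<omega>))\<^sup>2) > 0"
      using nz by (intro pos continuous_intros smooth_continuous schwartz_smooth
          fourier_schwartz ps) auto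
    with zero show False by simp
  qed
  then show thesis using inv by (rule that)
qed

lemma fourier_surj:
  assumes "f \<in> schwartz"
  obtains g where "g \<in> schwartz" "fourier g = f"
proof -
  obtain C where C: "C \<noteq> 0" "\<And>f y. f \<in> schwartz \<Longrightarrow> fourier (fourier f) y = C * f (- y)"
    by (rule fourier_inversion) blast
  let ?h = "\<lambda>x. f (- 1 * x + 0)"
  have h: "?h \<in> schwartz" by (rule schwartz_affine[OF assms]) simp
  show thesis
  proof (rule that[of "\<lambda>t. 1 / C * fourier ?h t"])
    show "(\<lambda>t. 1 / C * fourier ?h t) \<in> schwartz"
      by (intro schwartz_cmult fourier_schwartz h)
    show "fourier (\<lambda>t. 1 / C * fourier ?h t) = f"
      using C(1) by (simp only: fun_eq_iff fourier_cmult C(2)[OF h]) simp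
  qed
qed

section \<open>Density of the Fourier transforms of test functions\<close>

lemma tempered_add:
  "tempered_distribution u \<Longrightarrow> f \<in> schwartz \<Longrightarrow> g \<in> schwartz \<Longrightarrow> u (\<lambda>x. f x + g x) = u f + u g"
  and tempered_cmult:
  "tempered_distribution u \<Longrightarrow> f \<in> schwartz \<Longrightarrow> u (\<lambda>x. c * f x) = c * u f"
  unfolding tempered_distribution_def by blast+

lemma schwartz_seminorm_le:
  assumes "f \<in> schwartz" "set vs \<subseteq> (Basis :: real set)"
    and "\<And>x. \<bar>x\<bar> ^ k * norm ((vderiv ^^ length vs) f x) \<le> K"
  shows "schwartz_seminorm k vs f \<le> K"
  unfolding schwartz_seminorm_def
  using assms partial_derivs_real[OF schwartz_smooth[OF assms(1)] assms(2)]
  by (intro cSUP_least) auto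

text \<open>Only finitely many seminorms enter the continuity estimate of a tempered distribution, so
  the rate \<open>1 / (n + 1)\<close> survives their summation.\<close>

lemma tempered_tendsto_0:
  fixes u :: "real functional"
  assumes u: "tempered_distribution u" and h: "\<And>n. h n \<in> schwartz"
    and null: "\<And>k l. \<exists>K. \<forall>n x. \<bar>x\<bar> ^ k * norm ((vderiv ^^ l) (h n) x) \<le> K / real (Suc n)"
  shows "(\<lambda>n. u (h n)) \<longlonglongrightarrow> 0"
proof -
  obtain C N where C: "\<And>f. f \<in> schwartz \<Longrightarrow> norm (u f) \<le>
      C * (\<Sum>k\<le>N. \<Sum>vs | set vs \<subseteq> Basis \<and> length vs \<le> N. schwartz_seminorm k vs f)"
    using u unfolding tempered_distribution_def by blast
  let ?V = "{vs. set vs \<subseteq> (Basis :: real set) \<and> length vs \<le> N}"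
  obtain K where K: "\<And>k l n x. \<bar>x\<bar> ^ k * norm ((vderiv ^^ l) (h n) x) \<le> K k l / real (Suc n)"
    using null by metis
  define L where "L = (\<Sum>k\<le>N. \<Sum>vs\<in>?V. K k (length vs))"
  have bound: "norm (u (h n)) \<le> \<bar>C\<bar> * L * inverse (real (Suc n))" for n
  proof -
    let ?s = "\<Sum>k\<le>N. \<Sum>vs\<in>?V. schwartz_seminorm k vs (h n)"
    have nonneg: "schwartz_seminorm k vs (h n) \<ge> 0" if "vs \<in> ?V" for k vs
    proof -
      have "bdd_above (range (\<lambda>x. norm x ^ k * norm (partial_derivs vs (h n) x)))"
        using partial_derivs_real[OF schwartz_smooth[OF h[of n]], of vs] that
        by (intro bdd_aboveI[of _ "K k (length vs) / real (Suc n)"]) (auto simp del: of_nat_Suc intro!: K)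
      then have "norm (0::real) ^ k * norm (partial_derivs vs (h n) 0) \<le> schwartz_seminorm k vs (h n)"
        unfolding schwartz_seminorm_def by (intro cSUP_upper) auto
      then show ?thesis by (rule order_trans[rotated]) simp
    qed
    have "norm (u (h n)) \<le> C * ?s" by (rule C[OF h])
    also have "\<dots> \<le> \<bar>C\<bar> * ?s"
      using nonneg by (intro mult_right_mono sum_nonneg) auto
    also have "\<dots> \<le> \<bar>C\<bar> * (\<Sum>k\<le>N. \<Sum>vs\<in>?V. K k (length vs) * inverse (real (Suc n)))"
      using K by (intro mult_left_mono sum_mono schwartz_seminorm_le h) (auto simp: divide_inverse)
    also have "\<dots> = \<bar>C\<bar> * L * inverse (real (Suc n))"
      unfolding L_def by (simp add: sum_distrib_right)
    finally show ?thesis .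
  qed
  have "(\<lambda>n. \<bar>C\<bar> * L * inverse (real (Suc n))) \<longlonglongrightarrow> 0"
    by (rule tendsto_mult_right_zero[OF LIMSEQ_inverse_real_of_nat])
  then show ?thesis
    by (rule Lim_null_comparison[OF always_eventually[OF allI[OF bound]]])
qed

lemma vderiv_lincomb:
  assumes "smooth f" "smooth g"
  shows "vderiv (\<lambda>x. c * f x + g x) = (\<lambda>x. c * vderiv f x + vderiv g x)"
  by (rule vderiv_eqI)
     (intro has_vector_derivative_add has_vector_derivative_mult_right smooth_has_vderiv assms)

lemma funpow_vderiv_lincomb:
  assumes "smooth f" "smooth g"
  shows "(vderiv ^^ k) (\<lambda>x. c * f x + g x) = (\<lambda>x. c * (vderiv ^^ k) f x + (vderiv ^^ k) g x)"
  using assms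
proof (induction k arbitrary: f g)
  case (Suc k)
  show ?case
    using Suc.IH[OF smooth_vderiv[OF Suc.prems(1)] smooth_vderiv[OF Suc.prems(2)]]
    by (simp only: funpow_Suc_right o_apply vderiv_lincomb[OF Suc.prems])
qed simp

text \<open>Where \<open>\<theta> (x / (n + 1))\<close> does not vanish, \<open>\<bar>x\<bar>\<close> is at least \<open>n + 1\<close>, so one more power
  of \<open>x\<close> in the decay of \<open>g\<close> gains the factor \<open>1 / (n + 1)\<close>.  A derivative that falls on \<open>\<theta>\<close> produces
  another function of the same kind, with an even smaller factor; this is why \<open>\<theta>\<close> and \<open>g\<close> vary
  in the induction.\<close>

lemma tail_estimate:
  assumes "smooth \<theta>" "\<And>x. \<bar>x\<bar> < 1 \<Longrightarrow> \<theta> x = 0" "\<And>j. bounded (range ((vderiv ^^ j) \<theta>))"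
    and "g \<in> schwartz"
  shows "\<exists>K. \<forall>n x. (1 + x\<^sup>2) * norm ((vderiv ^^ k) (\<lambda>x. \<theta> (inverse (real (Suc n)) * x + 0) * g x) x)
    \<le> K / real (Suc n)"
  using assms
proof (induction k arbitrary: \<theta> g)
  case 0
  obtain B where B: "norm (\<theta> x) \<le> B" for x
    using "0.prems"(3)[of 0] by (auto simp: bounded_iff)
  have "B \<ge> 0" using order_trans[OF norm_ge_zero B] .
  obtain L where L: "(1 + x\<^sup>2) * norm (of_real x * g x) \<le> L" for x
    using schwartz_weighted[OF schwartz_times_x[OF "0.prems"(4)]] by metis
  have "L \<ge> 0" using order_trans[OF _ L[of 0]] by simp
  show ?case
  proof (intro exI[of _ "B * L"] allI)
    fix n and x :: real
    let ?t = "inverse (real (Suc n)) * x + 0"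
    show "(1 + x\<^sup>2) * norm ((vderiv ^^ 0) (\<lambda>x. \<theta> (inverse (real (Suc n)) * x + 0) * g x) x)
        \<le> B * L / real (Suc n)"
    proof (cases "\<bar>?t\<bar> < 1")
      case True
      then have "\<theta> ?t = 0" by (rule "0.prems"(2))
      then show ?thesis using \<open>B \<ge> 0\<close> \<open>L \<ge> 0\<close> by simp
    next
      case False
      then have x: "real (Suc n) \<le> \<bar>x\<bar>" by (simp add: abs_mult field_simps)
      have "real (Suc n) * ((1 + x\<^sup>2) * norm (g x)) \<le> \<bar>x\<bar> * ((1 + x\<^sup>2) * norm (g x))"
        using x by (rule mult_right_mono) simp
      also have "\<dots> \<le> L" using L[of x] by (simp add: norm_mult mult_ac)
      finally have "(1 + x\<^sup>2) * norm (g x) \<le> L / real (Suc n)"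
        by (simp add: pos_le_divide_eq mult.commute del: of_nat_Suc)
      then have "norm (\<theta> ?t) * ((1 + x\<^sup>2) * norm (g x)) \<le> B * (L / real (Suc n))"
        using B[of ?t] \<open>B \<ge> 0\<close> by (intro mult_mono) auto
      then show ?thesis by (simp add: norm_mult mult_ac)
    qed
  qed
next
  case (Suc k)
  let ?\<theta>' = "vderiv \<theta>" and ?g' = "vderiv g"
  have tail': "smooth ?\<theta>'" "\<And>x. \<bar>x\<bar> < 1 \<Longrightarrow> ?\<theta>' x = 0" "\<And>j. bounded (range ((vderiv ^^ j) ?\<theta>'))"
  proof -
    show "smooth ?\<theta>'" by (rule smooth_vderiv[OF Suc.prems(1)])
    show "?\<theta>' x = 0" if "\<bar>x\<bar> < 1" for x
      using that Suc.prems(2)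
      by (intro vderiv_eq_0[of "{y. \<bar>y\<bar> < 1}" x \<theta> 0])
         (auto intro!: open_Collect_less continuous_intros)
    show "bounded (range ((vderiv ^^ j) ?\<theta>'))" for j
      using Suc.prems(3)[of "Suc j"] by (simp add: funpow_swap1)
  qed
  obtain K1 where K1: "\<And>n x. (1 + x\<^sup>2) * norm ((vderiv ^^ k)
      (\<lambda>x. ?\<theta>' (inverse (real (Suc n)) * x + 0) * g x) x) \<le> K1 / real (Suc n)"
    using Suc.IH[OF tail' Suc.prems(4)] by blast
  obtain K2 where K2: "\<And>n x. (1 + x\<^sup>2) * norm ((vderiv ^^ k)
      (\<lambda>x. \<theta> (inverse (real (Suc n)) * x + 0) * ?g' x) x) \<le> K2 / real (Suc n)"
    using Suc.IH[OF Suc.prems(1-3) schwartz_vderiv[OF Suc.prems(4)]] by blast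
  show ?case
  proof (intro exI[of _ "K1 + K2"] allI)
    fix n and x :: real
    define c where "c = inverse (real (Suc n))"
    have c: "0 \<le> c" "c \<le> 1" by (auto simp: c_def inverse_eq_divide)
    define p where "p x = ?\<theta>' (c * x + 0) * g x" for x
    define q where "q x = \<theta> (c * x + 0) * ?g' x" for x
    have sm: "smooth p" "smooth q"
      unfolding p_def q_def
      by (rule smooth_mult[OF smooth_affine[OF tail'(1)] schwartz_smooth[OF Suc.prems(4)]],
          rule smooth_mult[OF smooth_affine[OF Suc.prems(1)]
            smooth_vderiv[OF schwartz_smooth[OF Suc.prems(4)]]])
    have "vderiv (\<lambda>x. \<theta> (c * x + 0) * g x) =
        (\<lambda>x. \<theta> (c * x + 0) * ?g' x + of_real c * ?\<theta>' (c * x + 0) * g x)"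
      by (intro vderiv_eqI has_vector_derivative_mult affine_has_vderiv Suc.prems
          smooth_has_vderiv schwartz_smooth)
    then have der: "vderiv (\<lambda>x. \<theta> (c * x + 0) * g x) = (\<lambda>x. of_real c * p x + q x)"
      by (simp add: p_def q_def mult_ac add.commute)
    have "(1 + x\<^sup>2) * norm ((vderiv ^^ Suc k) (\<lambda>x. \<theta> (c * x + 0) * g x) x)
        = (1 + x\<^sup>2) * norm (of_real c * (vderiv ^^ k) p x + (vderiv ^^ k) q x)"
      by (simp only: funpow_Suc_right o_apply der funpow_vderiv_lincomb[OF sm])
    also have "\<dots> \<le> (1 + x\<^sup>2) * (norm ((vderiv ^^ k) p x) + norm ((vderiv ^^ k) q x))"
    proof (rule mult_left_mono)
      have "norm (of_real c * (vderiv ^^ k) p x) \<le> 1 * norm ((vderiv ^^ k) p x)"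
        unfolding norm_mult using c by (intro mult_right_mono) auto
      then show "norm (of_real c * (vderiv ^^ k) p x + (vderiv ^^ k) q x)
          \<le> norm ((vderiv ^^ k) p x) + norm ((vderiv ^^ k) q x)"
        by (intro norm_triangle_le) simp
    qed simp
    also have "\<dots> \<le> (K1 + K2) / real (Suc n)"
      using K1[of x n] K2[of x n]
      by (simp add: p_def[abs_def] q_def[abs_def] c_def distrib_left add_divide_distrib)
    finally show "(1 + x\<^sup>2) * norm ((vderiv ^^ Suc k)
        (\<lambda>x. \<theta> (inverse (real (Suc n)) * x + 0) * g x) x) \<le> (K1 + K2) / real (Suc n)"
      by (simp only: c_def)
  qed
qed

lemma fourier_seminorm_le:
  assumes f: "f \<in> schwartz"
    and K: "\<And>x. (1 + x\<^sup>2) * norm ((vderiv ^^ k) (\<lambda>t. of_real t ^ l * f t) x) \<le> K"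
  shows "\<bar>\<omega>\<bar> ^ k * norm ((vderiv ^^ l) (fourier f) \<omega>) \<le> (2 * pi) ^ l * pi * K"
proof -
  define g where "g t = of_real t ^ l * f t" for t
  have g: "g \<in> schwartz" unfolding g_def by (rule schwartz_monom_mult[OF f])
  have dg: "(vderiv ^^ k) g \<in> schwartz" by (rule schwartz_funpow_vderiv[OF g])
  have "\<bar>\<omega>\<bar> ^ k * 1 \<le> \<bar>\<omega>\<bar> ^ k * (2 * pi) ^ k"
    using pi_ge_two by (intro mult_left_mono one_le_power) auto
  then have "\<bar>\<omega>\<bar> ^ k * norm (fourier g \<omega>) \<le> \<bar>\<omega>\<bar> ^ k * (2 * pi) ^ k * norm (fourier g \<omega>)"
    by (intro mult_right_mono) auto
  also have "\<dots> = norm (fourier ((vderiv ^^ k) g) \<omega>)"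
    by (simp add: fourier_funpow_vderiv[OF g] norm_mult norm_power power_mult_distrib)
  also have "\<dots> \<le> (LINT t|lborel. norm ((vderiv ^^ k) g t))"
    by (rule norm_fourier_le)
  also have "\<dots> \<le> K * pi"
    using K dg by (intro integral_weighted_bound) (auto simp: g_def[abs_def])
  finally have "(2 * pi) ^ l * (\<bar>\<omega>\<bar> ^ k * norm (fourier g \<omega>)) \<le> (2 * pi) ^ l * (K * pi)"
    by (intro mult_left_mono) auto
  then show ?thesis
    unfolding funpow_vderiv_fourier[OF f] g_def[symmetric]
    by (simp add: norm_mult norm_power mult_ac)
qed

text \<open>Every Schwartz function is a Fourier transform \<open>fourier g\<close>; splitting \<open>g\<close> by a cut-off at
  radius \<open>n\<close>, the remainder beyond that radius is of size \<open>O(1 / n)\<close> in every seminorm.\<close>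

lemma fourier_dist_nonzero:
  assumes u: "tempered_distribution u" and "\<exists>\<phi>\<in>schwartz. u \<phi> \<noteq> 0"
  obtains f where "f \<in> test_functions" "fourier_dist u f \<noteq> 0"
proof -
  obtain g where g: "g \<in> schwartz" and nz: "u (fourier g) \<noteq> 0"
    using assms(2) fourier_surj by metis
  obtain \<rho> :: "real \<Rightarrow> complex" where \<rho>: "\<rho> \<in> test_functions" "\<And>x. \<bar>x\<bar> \<le> 1 \<Longrightarrow> \<rho> x = 1"
    by (rule cutoff_exists) blast
  define \<theta> where "\<theta> x = (-1) * \<rho> x + 1" for x
  have \<theta>: "smooth \<theta>" unfolding \<theta>_def
    by (intro smooth_add smooth_cmult test_smooth \<rho> smooth_const)
  have d\<theta>: "(vderiv ^^ j) \<theta> = (\<lambda>x. (-1) * (vderiv ^^ j) \<rho> x + (vderiv ^^ j) (\<lambda>x. 1) x)" for j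
    unfolding \<theta>_def by (rule funpow_vderiv_lincomb[OF test_smooth[OF \<rho>(1)] smooth_const])
  have d1: "(vderiv ^^ j) (\<lambda>x. 1) = (\<lambda>x. if j = 0 then 1 else 0)" for j
    by (induction j) (auto intro!: vderiv_eqI)
  have bdd: "bounded (range ((vderiv ^^ j) \<theta>))" for j
  proof -
    obtain K where K: "norm ((vderiv ^^ j) \<rho> x) \<le> K" for x
      using schwartz_decay[OF schwartz_funpow_vderiv[OF test_schwartz[OF \<rho>(1)]], of 0 j] by auto
    have "norm ((vderiv ^^ j) \<theta> x) \<le> K + 1" for x
      unfolding d\<theta> d1 using K[of x] norm_triangle_ineq4[of 1 "(vderiv ^^ j) \<rho> x"] by auto
    then show ?thesis by (auto simp: bounded_iff)
  qed
  define h where "h n x = \<theta> (inverse (real (Suc n)) * x + 0) * g x" for n x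
  have decomp: "g = (\<lambda>x. \<rho> (inverse (real (Suc n)) * x + 0) * g x + h n x)" for n
    by (auto simp: h_def \<theta>_def algebra_simps)
  have cut: "(\<lambda>x. \<rho> (inverse (real (Suc n)) * x + 0) * g x) \<in> test_functions" for n
    using test_mult_smooth[OF schwartz_smooth[OF g] test_affine[OF \<rho>(1)], of "inverse (real (Suc n))" 0]
    by (simp add: mult.commute del: of_nat_Suc)
  have h: "h n \<in> schwartz" for n
  proof -
    have "h n = (\<lambda>x. g x - \<rho> (inverse (real (Suc n)) * x + 0) * g x)"
      by (auto simp: h_def \<theta>_def algebra_simps)
    then show ?thesis using schwartz_diff[OF g test_schwartz[OF cut]] by simp
  qed
  have lim: "(\<lambda>n. u (fourier (h n))) \<longlonglongrightarrow> 0"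
  proof (rule tempered_tendsto_0[OF u fourier_schwartz[OF h]])
    fix k l
    obtain K where K: "\<And>n x. (1 + x\<^sup>2) * norm ((vderiv ^^ k)
        (\<lambda>x. \<theta> (inverse (real (Suc n)) * x + 0) * (of_real x ^ l * g x)) x) \<le> K / real (Suc n)"
      using tail_estimate[OF \<theta> _ bdd schwartz_monom_mult[OF g, of l], of k] \<rho>(2)
      by (auto simp: \<theta>_def)
    have "(\<lambda>x. \<theta> (inverse (real (Suc n)) * x + 0) * (of_real x ^ l * g x)) =
        (\<lambda>x. of_real x ^ l * h n x)" for n
      by (simp add: h_def mult_ac)
    then have "\<bar>\<omega>\<bar> ^ k * norm ((vderiv ^^ l) (fourier (h n)) \<omega>) \<le> (2 * pi) ^ l * pi * (K / real (Suc n))"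
      for n \<omega>
      using K[of _ n] by (intro fourier_seminorm_le h) simp
    then show "\<exists>K. \<forall>n x. \<bar>x\<bar> ^ k * norm ((vderiv ^^ l) (fourier (h n)) x) \<le> K / real (Suc n)"
      by (intro exI[of _ "(2 * pi) ^ l * pi * K"]) simp
  qed
  have "\<exists>f\<in>test_functions. fourier_dist u f \<noteq> 0"
  proof (rule ccontr)
    assume "\<not> ?thesis"
    then have zero: "u (fourier f) = 0" if "f \<in> test_functions" for f
      using that by (auto simp: fourier_dist_def)
    have "u (fourier g) = u (fourier (h n))" for n
    proof -
      let ?r = "\<lambda>x. \<rho> (inverse (real (Suc n)) * x + 0) * g x"
      have "fourier g = (\<lambda>\<omega>. fourier ?r \<omega> + fourier (h n) \<omega>)"
        using fourier_add[OF test_schwartz[OF cut] h] by (subst decomp[of n]) blast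
      then have "u (fourier g) = u (fourier ?r) + u (fourier (h n))"
        using tempered_add[OF u fourier_schwartz[OF test_schwartz[OF cut]] fourier_schwartz[OF h]]
        by simp
      then show ?thesis using zero[OF cut] by simp
    qed
    then have "(\<lambda>n. u (fourier (h n))) \<longlonglongrightarrow> u (fourier g)" by simp
    with lim nz show False using LIMSEQ_unique by blast
  qed
  then show thesis using that by blast
qed

section \<open>Functionals with a local eigenvalue equation are discrete measures\<close>

text \<open>Values of distributions are meaningful on Schwartz functions only, and the arguments of
  this section use test functions only; so linearity is required just there.\<close>

definition test_linear :: "real functional \<Rightarrow> bool" where
  "test_linear S \<longleftrightarrow>
     (\<forall>f\<in>test_functions. \<forall>g\<in>test_functions. S (\<lambda>x. f x + g x) = S f + S g) \<and>
     (\<forall>f\<in>test_functions. \<forall>c. S (\<lambda>x. c * f x) = c * S f)"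

lemma test_linear_add:
  "test_linear S \<Longrightarrow> f \<in> test_functions \<Longrightarrow> g \<in> test_functions \<Longrightarrow> S (\<lambda>x. f x + g x) = S f + S g"
  and test_linear_cmult:
  "test_linear S \<Longrightarrow> f \<in> test_functions \<Longrightarrow> S (\<lambda>x. c * f x) = c * S f"
  unfolding test_linear_def by blast+

lemma test_cmult: "f \<in> test_functions \<Longrightarrow> (\<lambda>x::real. c * f x) \<in> test_functions"
  by (rule test_mult_smooth[OF smooth_const])

lemma test_zero: "(\<lambda>x::real. 0) \<in> test_functions"
  by (auto simp: test_functions_iff)

lemma test_linear_zero: "test_linear S \<Longrightarrow> S (\<lambda>x. 0) = 0"
  using test_linear_cmult[OF _ test_zero, of S 0] by simp

lemma test_linear_sum:
  assumes S: "test_linear S" and "finite J" "\<And>j. j \<in> J \<Longrightarrow> f j \<in> test_functions"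
  shows "(\<lambda>x. \<Sum>j\<in>J. f j x) \<in> test_functions \<and> S (\<lambda>x. \<Sum>j\<in>J. f j x) = (\<Sum>j\<in>J. S (f j))"
  using assms(2,3)
proof (induction J)
  case empty
  then show ?case using test_zero test_linear_zero[OF S] by simp
next
  case (insert j J)
  then have "f j \<in> test_functions" "(\<lambda>x. \<Sum>j\<in>J. f j x) \<in> test_functions" by auto
  then show ?case
    using insert test_add test_linear_add[OF S] by (simp add: insert.hyps)
qed

definition supp_in :: "real \<Rightarrow> real \<Rightarrow> (real \<Rightarrow> complex) set" where
  "supp_in l r = {f \<in> test_functions. \<forall>x. x \<notin> {l..r} \<longrightarrow> f x = 0}"

lemma supp_inD: "f \<in> supp_in l r \<Longrightarrow> f \<in> test_functions" "f \<in> supp_in l r \<Longrightarrow> x \<notin> {l..r} \<Longrightarrow> f x = 0"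
  by (auto simp: supp_in_def)

lemma supp_in_mult_smooth: "smooth g \<Longrightarrow> f \<in> supp_in l r \<Longrightarrow> (\<lambda>x. g x * f x) \<in> supp_in l r"
  by (simp add: supp_in_def test_mult_smooth)

lemma supp_in_add: "f \<in> supp_in l r \<Longrightarrow> g \<in> supp_in l r \<Longrightarrow> (\<lambda>x. f x + g x) \<in> supp_in l r"
  by (simp add: supp_in_def test_add)

text \<open>The translates of the difference of two consecutive steps form a partition of unity, since
  their sum telescopes.\<close>

definition tile :: "real \<Rightarrow> int \<Rightarrow> real \<Rightarrow> complex" where
  "tile w j x = complex_of_real (step (inverse w * x + - of_int j))
     - complex_of_real (step (inverse w * x + - of_int (j + 1)))"

lemma tile_smooth: "smooth (tile w j)"
  unfolding tile_def by (intro smooth_diff smooth_affine[OF step_smooth])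

lemma tile_eq_0:
  assumes "w > 0" "x \<notin> {of_int j * w..of_int j * w + 2 * w}"
  shows "tile w j x = 0"
proof -
  have "inverse w * x \<le> of_int j \<or> inverse w * x \<ge> of_int j + 2"
    using assms by (auto simp: field_simps)
  then show ?thesis by (auto simp: tile_def step_eq)
qed

lemma tile_supp_in:
  assumes "w > 0" "f \<in> test_functions"
  shows "(\<lambda>x. tile w j x * f x) \<in> supp_in (of_int j * w) (of_int j * w + 2 * w)"
  using tile_eq_0[OF assms(1)] test_mult_smooth[OF tile_smooth assms(2)] by (simp add: supp_in_def)

lemma tile_sum:
  "(\<Sum>j\<in>{- int n..<int n}. tile w j x)
    = of_real (step (inverse w * x + real n)) - of_real (step (inverse w * x + - real n))"
proof (induction n)
  case (Suc n)
  have "{- int (Suc n)..<int (Suc n)} = insert (- int (Suc n)) (insert (int n) {- int n..<int n})"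
    by auto
  then have "(\<Sum>j\<in>{- int (Suc n)..<int (Suc n)}. tile w j x)
      = tile w (- int (Suc n)) x + (tile w (int n) x + (\<Sum>j\<in>{- int n..<int n}. tile w j x))"
    by simp
  moreover have "tile w (- int (Suc n)) x
      = of_real (step (inverse w * x + real (Suc n))) - of_real (step (inverse w * x + real n))"
    "tile w (int n) x
      = of_real (step (inverse w * x + - real n)) - of_real (step (inverse w * x + - real (Suc n)))"
    by (simp_all add: tile_def add_ac)
  ultimately show ?case
    by (simp only: Suc.IH) simp
qed simp

lemma tile_partition:
  assumes "w > 0" "f \<in> test_functions"
  obtains N where "\<And>n. n \<ge> N \<Longrightarrow> f = (\<lambda>x. \<Sum>j\<in>{- int n..<int n}. tile w j x * f x)"
proof -
  obtain M where M: "\<And>x. \<bar>x\<bar> > M \<Longrightarrow> f x = 0"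
    using test_bound[OF assms(2)] by metis
  obtain N where N: "M / w + 1 \<le> real N" using real_arch_simple by blast
  show thesis
  proof (rule that[of N], rule ext)
    fix n and x :: real
    assume "N \<le> n"
    show "f x = (\<Sum>j\<in>{- int n..<int n}. tile w j x * f x)"
    proof (cases "\<bar>x\<bar> > M")
      case False
      then have "\<bar>inverse w * x\<bar> \<le> M / w"
        using assms(1) by (simp add: abs_mult divide_inverse mult.commute)
      then have "\<bar>inverse w * x\<bar> + 1 \<le> real n"
        using N \<open>N \<le> n\<close> by linarith
      then have "inverse w * x + real n \<ge> 1" "inverse w * x + - real n \<le> 0" by linarith+
      then have "(\<Sum>j\<in>{- int n..<int n}. tile w j x) = 1"
        unfolding tile_sum by (simp only: step_eq) simp
      then show ?thesis by (simp add: sum_distrib_right[symmetric])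
    qed (simp add: M)
  qed
qed

lemma test_linear_tiles:
  assumes "test_linear S" "w > 0" "f \<in> test_functions"
  obtains N where "\<And>n. n \<ge> N \<Longrightarrow> S f = (\<Sum>j\<in>{- int n..<int n}. S (\<lambda>x. tile w j x * f x))"
proof -
  obtain N where N: "\<And>n. n \<ge> N \<Longrightarrow> f = (\<lambda>x. \<Sum>j\<in>{- int n..<int n}. tile w j x * f x)"
    using tile_partition[OF assms(2,3)] by blast
  have "S f = (\<Sum>j\<in>{- int n..<int n}. S (\<lambda>x. tile w j x * f x))" if "n \<ge> N" for n
    using test_linear_sum[OF assms(1), of "{- int n..<int n}" "\<lambda>j x. tile w j x * f x"]
      N[OF that] test_mult_smooth[OF tile_smooth assms(3)] by simp
  then show thesis by (rule that)
qed

text \<open>The relation between \<open>S\<close> and \<open>R\<close> says that their tensor product is carried by the lines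
  \<open>\<alpha> p + \<beta> q \<in> B\<close> and involves no derivatives across these lines.  Fix a function \<open>g\<close> of
  small support with \<open>R g \<noteq> 0\<close>.  On a short window for \<open>p\<close> at most one line
  \<open>\<alpha> p + \<beta> q = s\<close> is visible, and on it \<open>p\<close> equals \<open>(s - \<beta> q) / \<alpha>\<close>; so multiplication by
  \<open>p\<close> can be moved from \<open>S\<close> to \<open>R\<close>, where it produces a scalar.\<close>

lemma local_eigenvalue:
  fixes S R :: "real functional"
  assumes S: "test_linear S" and R: "test_linear R" and "g \<in> test_functions" "R g \<noteq> 0"
    and ab: "\<alpha> \<noteq> 0" "\<beta> \<noteq> 0" and "uniform_discrete B"
    and SR: "\<And>f f1 g g1. f \<in> test_functions \<Longrightarrow> f1 \<in> test_functions \<Longrightarrow>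
      g \<in> test_functions \<Longrightarrow> g1 \<in> test_functions \<Longrightarrow>
      (\<And>p q. \<alpha> * p + \<beta> * q \<in> B \<Longrightarrow> f p * g1 q = f1 p * g q) \<Longrightarrow> S f * R g1 = S f1 * R g"
  obtains \<epsilon> where "\<epsilon> > 0"
    "\<And>l. \<exists>\<kappa>. \<forall>f\<in>supp_in l (l + \<epsilon>). S (\<lambda>x. (of_real x - \<kappa>) * f x) = 0"
proof -
  obtain \<delta> where \<delta>: "\<delta> > 0" "\<And>x y. x \<in> B \<Longrightarrow> y \<in> B \<Longrightarrow> dist x y < \<delta> \<Longrightarrow> x = y"
    using \<open>uniform_discrete B\<close> unfolding uniform_discrete_def by blast
  \<comment> \<open>With these window lengths \<open>\<alpha> p + \<beta> q\<close> varies by at most \<open>\<delta> / 2\<close>.\<close>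
  define w where "w = \<delta> / (8 * \<bar>\<beta>\<bar>)"
  define \<epsilon> where "\<epsilon> = \<delta> / (4 * \<bar>\<alpha>\<bar>)"
  have w: "w > 0" "\<bar>\<beta>\<bar> * (2 * w) = \<delta> / 4" and \<epsilon>: "\<epsilon> > 0" "\<bar>\<alpha>\<bar> * \<epsilon> = \<delta> / 4"
    using \<delta>(1) ab by (auto simp: w_def \<epsilon>_def)
  obtain N where N: "R g = (\<Sum>j\<in>{- int N..<int N}. R (\<lambda>x. tile w j x * g x))"
    using test_linear_tiles[OF R w(1) \<open>g \<in> test_functions\<close>] by blast
  have "\<exists>j. R (\<lambda>x. tile w j x * g x) \<noteq> 0"
  proof (rule ccontr)
    assume "\<not> ?thesis"
    then show False using N \<open>R g \<noteq> 0\<close> by simp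
  qed
  then obtain j where j: "R (\<lambda>x. tile w j x * g x) \<noteq> 0" ..
  define m where "m = of_int j * w"
  define g0 where "g0 x = tile w j x * g x" for x
  have g0: "g0 \<in> supp_in m (m + 2 * w)" "R g0 \<noteq> 0"
    unfolding g0_def m_def by (rule tile_supp_in[OF w(1) \<open>g \<in> test_functions\<close>]) (rule j)
  have one_line: "s = s'" if "s \<in> B" "s' \<in> B" "s = \<alpha> * p + \<beta> * q" "s' = \<alpha> * p' + \<beta> * q'"
    "p \<in> {l..l + \<epsilon>}" "p' \<in> {l..l + \<epsilon>}" "q \<in> {m..m + 2 * w}" "q' \<in> {m..m + 2 * w}"
    for s s' p p' q q' l
  proof (rule \<delta>(2)[OF that(1,2)])
    have "dist s s' = \<bar>\<alpha> * (p - p') + \<beta> * (q - q')\<bar>"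
      using that by (simp add: dist_real_def algebra_simps)
    also have "\<dots> \<le> \<bar>\<alpha>\<bar> * \<bar>p - p'\<bar> + \<bar>\<beta>\<bar> * \<bar>q - q'\<bar>"
      by (simp add: abs_mult[symmetric] abs_triangle_ineq)
    also have "\<dots> \<le> \<bar>\<alpha>\<bar> * \<epsilon> + \<bar>\<beta>\<bar> * (2 * w)"
      using that by (intro add_mono mult_left_mono) auto
    also have "\<dots> < \<delta>" using w \<epsilon> \<delta>(1) by simp
    finally show "dist s s' < \<delta>" .
  qed
  have "\<exists>\<kappa>. \<forall>f\<in>supp_in l (l + \<epsilon>). S (\<lambda>x. (of_real x - \<kappa>) * f x) = 0" for l
  proof (cases "\<exists>s\<in>B. \<exists>p\<in>{l..l + \<epsilon>}. \<exists>q\<in>{m..m + 2 * w}. s = \<alpha> * p + \<beta> * q")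
    case False
    have "S f = 0" if f: "f \<in> supp_in l (l + \<epsilon>)" for f
    proof -
      have "S f * R g0 = S (\<lambda>x. 0) * R g0"
      proof (rule SR)
        fix p q
        assume "\<alpha> * p + \<beta> * q \<in> B"
        then have "p \<notin> {l..l + \<epsilon>} \<or> q \<notin> {m..m + 2 * w}"
          using False by blast
        then show "f p * g0 q = 0 * g0 q"
          using supp_inD(2)[OF f] supp_inD(2)[OF g0(1)] by auto
      qed (use f g0 supp_inD test_zero in auto)
      then show ?thesis
        using g0(2) test_linear_zero[OF S] by simp
    qed
    then show ?thesis
      using supp_in_mult_smooth[OF smooth_of_real] by (intro exI[of _ 0]) auto
  next
    case True
    then obtain s p0 q0 where s: "s \<in> B" "p0 \<in> {l..l + \<epsilon>}" "q0 \<in> {m..m + 2 * w}" "s = \<alpha> * p0 + \<beta> * q0"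
      by blast
    define g1 where "g1 q = of_real (- \<beta> / \<alpha> * q + s / \<alpha>) * g0 q" for q
    have g1: "g1 \<in> test_functions"
      unfolding g1_def
      by (rule test_mult_smooth[OF smooth_affine[OF smooth_of_real] supp_inD(1)[OF g0(1)]])
    have "S (\<lambda>x. (of_real x - R g1 / R g0) * f x) = 0" if f: "f \<in> supp_in l (l + \<epsilon>)" for f
    proof -
      have ft: "f \<in> test_functions" using supp_inD(1)[OF f] .
      have xf: "(\<lambda>x. of_real x * f x) \<in> test_functions"
        by (rule test_mult_smooth[OF smooth_of_real ft])
      have eq: "S f * R g1 = S (\<lambda>x. of_real x * f x) * R g0"
      proof (rule SR)
        fix p q
        assume B: "\<alpha> * p + \<beta> * q \<in> B"
        show "f p * g1 q = of_real p * f p * g0 q"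
        proof (cases "p \<in> {l..l + \<epsilon>} \<and> q \<in> {m..m + 2 * w}")
          case True
          then have "s = \<alpha> * p + \<beta> * q"
            using one_line[OF s(1) B s(4) refl s(2) _ s(3)] by blast
          then have "- \<beta> / \<alpha> * q + s / \<alpha> = p"
            using ab by (simp add: field_simps)
          then show ?thesis by (simp add: g1_def)
        next
          case False
          then show ?thesis
            using supp_inD(2)[OF f] supp_inD(2)[OF g0(1)] by (auto simp: g1_def)
        qed
      qed (use ft xf g1 supp_inD(1)[OF g0(1)] in auto)
      have "S (\<lambda>x. (of_real x - R g1 / R g0) * f x) = S (\<lambda>x. of_real x * f x + (- (R g1 / R g0)) * f x)"
        by (simp add: algebra_simps)
      also have "\<dots> = S (\<lambda>x. of_real x * f x) + (- (R g1 / R g0)) * S f"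
        by (simp only: test_linear_add[OF S xf test_cmult[OF ft]] test_linear_cmult[OF S ft])
      also have "\<dots> = 0"
        using eq g0(2) by (simp add: field_simps)
      finally show ?thesis .
    qed
    then show ?thesis by blast
  qed
  with \<epsilon>(1) show thesis by (rule that)
qed

lemma continuous_isolated_zero:
  assumes "continuous_on UNIV h" "open U" "y \<in> U" "\<And>x. x \<in> U \<Longrightarrow> x \<noteq> y \<Longrightarrow> h x = 0"
  shows "h (y::real) = (0::complex)"
proof (rule tendsto_unique)
  show "(h \<longlongrightarrow> h y) (at y)"
    using assms(1) by (simp add: continuous_on_eq_continuous_at isCont_def)
  show "(h \<longlongrightarrow> 0) (at y)"
    using assms(2-4) by (intro tendsto_eventually) (auto simp: eventually_at_topological)
qed simp

text \<open>A functional killed by \<open>x - \<kappa>\<close> on a window vanishes on every function that is divisible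
  by \<open>x - \<kappa>\<close>, that is, on every function that vanishes at \<open>\<kappa>\<close>; so it is a multiple of the
  evaluation at \<open>\<kappa>\<close>.  If \<open>\<kappa>\<close> is not real or lies outside the window, all functions are
  divisible and the functional is zero there.\<close>

lemma local_point_mass:
  assumes S: "test_linear S" and "l \<le> r"
    and \<kappa>: "\<forall>f\<in>supp_in l r. S (\<lambda>x. (of_real x - \<kappa>) * f x) = 0"
  obtains y c where "y \<in> {l..r}" "\<And>f. f \<in> supp_in l r \<Longrightarrow> S f = c * f y"
proof -
  have zero: "S f = 0" if f: "f \<in> supp_in l r" and van: "\<And>y. \<kappa> = of_real y \<Longrightarrow> f y = 0" for f
  proof -
    have "\<exists>h\<in>supp_in l r. f = (\<lambda>x. (of_real x - \<kappa>) * h x)"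
    proof (cases "\<exists>y. \<kappa> = of_real y")
      case True
      then obtain y where y: "\<kappa> = of_real y" by blast
      obtain h where h: "smooth h" "\<And>x. f x = of_real (x - y) * h x"
        using hadamard[OF test_smooth[OF supp_inD(1)[OF f]] van[OF y]] by blast
      have off: "h x = 0" if "x \<notin> {l..r}" "x \<noteq> y" for x
        using h(2)[of x] supp_inD(2)[OF f that(1)] that(2) by simp
      have out: "h x = 0" if "x \<notin> {l..r}" for x
      proof (cases "x = y")
        case True
        show ?thesis
          unfolding True
          by (rule continuous_isolated_zero[OF smooth_continuous[OF h(1)], of "- {l..r}"])
             (use that True off in \<open>auto intro!: open_Compl\<close>)
      qed (use off that in auto)
      have "h x = 0" if "\<bar>x\<bar> > max \<bar>l\<bar> \<bar>r\<bar>" for x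
        using that by (intro out) auto
      then have "\<exists>M. \<forall>x. \<bar>x\<bar> > M \<longrightarrow> h x = 0" by blast
      then have "h \<in> supp_in l r"
        using h(1) out by (simp add: supp_in_def test_functions_iff)
      then show ?thesis using h(2) y by (intro bexI[of _ h]) auto
    next
      case False
      then have nz: "(- \<kappa>) + of_real x \<noteq> 0" for x by (metis add.commute add.inverse_inverse eq_neg_iff_add_eq_0)
      have "smooth (\<lambda>x. 1 / ((- \<kappa>) + of_real x))"
        by (intro smooth_divide smooth_add smooth_const smooth_of_real nz)
      from supp_in_mult_smooth[OF this f] show ?thesis
        using nz by (intro bexI[of _ "\<lambda>x. 1 / ((- \<kappa>) + of_real x) * f x"]) (auto simp: fun_eq_iff)
    qed
    then show ?thesis using \<kappa> by auto
  qed
  show thesis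
  proof (cases "\<exists>y \<phi>. \<kappa> = of_real y \<and> \<phi> \<in> supp_in l r \<and> \<phi> y \<noteq> 0")
    case True
    then obtain y \<phi> where y: "\<kappa> = of_real y" and \<phi>: "\<phi> \<in> supp_in l r" "\<phi> y \<noteq> 0" by blast
    show thesis
    proof (rule that[of y "S \<phi> / \<phi> y"])
      show "y \<in> {l..r}" using supp_inD(2)[OF \<phi>(1)] \<phi>(2) by blast
      fix f assume f: "f \<in> supp_in l r"
      have "(\<lambda>x. f x + (- (f y / \<phi> y)) * \<phi> x) \<in> supp_in l r"
        by (intro supp_in_add supp_in_mult_smooth smooth_const f \<phi>(1))
      then have "S (\<lambda>x. f x + (- (f y / \<phi> y)) * \<phi> x) = 0"
        using y \<phi>(2) by (intro zero) auto
      moreover have "S (\<lambda>x. f x + (- (f y / \<phi> y)) * \<phi> x) = S f + (- (f y / \<phi> y)) * S \<phi>"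
        by (simp only: test_linear_add[OF S supp_inD(1)[OF f] test_cmult[OF supp_inD(1)[OF \<phi>(1)]]]
          test_linear_cmult[OF S supp_inD(1)[OF \<phi>(1)]])
      ultimately show "S f = S \<phi> / \<phi> y * f y" by simp
    qed
  next
    case False
    then have "S f = 0" if "f \<in> supp_in l r" for f
      using that by (intro zero) auto
    then show thesis
      using \<open>l \<le> r\<close> by (intro that[of l 0]) auto
  qed
qed

text \<open>On the \<open>j\<close>-th tile \<open>S\<close> is a multiple of the evaluation at a node \<open>y j\<close>.  Neighbouring tiles
  overlap and may share their node, so the weights of all tiles with the same node are added.
  Two nodes of nonzero total weight at distance less than \<open>\<epsilon> / 2\<close> would lie inside a common
  window, where \<open>S\<close> has a single node.\<close>

lemma discrete_representation:
  assumes S: "test_linear S" and "\<epsilon> > 0"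
    and eig: "\<And>l. \<exists>\<kappa>. \<forall>f\<in>supp_in l (l + \<epsilon>). S (\<lambda>x. (of_real x - \<kappa>) * f x) = 0"
  obtains m :: "real \<Rightarrow> complex" where "uniform_discrete {v. m v \<noteq> 0}"
    "\<And>M. finite {v. m v \<noteq> 0 \<and> \<bar>v\<bar> \<le> M}"
    "\<And>f M. f \<in> test_functions \<Longrightarrow> (\<And>x. \<bar>x\<bar> > M \<Longrightarrow> f x = 0) \<Longrightarrow>
      S f = (\<Sum>v | m v \<noteq> 0 \<and> \<bar>v\<bar> \<le> M. m v * f v)"
proof -
  have window: "\<exists>y c. y \<in> {l..l + \<epsilon>} \<and> (\<forall>f\<in>supp_in l (l + \<epsilon>). S f = c * f y)" for l
  proof -
    obtain \<kappa> where "\<forall>f\<in>supp_in l (l + \<epsilon>). S (\<lambda>x. (of_real x - \<kappa>) * f x) = 0"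
      using eig[of l] ..
    moreover have "l \<le> l + \<epsilon>" using \<open>\<epsilon> > 0\<close> by simp
    ultimately obtain y c where "y \<in> {l..l + \<epsilon>}" "\<And>f. f \<in> supp_in l (l + \<epsilon>) \<Longrightarrow> S f = c * f y"
      using local_point_mass[OF S] by blast
    then show ?thesis by blast
  qed
  define w where "w = \<epsilon> / 2"
  have w: "w > 0" "2 * w = \<epsilon>" using \<open>\<epsilon> > 0\<close> by (auto simp: w_def)
  have "\<forall>j::int. \<exists>y c. y \<in> {of_int j * w..of_int j * w + 2 * w} \<and>
      (\<forall>f\<in>supp_in (of_int j * w) (of_int j * w + 2 * w). S f = c * f y)"
    using window unfolding w(2) by blast
  from choice[OF this] obtain y where "\<forall>j::int. \<exists>c. y j \<in> {of_int j * w..of_int j * w + 2 * w} \<and>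
      (\<forall>f\<in>supp_in (of_int j * w) (of_int j * w + 2 * w). S f = c * f (y j))"
    ..
  from choice[OF this] obtain c where yc: "\<forall>j::int. y j \<in> {of_int j * w..of_int j * w + 2 * w} \<and>
      (\<forall>f\<in>supp_in (of_int j * w) (of_int j * w + 2 * w). S f = c j * f (y j))"
    ..
  have y: "y j \<in> {of_int j * w..of_int j * w + 2 * w}" for j
    using yc by blast
  have c: "S f = c j * f (y j)" if "f \<in> supp_in (of_int j * w) (of_int j * w + 2 * w)" for j f
    using yc that by blast
  define a where "a j = c j * tile w j (y j)" for j
  have fin: "finite {j. \<bar>y j\<bar> \<le> M}" for M
  proof (rule finite_subset)
    show "{j. \<bar>y j\<bar> \<le> M} \<subseteq> {\<lfloor>- M / w\<rfloor> - 2..\<lceil>M / w\<rceil>}"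
    proof safe
      fix j assume "\<bar>y j\<bar> \<le> M"
      then have "of_int j * w \<le> M" "- M \<le> of_int j * w + 2 * w"
        using y[of j] by auto
      then have "of_int j \<le> M / w" "- M / w \<le> of_int j + 2"
        using w(1) by (auto simp: field_simps)
      then show "j \<in> {\<lfloor>- M / w\<rfloor> - 2..\<lceil>M / w\<rceil>}"
        by (auto simp: le_ceiling_iff floor_le_iff) linarith+
    qed
  qed simp
  have rep: "S f = (\<Sum>j | \<bar>y j\<bar> \<le> M. a j * f (y j))"
    if f: "f \<in> test_functions" and M: "\<And>x. \<bar>x\<bar> > M \<Longrightarrow> f x = 0" for f M
  proof -
    obtain N where N: "\<And>n. n \<ge> N \<Longrightarrow> S f = (\<Sum>j\<in>{- int n..<int n}. S (\<lambda>x. tile w j x * f x))"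
      using test_linear_tiles[OF S w(1) f] by blast
    have "bdd_above (abs ` {j. \<bar>y j\<bar> \<le> M})"
      by (intro bdd_above_finite finite_imageI fin)
    then obtain K where K: "\<And>j. j \<in> {j. \<bar>y j\<bar> \<le> M} \<Longrightarrow> \<bar>j\<bar> \<le> K"
      unfolding bdd_above_def by blast
    define n where "n = max N (nat (K + 1))"
    have sub: "{j. \<bar>y j\<bar> \<le> M} \<subseteq> {- int n..<int n}"
      using K by (fastforce simp: n_def)
    have "S f = (\<Sum>j\<in>{- int n..<int n}. S (\<lambda>x. tile w j x * f x))"
      by (rule N) (simp add: n_def)
    also have "\<dots> = (\<Sum>j\<in>{- int n..<int n}. a j * f (y j))"
      using c[OF tile_supp_in[OF w(1) f]] by (simp add: a_def mult.assoc)
    also have "\<dots> = (\<Sum>j | \<bar>y j\<bar> \<le> M. a j * f (y j))"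
      using sub M by (intro sum.mono_neutral_right) (auto simp: not_le)
    finally show ?thesis .
  qed
  define m where "m v = (\<Sum>j | y j = v. a j)" for v
  have supp: "{v. m v \<noteq> 0 \<and> \<bar>v\<bar> \<le> M} \<subseteq> y ` {j. \<bar>y j\<bar> \<le> M}" for M
  proof safe
    fix v assume "m v \<noteq> 0" "\<bar>v\<bar> \<le> M"
    then have "{j. y j = v} \<noteq> {}"
      unfolding m_def by (metis sum.empty)
    then obtain j where "y j = v" by blast
    then show "v \<in> y ` {j. \<bar>y j\<bar> \<le> M}" using \<open>\<bar>v\<bar> \<le> M\<close> by blast
  qed
  have fin_m: "finite {v. m v \<noteq> 0 \<and> \<bar>v\<bar> \<le> M}" for M
    by (rule finite_subset[OF supp finite_imageI[OF fin]])
  have rep_m: "S f = (\<Sum>v | m v \<noteq> 0 \<and> \<bar>v\<bar> \<le> M. m v * f v)"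
    if f: "f \<in> test_functions" and M: "\<And>x. \<bar>x\<bar> > M \<Longrightarrow> f x = 0" for f M
  proof -
    let ?J = "{j. \<bar>y j\<bar> \<le> M}"
    have "S f = (\<Sum>j\<in>?J. a j * f (y j))" by (rule rep[OF that])
    also have "\<dots> = (\<Sum>v\<in>y ` ?J. \<Sum>j | j \<in> ?J \<and> y j = v. a j * f (y j))"
      by (rule sum.image_gen[OF fin])
    also have "\<dots> = (\<Sum>v\<in>y ` ?J. m v * f v)"
    proof (rule sum.cong[OF refl])
      fix v assume "v \<in> y ` ?J"
      then have "{j. j \<in> ?J \<and> y j = v} = {j. y j = v}" by auto
      then have "(\<Sum>j | j \<in> ?J \<and> y j = v. a j * f (y j)) = (\<Sum>j | y j = v. a j * f v)"
        by (intro sum.cong) auto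
      then show "(\<Sum>j | j \<in> ?J \<and> y j = v. a j * f (y j)) = m v * f v"
        by (simp add: m_def sum_distrib_right)
    qed
    also have "\<dots> = (\<Sum>v | m v \<noteq> 0 \<and> \<bar>v\<bar> \<le> M. m v * f v)"
      using supp fin by (intro sum.mono_neutral_right) auto
    finally show ?thesis .
  qed
  have "v = v'" if v: "m v \<noteq> 0" "m v' \<noteq> 0" and close: "dist v v' < \<epsilon> / 2" for v v'
  proof -
    define l where "l = min v v' - \<epsilon> / 4"
    obtain z d where z: "\<And>f. f \<in> supp_in l (l + \<epsilon>) \<Longrightarrow> S f = d * f z"
      using window[of l] by blast
    \<comment> \<open>A bump around \<open>x\<close> that avoids \<open>z\<close> and all other atoms would see the weight at \<open>x\<close>,
      although \<open>S\<close> sees only \<open>z\<close> in this window.\<close>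
    have at: "x = z" if x: "m x \<noteq> 0" "l + \<epsilon> / 4 \<le> x" "x \<le> l + 3 * \<epsilon> / 4" for x
    proof (rule ccontr)
      assume "x \<noteq> z"
      let ?F = "insert z {u. m u \<noteq> 0 \<and> \<bar>u\<bar> \<le> \<bar>x\<bar> + 1} - {x}"
      have "finite ?F" using fin_m by simp
      then obtain \<eta>0 where \<eta>0: "\<eta>0 > 0" "\<forall>u\<in>?F. u \<noteq> x \<longrightarrow> \<eta>0 \<le> dist x u"
        using finite_set_avoid by blast
      define \<eta> where "\<eta> = min \<eta>0 (min (\<epsilon> / 4) 1)"
      have \<eta>: "\<eta> > 0" "\<eta> \<le> \<epsilon> / 4" "\<eta> \<le> 1" "\<eta> \<le> \<eta>0"
        using \<eta>0(1) \<open>\<epsilon> > 0\<close> by (auto simp: \<eta>_def)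
      obtain p :: "real \<Rightarrow> real" where p: "(\<lambda>u. complex_of_real (p u)) \<in> test_functions"
        "p x = 1" "\<And>u. p u \<ge> 0" "\<And>u. \<bar>u - x\<bar> \<ge> \<eta> \<Longrightarrow> p u = 0"
        using bump_exists[OF \<eta>(1), of x] by blast
      have p0: "p u = 0" if "u \<in> ?F" for u
        using \<eta>0(2) that \<eta>(4) by (intro p(4)) (force simp: dist_real_def abs_minus_commute)
      have pt: "(\<lambda>u. complex_of_real (p u)) \<in> supp_in l (l + \<epsilon>)"
        using p(1) p(4) x \<eta>(2) by (auto simp: supp_in_def)
      have "S (\<lambda>u. of_real (p u)) = (\<Sum>u | m u \<noteq> 0 \<and> \<bar>u\<bar> \<le> \<bar>x\<bar> + 1. m u * of_real (p u))"
        using p(4) \<eta>(3) by (intro rep_m p(1)) auto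
      also have "\<dots> = (\<Sum>u\<in>{x}. m u * of_real (p u))"
        using fin_m x(1) p0 by (intro sum.mono_neutral_right) auto
      also have "\<dots> = m x" using p(2) by simp
      finally have "m x = d * of_real (p z)" using z[OF pt] by simp
      moreover have "p z = 0" using \<open>x \<noteq> z\<close> by (intro p0) auto
      ultimately show False using x(1) by simp
    qed
    have "v = z" "v' = z"
      using v close by (intro at; auto simp: l_def dist_real_def min_def abs_if split: if_splits)+
    then show ?thesis by simp
  qed
  then have "uniform_discrete {v. m v \<noteq> 0}"
    unfolding uniform_discrete_def using \<open>\<epsilon> > 0\<close> by (intro exI[of _ "\<epsilon> / 2"]) auto
  from that[OF this fin_m rep_m] show thesis .
qed

subsection \<open>The measure with prescribed atoms\<close>

lemma given_by_atomic_measure: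
  fixes m :: "real \<Rightarrow> complex"
  assumes fin: "\<And>M. finite {v. m v \<noteq> 0 \<and> \<bar>v\<bar> \<le> M}"
    and rep: "\<And>f M. f \<in> test_functions \<Longrightarrow> (\<And>x. \<bar>x\<bar> > M \<Longrightarrow> f x = 0) \<Longrightarrow>
      S f = (\<Sum>v | m v \<noteq> 0 \<and> \<bar>v\<bar> \<le> M. m v * f v)"
  shows "given_by_measure S (\<lambda>E. \<Sum>v | m v \<noteq> 0 \<and> v \<in> E. m v)"
    and "measure_supported_on (\<lambda>E. \<Sum>v | m v \<noteq> 0 \<and> v \<in> E. m v) {v. m v \<noteq> 0}"
proof -
  let ?\<kappa> = "\<lambda>E. \<Sum>v | m v \<noteq> 0 \<and> v \<in> E. m v"
  have fin_bdd: "finite {v. m v \<noteq> 0 \<and> v \<in> E}" if E: "bounded E" for E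
  proof -
    obtain M where "\<And>x. x \<in> E \<Longrightarrow> \<bar>x\<bar> \<le> M"
      using E by (auto simp: bounded_iff)
    then show ?thesis by (intro finite_subset[OF _ fin[of M]]) auto
  qed
  define A where "A = distr (density (count_space UNIV) (\<lambda>v. ennreal (norm (m v)))) borel (\<lambda>v. v)"
  define h where "h v = (if m v = 0 then 1 else m v / of_real (norm (m v)))" for v
  have "countable {v. m v \<noteq> 0}"
  proof -
    have "{v. m v \<noteq> 0} \<subseteq> (\<Union>n::nat. {v. m v \<noteq> 0 \<and> \<bar>v\<bar> \<le> real n})"
      using real_arch_simple by auto
    then show ?thesis
      by (rule countable_subset) (intro countable_UN countable_finite[OF fin], simp)
  qed
  then have h_meas: "h \<in> borel_measurable borel"
    by (intro measurable_discrete_difference[of "\<lambda>_. 1" borel borel "{v. m v \<noteq> 0}" h])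
       (auto simp: h_def)
  have mh: "norm (m v) *\<^sub>R h v = m v" for v
    by (simp add: h_def scaleR_conv_of_real)
  have int: "integrable A F \<and> integral\<^sup>L A F = (\<Sum>v | m v \<noteq> 0 \<and> v \<in> E. norm (m v) *\<^sub>R F v)"
    if F: "F \<in> borel_measurable borel" and E: "bounded E" and van: "\<And>x. x \<notin> E \<Longrightarrow> F x = 0"
    for F :: "real \<Rightarrow> 'b :: {banach, second_countable_topology}" and E
  proof -
    let ?G = "\<lambda>v. norm (m v) *\<^sub>R F v"
    have sub: "{v. ?G v \<noteq> 0} \<subseteq> {v. m v \<noteq> 0 \<and> v \<in> E}" using van by auto
    have "integral\<^sup>L A F = integral\<^sup>L (count_space UNIV) ?G"
      unfolding A_def using F by (subst integral_distr) (auto simp: integral_density)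
    also have "\<dots> = (\<Sum>v | v \<in> UNIV \<and> ?G v \<noteq> 0. ?G v)"
      using finite_subset[OF sub fin_bdd[OF E]]
      by (intro lebesgue_integral_count_space_finite_support) simp
    also have "\<dots> = (\<Sum>v | m v \<noteq> 0 \<and> v \<in> E. ?G v)"
      using sub fin_bdd[OF E] by (intro sum.mono_neutral_left) auto
    finally have val: "integral\<^sup>L A F = (\<Sum>v | m v \<noteq> 0 \<and> v \<in> E. ?G v)" .
    have "integrable (count_space UNIV) ?G"
    proof -
      have "integrable (count_space UNIV)
          (\<lambda>x. \<Sum>v | m v \<noteq> 0 \<and> v \<in> E. indicator {v} x *\<^sub>R ?G v)"
        by (intro Bochner_Integration.integrable_sum integrable_scaleR_left)
           (auto intro!: integrable_real_indicator)
      moreover have "(\<lambda>x. \<Sum>v | m v \<noteq> 0 \<and> v \<in> E. indicator {v} x *\<^sub>R ?G v) = ?G"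
      proof
        fix x
        have "(\<Sum>v | m v \<noteq> 0 \<and> v \<in> E. indicator {v} x *\<^sub>R ?G v)
            = (\<Sum>v | m v \<noteq> 0 \<and> v \<in> E. if v = x then ?G x else 0)"
          by (intro sum.cong) (auto simp: indicator_def)
        then show "(\<Sum>v | m v \<noteq> 0 \<and> v \<in> E. indicator {v} x *\<^sub>R ?G v) = ?G x"
          using fin_bdd[OF E] van[of x] by (simp add: sum.delta)
      qed
      ultimately show ?thesis by (simp only:)
    qed
    then have "integrable A F"
      unfolding A_def using F by (simp add: integrable_distr_eq integrable_density)
    with val show ?thesis by blast
  qed
  have polar: "polar_decomposition ?\<kappa> A h"
    unfolding polar_decomposition_def
  proof (intro conjI ballI allI impI)
    show "sets A = sets borel" by (simp add: A_def)
    show "h \<in> borel_measurable borel" by (rule h_meas)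
    show "norm (h x) = 1" for x by (simp add: h_def norm_divide)
    fix E :: "real set"
    assume E: "E \<in> sets borel" "bounded E"
    have "integrable A (indicator E :: real \<Rightarrow> real)"
      using int[of "indicator E :: real \<Rightarrow> real" E] E by auto
    then show "emeasure A E < \<infinity>"
      using E by (simp add: integrable_indicator_iff A_def)
    have "integral\<^sup>L A (\<lambda>x. indicator E x * h x)
        = (\<Sum>v | m v \<noteq> 0 \<and> v \<in> E. norm (m v) *\<^sub>R (indicator E v * h v))"
      using int[of "\<lambda>x. indicator E x * h x" E] E h_meas by auto
    also have "\<dots> = ?\<kappa> E"
      by (intro sum.cong) (auto simp: mh)
    finally show "?\<kappa> E = integral\<^sup>L A (\<lambda>x. indicator E x * h x)" by simp
  qed
  have "has_complex_measure_integral \<phi> (S \<phi>) ?\<kappa>" if \<phi>: "\<phi> \<in> test_functions" for \<phi>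
  proof -
    obtain M where M: "\<And>x. \<bar>x\<bar> > M \<Longrightarrow> \<phi> x = 0"
      using test_bound[OF \<phi>] by metis
    have "bounded {x. \<bar>x\<bar> \<le> M}" by (auto simp: bounded_iff)
    then have "integrable A (\<lambda>x. \<phi> x * h x) \<and> integral\<^sup>L A (\<lambda>x. \<phi> x * h x)
        = (\<Sum>v | m v \<noteq> 0 \<and> v \<in> {x. \<bar>x\<bar> \<le> M}. norm (m v) *\<^sub>R (\<phi> v * h v))"
      using M h_meas smooth_measurable[OF test_smooth[OF \<phi>]] by (intro int) auto
    moreover have "norm (m v) *\<^sub>R (\<phi> v * h v) = m v * \<phi> v" for v
      using mh[of v] by (metis mult.commute mult_scaleR_right)
    ultimately show ?thesis
      unfolding has_complex_measure_integral_def using polar rep[OF \<phi> M]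
      by (intro exI[of _ A] exI[of _ h]) auto
  qed
  moreover have "locally_finite_complex_measure ?\<kappa>"
    unfolding locally_finite_complex_measure_def
  proof (intro allI impI, elim conjE)
    fix E :: "nat \<Rightarrow> real set"
    assume disj: "disjoint_family E" and bdd: "bounded (\<Union>i. E i)"
    let ?F = "{v. m v \<noteq> 0 \<and> v \<in> (\<Union>i. E i)}"
    have F: "finite ?F" by (rule fin_bdd[OF bdd])
    have "?\<kappa> (E i) = (\<Sum>v\<in>?F. if v \<in> E i then m v else 0)" for i
    proof -
      have "(\<Sum>v\<in>?F. if v \<in> E i then m v else 0) = sum m (?F \<inter> {v. v \<in> E i})"
        using F by (simp add: sum.If_cases)
      also have "?F \<inter> {v. v \<in> E i} = {v. m v \<noteq> 0 \<and> v \<in> E i}" by auto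
      finally show ?thesis by simp
    qed
    moreover have "(\<lambda>i. \<Sum>v\<in>?F. if v \<in> E i then m v else 0) sums (\<Sum>v\<in>?F. m v)"
    proof (rule sums_sum)
      fix v assume "v \<in> ?F"
      then obtain i where i: "v \<in> E i" by auto
      have "(v \<in> E j) = (j = i)" for j
        using disj i by (auto simp: disjoint_family_on_def)
      then show "(\<lambda>j. if v \<in> E j then m v else 0) sums m v"
        using sums_single[of i "\<lambda>_. m v"] by simp
    qed
    ultimately show "(\<lambda>i. ?\<kappa> (E i)) sums ?\<kappa> (\<Union>i. E i)" by simp
  qed
  ultimately show "given_by_measure S ?\<kappa>"
    by (simp add: given_by_measure_def)
  show "measure_supported_on ?\<kappa> {v. m v \<noteq> 0}"
    unfolding measure_supported_on_def
  proof (intro ballI impI)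
    fix E :: "real set"
    assume "bounded E \<and> E \<inter> {v. m v \<noteq> 0} = {}"
    then have "{v. m v \<noteq> 0 \<and> v \<in> E} = {}" by auto
    then show "?\<kappa> E = 0" by (simp only: sum.empty)
  qed
qed

section \<open>Test functions on the plane adapted to the transform\<close>

text \<open>With \<open>x = a u + b v\<close>, \<open>y = c u + d v\<close> and \<open>p = a \<alpha> + c t\<close>, \<open>q = b \<alpha> + d t\<close> one has
  \<open>p u + q v = \<alpha> x + t y\<close>.  Hence \<open>fourier f u * fourier g v\<close> is, up to a constant, the
  Fourier transform in both variables of \<open>(\<alpha>, t) \<mapsto> f p * g q\<close> at \<open>(x, y)\<close>, and undoing the
  transform in the second variable leaves the following function of \<open>(x, t)\<close>.\<close>

definition wigner_test ::
  "real \<Rightarrow> real \<Rightarrow> real \<Rightarrow> real \<Rightarrow> (real \<Rightarrow> complex) \<Rightarrow> (real \<Rightarrow> complex) \<Rightarrow> real^2 \<Rightarrow> complex" where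
  "wigner_test a b c d f g z =
     fourier (\<lambda>\<alpha>. f (a * \<alpha> + c * z $ 2) * g (b * \<alpha> + d * z $ 2)) (z $ 1)"

context
  fixes a b c d D :: real
  assumes D: "D \<noteq> 0" "D = a * d - b * c" and a: "a \<noteq> 0"
begin

lemma coordinates:
  "d * (a * \<alpha> + c * t) - c * (b * \<alpha> + d * t) = D * \<alpha>"
  "a * (b * \<alpha> + d * t) - b * (a * \<alpha> + c * t) = D * t"
  by (simp_all add: D(2) algebra_simps)

lemma slice_test:
  assumes "f \<in> test_functions" "g \<in> test_functions"
  shows "(\<lambda>\<alpha>. f (a * \<alpha> + c * t) * g (b * \<alpha> + d * t)) \<in> test_functions"
  using test_mult_smooth[OF smooth_affine[OF test_smooth[OF assms(2)], of b "d * t"]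
      test_affine[OF assms(1) a, of "c * t"]]
  by (simp add: mult.commute)

lemma slice_schwartz:
  assumes "f \<in> test_functions" "g \<in> test_functions"
  shows "(\<lambda>\<alpha>. f (a * \<alpha> + c * t) * g (b * \<alpha> + d * t)) \<in> schwartz"
  by (rule test_schwartz[OF slice_test[OF assms]])

lemma wigner_test_lincomb:
  assumes "f1 \<in> test_functions" "g1 \<in> test_functions" "f2 \<in> test_functions" "g2 \<in> test_functions"
    and eq: "\<And>\<alpha>. F \<alpha> = y * (f1 (a * \<alpha> + c * z $ 2) * g1 (b * \<alpha> + d * z $ 2))
      + y' * (f2 (a * \<alpha> + c * z $ 2) * g2 (b * \<alpha> + d * z $ 2))"
  shows "fourier F (z $ 1) = y * wigner_test a b c d f1 g1 z + y' * wigner_test a b c d f2 g2 z"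
proof -
  have "F = (\<lambda>\<alpha>. y * (f1 (a * \<alpha> + c * z $ 2) * g1 (b * \<alpha> + d * z $ 2))
      + y' * (f2 (a * \<alpha> + c * z $ 2) * g2 (b * \<alpha> + d * z $ 2)))"
    using eq by blast
  then show ?thesis
    using assms(1-4)
    by (simp only: fourier_add[OF schwartz_cmult[OF slice_schwartz] schwartz_cmult[OF slice_schwartz]]
        fourier_cmult wigner_test_def)
qed

text \<open>The next three identities are what puts these functions into \<^const>\<open>schwartz\<close>: multiplying
  by \<open>x\<close>, by \<open>t\<close> or, under the integral, by \<open>\<alpha>\<close> (that is, differentiating in \<open>x\<close>) leads to
  combinations of functions of the same form.\<close>

lemma wigner_test_times_1:
  assumes f: "f \<in> test_functions" and g: "g \<in> test_functions"
  shows "of_real (z $ 1) * wigner_test a b c d f g z =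
    a / (2 * pi * \<i>) * wigner_test a b c d (vderiv f) g z
    + b / (2 * pi * \<i>) * wigner_test a b c d f (vderiv g) z"
proof -
  let ?s = "\<lambda>\<alpha>. f (a * \<alpha> + c * z $ 2) * g (b * \<alpha> + d * z $ 2)"
  have "vderiv ?s = (\<lambda>\<alpha>. f (a * \<alpha> + c * z $ 2) * (of_real b * vderiv g (b * \<alpha> + d * z $ 2))
      + of_real a * vderiv f (a * \<alpha> + c * z $ 2) * g (b * \<alpha> + d * z $ 2))"
    by (intro vderiv_eqI has_vector_derivative_mult affine_has_vderiv test_smooth f g)
  then have "fourier (vderiv ?s) (z $ 1) = of_real a * wigner_test a b c d (vderiv f) g z
      + of_real b * wigner_test a b c d f (vderiv g) z"
    by (intro wigner_test_lincomb test_vderiv f g) (simp add: mult_ac add.commute)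
  then have "(2 * pi * \<i>) * (of_real (z $ 1) * wigner_test a b c d f g z) =
      of_real a * wigner_test a b c d (vderiv f) g z + of_real b * wigner_test a b c d f (vderiv g) z"
    by (simp add: fourier_vderiv[OF slice_schwartz[OF f g]] wigner_test_def mult.assoc)
  then have "of_real (z $ 1) * wigner_test a b c d f g z =
      (of_real a * wigner_test a b c d (vderiv f) g z + of_real b * wigner_test a b c d f (vderiv g) z)
        / (2 * pi * \<i>)"
    by (metis nonzero_mult_div_cancel_left complex_i_not_zero mult_eq_0_iff of_real_eq_0_iff
        pi_neq_zero zero_neq_numeral)
  then show ?thesis by (simp add: add_divide_distrib)
qed

lemma wigner_test_times_2:
  assumes f: "f \<in> test_functions" and g: "g \<in> test_functions"
  shows "of_real (z $ 2) * wigner_test a b c d f g z =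
    of_real (a / D) * wigner_test a b c d f (\<lambda>x. of_real x * g x) z
    + of_real (- b / D) * wigner_test a b c d (\<lambda>x. of_real x * f x) g z"
proof -
  let ?s = "\<lambda>\<alpha>. f (a * \<alpha> + c * z $ 2) * g (b * \<alpha> + d * z $ 2)"
  have "of_real (z $ 2) * wigner_test a b c d f g z = fourier (\<lambda>\<alpha>. of_real (z $ 2) * ?s \<alpha>) (z $ 1)"
    by (simp only: wigner_test_def fourier_cmult)
  also have "\<dots> = of_real (a / D) * wigner_test a b c d f (\<lambda>x. of_real x * g x) z
    + of_real (- b / D) * wigner_test a b c d (\<lambda>x. of_real x * f x) g z"
  proof (intro wigner_test_lincomb f g test_mult_smooth smooth_of_real)
    fix \<alpha>
    define p q where "p = a * \<alpha> + c * z $ 2" and "q = b * \<alpha> + d * z $ 2"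
    have "a * q - b * p = D * z $ 2"
      unfolding p_def q_def by (rule coordinates)
    then have "z $ 2 = a / D * q + - b / D * p"
      using D(1) by (simp add: field_simps)
    then have "of_real (z $ 2) * (f p * g q) = of_real (a / D * q + - b / D * p) * (f p * g q)"
      by (simp only:)
    also have "\<dots> = of_real (a / D) * (f p * (of_real q * g q)) + of_real (- b / D) * (of_real p * f p * g q)"
      by (simp add: algebra_simps)
    finally show "of_real (z $ 2) * ?s \<alpha> =
        of_real (a / D) * (f (a * \<alpha> + c * z $ 2) * (of_real (b * \<alpha> + d * z $ 2) * g (b * \<alpha> + d * z $ 2)))
        + of_real (- b / D) * (of_real (a * \<alpha> + c * z $ 2) * f (a * \<alpha> + c * z $ 2) * g (b * \<alpha> + d * z $ 2))"
      unfolding p_def q_def .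
  qed
  finally show ?thesis .
qed

lemma wigner_test_times_alpha:
  assumes f: "f \<in> test_functions" and g: "g \<in> test_functions"
  shows "fourier (\<lambda>\<alpha>. of_real \<alpha> * (f (a * \<alpha> + c * z $ 2) * g (b * \<alpha> + d * z $ 2))) (z $ 1) =
    of_real (d / D) * wigner_test a b c d (\<lambda>x. of_real x * f x) g z
    + of_real (- c / D) * wigner_test a b c d f (\<lambda>x. of_real x * g x) z"
proof (intro wigner_test_lincomb f g test_mult_smooth smooth_of_real)
  fix \<alpha>
  define p q where "p = a * \<alpha> + c * z $ 2" and "q = b * \<alpha> + d * z $ 2"
  have "d * p - c * q = D * \<alpha>"
    unfolding p_def q_def by (rule coordinates)
  then have "\<alpha> = d / D * p + - c / D * q"
    using D(1) by (simp add: field_simps)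
  then have "of_real \<alpha> * (f p * g q) = of_real (d / D * p + - c / D * q) * (f p * g q)"
    by (simp only:)
  also have "\<dots> = of_real (d / D) * (of_real p * f p * g q) + of_real (- c / D) * (f p * (of_real q * g q))"
    by (simp add: algebra_simps)
  finally show "of_real \<alpha> * (f (a * \<alpha> + c * z $ 2) * g (b * \<alpha> + d * z $ 2)) =
      of_real (d / D) * (of_real (a * \<alpha> + c * z $ 2) * f (a * \<alpha> + c * z $ 2) * g (b * \<alpha> + d * z $ 2))
      + of_real (- c / D) * (f (a * \<alpha> + c * z $ 2) * (of_real (b * \<alpha> + d * z $ 2) * g (b * \<alpha> + d * z $ 2)))"
    unfolding p_def q_def .
qed

text \<open>The slices have a common compact support, since \<open>p\<close> and \<open>q\<close> together determine
  \<open>\<alpha>\<close>; this makes differentiation under the integral sign available.\<close>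

lemma slice_support:
  assumes f: "f \<in> test_functions" and g: "g \<in> test_functions"
  obtains M where "M > 0"
    "\<And>(z :: real^2) \<alpha>. \<bar>\<alpha>\<bar> > M \<Longrightarrow> f (a * \<alpha> + c * z $ 2) * g (b * \<alpha> + d * z $ 2) = 0"
proof -
  obtain N1 where N1: "N1 > 0" "\<And>x. \<bar>x\<bar> > N1 \<Longrightarrow> f x = 0" using test_bound[OF f] by metis
  obtain N2 where N2: "N2 > 0" "\<And>x. \<bar>x\<bar> > N2 \<Longrightarrow> g x = 0" using test_bound[OF g] by metis
  define M where "M = (\<bar>d\<bar> * N1 + \<bar>c\<bar> * N2) / \<bar>D\<bar> + 1"
  have "M > 0" using N1 N2 by (simp add: M_def add_nonneg_pos)
  moreover have "f (a * \<alpha> + c * z $ 2) * g (b * \<alpha> + d * z $ 2) = 0" if \<alpha>: "\<bar>\<alpha>\<bar> > M" for z :: "real^2" and \<alpha>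
  proof (rule ccontr)
    let ?p = "a * \<alpha> + c * z $ 2" and ?q = "b * \<alpha> + d * z $ 2"
    assume "f ?p * g ?q \<noteq> 0"
    then have pq: "\<bar>?p\<bar> \<le> N1" "\<bar>?q\<bar> \<le> N2"
      using N1(2)[of ?p] N2(2)[of ?q] by force+
    have "\<bar>D\<bar> * \<bar>\<alpha>\<bar> = \<bar>d * ?p - c * ?q\<bar>"
      unfolding coordinates by (simp add: abs_mult)
    also have "\<dots> \<le> \<bar>d\<bar> * \<bar>?p\<bar> + \<bar>c\<bar> * \<bar>?q\<bar>"
      by (simp add: abs_mult[symmetric] abs_triangle_ineq4)
    also have "\<dots> \<le> \<bar>d\<bar> * N1 + \<bar>c\<bar> * N2"
      using pq by (intro add_mono mult_left_mono) auto
    finally have "\<bar>\<alpha>\<bar> \<le> (\<bar>d\<bar> * N1 + \<bar>c\<bar> * N2) / \<bar>D\<bar>"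
      using D(1) by (simp add: pos_le_divide_eq mult.commute)
    then show False using \<alpha> by (simp add: M_def)
  qed
  ultimately show thesis by (rule that)
qed

lemma fourier_eq_integral:
  assumes "continuous_on UNIV s" "\<And>\<alpha>. \<bar>\<alpha>\<bar> > M \<Longrightarrow> s \<alpha> = 0"
  shows "fourier s x = integral (cbox (- M) M) (\<lambda>\<alpha>. s \<alpha> * cis (- (2 * pi * x) * \<alpha>))"
proof -
  let ?F = "\<lambda>\<alpha>. s \<alpha> * cis (- (2 * pi * x) * \<alpha>)"
  have "continuous_on {- M..M} ?F"
    by (intro continuous_intros continuous_on_subset[OF assms(1)]) auto
  then have int: "set_integrable lborel {- M..M} ?F"
    by (rule borel_integrable_atLeastAtMost')
  have "fourier s x = (LINT \<alpha>:{- M..M}|lborel. ?F \<alpha>)"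
    unfolding fourier_cis set_lebesgue_integral_def
    using assms(2) by (intro Bochner_Integration.integral_cong) (auto simp: indicator_def abs_le_iff not_le)
  also have "\<dots> = integral {- M..M} ?F"
    by (rule set_borel_integral_eq_integral(2)[OF int])
  finally show ?thesis by simp
qed

lemma has_derivative_along_coordinate:
  assumes "smooth f"
  shows "((\<lambda>z::real^2. f (s + t * z $ i)) has_derivative
    (\<lambda>h. (h $ i) *\<^sub>R (of_real t * vderiv f (s + t * z $ i)))) (at z)"
proof -
  have "((\<lambda>z::real^2. s + t * z $ i) has_derivative (\<lambda>h. t * h $ i)) (at z)"
    by (auto intro!: derivative_eq_intros bounded_linear.has_derivative[OF bounded_linear_vec_nth])
  from has_derivative_compose[OF this smooth_has_vderiv[OF assms, unfolded has_vector_derivative_def]]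
  show ?thesis by (simp add: scaleR_conv_of_real mult_ac)
qed

lemma wigner_test_has_derivative:
  assumes f: "f \<in> test_functions" and g: "g \<in> test_functions"
  obtains L where "(wigner_test a b c d f g has_derivative L) (at z)"
    and "L (axis 1 1) = (- 2 * pi * \<i>) *
      (of_real (d / D) * wigner_test a b c d (\<lambda>x. of_real x * f x) g z
       + of_real (- c / D) * wigner_test a b c d f (\<lambda>x. of_real x * g x) z)"
    and "L (axis 2 1) = of_real c * wigner_test a b c d (vderiv f) g z
       + of_real d * wigner_test a b c d f (vderiv g) z"
proof -
  have fs: "smooth f" and gs: "smooth g" using f g by (auto intro: test_smooth)
  obtain M1 where M1: "M1 > 0"
    "\<And>(z :: real^2) \<alpha>. \<bar>\<alpha>\<bar> > M1 \<Longrightarrow> f (a * \<alpha> + c * z $ 2) * g (b * \<alpha> + d * z $ 2) = 0"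
    using slice_support[OF f g] by metis
  obtain M2 where M2: "M2 > 0"
    "\<And>(z :: real^2) \<alpha>. \<bar>\<alpha>\<bar> > M2 \<Longrightarrow> vderiv f (a * \<alpha> + c * z $ 2) * g (b * \<alpha> + d * z $ 2) = 0"
    using slice_support[OF test_vderiv[OF f] g] by metis
  obtain M3 where M3: "M3 > 0"
    "\<And>(z :: real^2) \<alpha>. \<bar>\<alpha>\<bar> > M3 \<Longrightarrow> f (a * \<alpha> + c * z $ 2) * vderiv g (b * \<alpha> + d * z $ 2) = 0"
    using slice_support[OF f test_vderiv[OF g]] by metis
  define M where "M = max M1 (max M2 M3)"
  define P where "P z \<alpha> = f (a * \<alpha> + c * z $ 2)" for z :: "real^2" and \<alpha>
  define Q where "Q z \<alpha> = g (b * \<alpha> + d * z $ 2)" for z :: "real^2" and \<alpha>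
  define P' where "P' z \<alpha> = vderiv f (a * \<alpha> + c * z $ 2)" for z :: "real^2" and \<alpha>
  define Q' where "Q' z \<alpha> = vderiv g (b * \<alpha> + d * z $ 2)" for z :: "real^2" and \<alpha>
  define e where "e z \<alpha> = cis (- (2 * pi * z $ 1) * \<alpha>)" for z :: "real^2" and \<alpha>
  define s1 where "s1 z \<alpha> = (- 2 * pi * \<i>) * (of_real \<alpha> * (P z \<alpha> * Q z \<alpha>))" for z \<alpha>
  define s2 where "s2 z \<alpha> = of_real c * (P' z \<alpha> * Q z \<alpha>) + of_real d * (P z \<alpha> * Q' z \<alpha>)" for z \<alpha>
  define K' :: "real^2 \<Rightarrow> real \<Rightarrow> (real^2) \<Rightarrow>\<^sub>L complex" where "K' z \<alpha> = (blinfun_scaleR_left (s1 z \<alpha> * e z \<alpha>) o\<^sub>L blinfun_inner_left (axis 1 1))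
      + (blinfun_scaleR_left (s2 z \<alpha> * e z \<alpha>) o\<^sub>L blinfun_inner_left (axis 2 1))" for z \<alpha>
  have K'_apply: "blinfun_apply (K' z \<alpha>) h = (h $ 1) *\<^sub>R (s1 z \<alpha> * e z \<alpha>) + (h $ 2) *\<^sub>R (s2 z \<alpha> * e z \<alpha>)"
    for z \<alpha> h
    by (simp add: K'_def blinfun.add_left inner_axis)
  have contPQ: "continuous_on UNIV (\<lambda>(z, \<alpha>). P z \<alpha>)" "continuous_on UNIV (\<lambda>(z, \<alpha>). Q z \<alpha>)"
      "continuous_on UNIV (\<lambda>(z, \<alpha>). P' z \<alpha>)" "continuous_on UNIV (\<lambda>(z, \<alpha>). Q' z \<alpha>)"
      "continuous_on UNIV (\<lambda>(z, \<alpha>). e z \<alpha>)"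
    unfolding P_def Q_def P'_def Q'_def e_def split_beta
    by (intro continuous_intros smooth_continuous_compose[OF fs] smooth_continuous_compose[OF gs]
        smooth_continuous_compose[OF smooth_vderiv[OF fs]] smooth_continuous_compose[OF smooth_vderiv[OF gs]])+
  note cont = contPQ[unfolded split_beta]
  have contK': "continuous_on UNIV (\<lambda>(z, \<alpha>). K' z \<alpha>)"
    unfolding K'_def s1_def s2_def split_beta by (intro continuous_intros cont)
  have slice: "continuous_on S (\<lambda>\<alpha>. h (z, \<alpha>))" if "continuous_on UNIV h"
    for h :: "(real^2) \<times> real \<Rightarrow> 'z::topological_space" and z and S
    by (rule continuous_on_compose2[OF that]) (auto intro!: continuous_intros)
  have "((\<lambda>z. integral (cbox (- M) M) (\<lambda>\<alpha>. P z \<alpha> * Q z \<alpha> * e z \<alpha>)) has_derivative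
      blinfun_apply (integral (cbox (- M) M) (K' z))) (at z within UNIV)"
  proof (rule leibniz_rule)
    fix z :: "real^2" and \<alpha> :: real
    have dP: "((\<lambda>z. P z \<alpha>) has_derivative (\<lambda>h. (h $ 2) *\<^sub>R (of_real c * P' z \<alpha>))) (at z)"
      unfolding P_def P'_def by (rule has_derivative_along_coordinate[OF fs])
    have dQ: "((\<lambda>z. Q z \<alpha>) has_derivative (\<lambda>h. (h $ 2) *\<^sub>R (of_real d * Q' z \<alpha>))) (at z)"
      unfolding Q_def Q'_def by (rule has_derivative_along_coordinate[OF gs])
    have "((\<lambda>z::real^2. - (2 * pi * \<alpha>) * z $ 1) has_derivative (\<lambda>h. - (2 * pi * \<alpha>) * h $ 1)) (at z)"
      by (auto intro!: derivative_eq_intros bounded_linear.has_derivative[OF bounded_linear_vec_nth])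
    from has_derivative_compose[OF this cis_has_vderiv[of 1, unfolded has_vector_derivative_def]]
    have de: "((\<lambda>z. e z \<alpha>) has_derivative (\<lambda>h. (h $ 1) *\<^sub>R ((- 2 * pi * \<i>) * of_real \<alpha> * e z \<alpha>))) (at z)"
      by (simp add: e_def scaleR_conv_of_real mult_ac)
    show "((\<lambda>z. P z \<alpha> * Q z \<alpha> * e z \<alpha>) has_derivative blinfun_apply (K' z \<alpha>)) (at z within UNIV)"
      by (rule has_derivative_eq_rhs[OF has_derivative_mult[OF has_derivative_mult[OF dP dQ] de]])
         (auto simp: K'_apply s1_def s2_def scaleR_conv_of_real algebra_simps)
    show "(\<lambda>\<alpha>. P z \<alpha> * Q z \<alpha> * e z \<alpha>) integrable_on cbox (- M) M"
      by (intro integrable_continuous continuous_intros slice[OF contPQ(1), simplified]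
          slice[OF contPQ(2), simplified] slice[OF contPQ(5), simplified])
    show "continuous_on (UNIV \<times> cbox (- M) M) (\<lambda>(z, \<alpha>). K' z \<alpha>)"
      using contK' by (rule continuous_on_subset) simp
  qed auto
  moreover have "wigner_test a b c d f g = (\<lambda>z. integral (cbox (- M) M) (\<lambda>\<alpha>. P z \<alpha> * Q z \<alpha> * e z \<alpha>))"
  proof
    fix z
    show "wigner_test a b c d f g z = integral (cbox (- M) M) (\<lambda>\<alpha>. P z \<alpha> * Q z \<alpha> * e z \<alpha>)"
      unfolding wigner_test_def P_def Q_def e_def
      using M1(2) by (intro fourier_eq_integral smooth_continuous test_smooth slice_test f g)
        (auto simp: M_def)
  qed
  ultimately have der: "(wigner_test a b c d f g has_derivative
      blinfun_apply (integral (cbox (- M) M) (K' z))) (at z)" by simp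
  have int: "K' z integrable_on cbox (- M) M"
    using slice[OF contK', of "cbox (- M) M" z] by (intro integrable_continuous) simp
  have apply_eq: "blinfun_apply (integral (cbox (- M) M) (K' z)) h
      = integral (cbox (- M) M) (\<lambda>\<alpha>. blinfun_apply (K' z \<alpha>) h)" for h
    by (rule blinfun_apply_integral[OF int])
  have cont_s: "continuous_on UNIV (s1 z)" "continuous_on UNIV (s2 z)"
    unfolding s1_def s2_def
    by (intro continuous_intros slice[OF contPQ(1), simplified] slice[OF contPQ(2), simplified]
        slice[OF contPQ(3), simplified] slice[OF contPQ(4), simplified])+
  have "blinfun_apply (integral (cbox (- M) M) (K' z)) (axis 1 1) = fourier (s1 z) (z $ 1)"
  proof -
    have "s1 z \<alpha> = 0" if "\<bar>\<alpha>\<bar> > M" for \<alpha>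
      using M1(2)[of \<alpha> z] that by (auto simp: s1_def P_def Q_def M_def)
    then show ?thesis
      unfolding apply_eq K'_apply
      by (subst fourier_eq_integral[OF cont_s(1)]) (auto simp: axis_def e_def)
  qed
  also have "\<dots> = (- 2 * pi * \<i>) *
      fourier (\<lambda>\<alpha>. of_real \<alpha> * (f (a * \<alpha> + c * z $ 2) * g (b * \<alpha> + d * z $ 2))) (z $ 1)"
    unfolding s1_def P_def Q_def by (rule fourier_cmult)
  also note wigner_test_times_alpha[OF f g]
  finally have L1: "blinfun_apply (integral (cbox (- M) M) (K' z)) (axis 1 1) = (- 2 * pi * \<i>) *
      (of_real (d / D) * wigner_test a b c d (\<lambda>x. of_real x * f x) g z
       + of_real (- c / D) * wigner_test a b c d f (\<lambda>x. of_real x * g x) z)" .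
  have "blinfun_apply (integral (cbox (- M) M) (K' z)) (axis 2 1) = fourier (s2 z) (z $ 1)"
  proof -
    have "s2 z \<alpha> = 0" if "\<bar>\<alpha>\<bar> > M" for \<alpha>
      using M2(2)[of \<alpha> z] M3(2)[of \<alpha> z] that by (simp only: s2_def P_def Q_def P'_def Q'_def M_def) simp
    then show ?thesis
      unfolding apply_eq K'_apply
      by (subst fourier_eq_integral[OF cont_s(2)]) (auto simp: axis_def e_def)
  qed
  also have "\<dots> = of_real c * wigner_test a b c d (vderiv f) g z
      + of_real d * wigner_test a b c d f (vderiv g) z"
    by (intro wigner_test_lincomb test_vderiv f g) (simp add: s2_def P_def Q_def P'_def Q'_def)
  finally have L2: "blinfun_apply (integral (cbox (- M) M) (K' z)) (axis 2 1) =
      of_real c * wigner_test a b c d (vderiv f) g z + of_real d * wigner_test a b c d f (vderiv g) z" .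
  from der L1 L2 show thesis by (rule that)
qed

lemma wigner_test_schwartz:
  assumes "f \<in> test_functions" "g \<in> test_functions"
  shows "wigner_test a b c d f g \<in> schwartz"
proof (rule schwartz_lin_span[of
      "{wigner_test a b c d f g |f g. f \<in> test_functions \<and> g \<in> test_functions}"])
  let ?X = "{wigner_test a b c d f g |f g. f \<in> test_functions \<and> g \<in> test_functions}"
  have mem: "wigner_test a b c d f g \<in> ?X" if "f \<in> test_functions" "g \<in> test_functions" for f g
    using that by blast
  have basis: "v = axis 1 1 \<or> v = axis 2 1" if "v \<in> Basis" for v :: "real^2"
    using that by (auto simp: Basis_vec_def UNIV_2)
  have xt: "(\<lambda>x. of_real x * f x) \<in> test_functions" if "f \<in> test_functions" for f
    by (rule test_mult_smooth[OF smooth_of_real that])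
  fix h
  assume "h \<in> ?X"
  then obtain f g where h: "h = wigner_test a b c d f g"
    and f: "f \<in> test_functions" and g: "g \<in> test_functions" by blast
  have "\<exists>L. (h has_derivative L) (at z)
      \<and> L (axis 1 1) = (- 2 * pi * \<i>) *
        (of_real (d / D) * wigner_test a b c d (\<lambda>x. of_real x * f x) g z
         + of_real (- c / D) * wigner_test a b c d f (\<lambda>x. of_real x * g x) z)
      \<and> L (axis 2 1) = of_real c * wigner_test a b c d (vderiv f) g z
         + of_real d * wigner_test a b c d f (vderiv g) z" for z
    unfolding h by (rule wigner_test_has_derivative[OF f g, of z]) blast
  then obtain L where L: "\<And>z. (h has_derivative L z) (at z)"
    and L1: "\<And>z. L z (axis 1 1) = (- 2 * pi * \<i>) *
        (of_real (d / D) * wigner_test a b c d (\<lambda>x. of_real x * f x) g z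
         + of_real (- c / D) * wigner_test a b c d f (\<lambda>x. of_real x * g x) z)"
    and L2: "\<And>z. L z (axis 2 1) = of_real c * wigner_test a b c d (vderiv f) g z
         + of_real d * wigner_test a b c d f (vderiv g) z"
    by metis
  show "h differentiable_on UNIV"
    using L by (auto simp: differentiable_on_def differentiable_def)
  have fr: "frechet_derivative h (at z) = L z" for z
    using frechet_derivative_at[OF L[of z]] by simp
  show "(\<lambda>z. frechet_derivative h (at z) v) \<in> lin_span ?X" if "v \<in> Basis" for v
    using basis[OF that]
  proof
    assume v: "v = axis 1 1"
    show ?thesis
      unfolding v fr L1 by (intro lin_span.scale lin_span_combine mem xt f g)
  next
    assume v: "v = axis 2 1"
    show ?thesis
      unfolding v fr L2 by (intro lin_span_combine mem test_vderiv f g)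
  qed
  show "(\<lambda>z. of_real (z \<bullet> v) * h z) \<in> lin_span ?X" if "v \<in> Basis" for v
    using basis[OF that]
  proof
    assume v: "v = axis 1 1"
    show ?thesis
      unfolding v inner_axis h inner_real_def mult_1_right wigner_test_times_1[OF f g]
      by (intro lin_span_combine mem test_vderiv f g)
  next
    assume v: "v = axis 2 1"
    show ?thesis
      unfolding v inner_axis h inner_real_def mult_1_right wigner_test_times_2[OF f g]
      by (intro lin_span_combine mem xt f g)
  qed
  obtain K where K: "\<And>x. norm (g x) \<le> K"
    using schwartz_decay[OF test_schwartz[OF g], of 0] by auto
  have K0: "K \<ge> 0" using order_trans[OF norm_ge_zero K] .
  have "norm (h z) \<le> K * ((LINT x|lborel. norm (f x)) / \<bar>a\<bar>)" for z
  proof -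
    have f_int: "integrable lborel (\<lambda>\<alpha>. norm (f (c * z $ 2 + a * \<alpha>)))"
      by (rule integrable_norm[OF lborel_integrable_real_affine[OF schwartz_integrable[OF
              test_schwartz[OF f]] a]])
    have "norm (h z) \<le> (LINT \<alpha>|lborel. norm (f (a * \<alpha> + c * z $ 2) * g (b * \<alpha> + d * z $ 2)))"
      unfolding h wigner_test_def by (rule norm_fourier_le)
    also have "\<dots> \<le> (LINT \<alpha>|lborel. K * norm (f (c * z $ 2 + a * \<alpha>)))"
    proof (rule integral_mono)
      show "integrable lborel (\<lambda>\<alpha>. norm (f (a * \<alpha> + c * z $ 2) * g (b * \<alpha> + d * z $ 2)))"
        by (rule integrable_norm[OF schwartz_integrable[OF slice_schwartz[OF f g]]])
      show "integrable lborel (\<lambda>\<alpha>. K * norm (f (c * z $ 2 + a * \<alpha>)))"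
        by (rule integrable_mult_right[OF f_int])
      show "norm (f (a * \<alpha> + c * z $ 2) * g (b * \<alpha> + d * z $ 2)) \<le> K * norm (f (c * z $ 2 + a * \<alpha>))"
        for \<alpha>
        using mult_right_mono[OF K norm_ge_zero] by (simp add: norm_mult mult.commute add.commute)
    qed
    also have "\<dots> = K * ((LINT x|lborel. norm (f x)) / \<bar>a\<bar>)"
      using lborel_integral_real_affine[OF a, of "\<lambda>x. norm (f x)" "c * z $ 2"] a by simp
    finally show ?thesis .
  qed
  then show "bounded (range h)" by (auto simp: bounded_iff)
qed (use assms in \<open>auto intro!: lin_span.base\<close>)

text \<open>Both changes of variable are one-dimensional: first \<open>\<alpha>\<close> is replaced by \<open>p\<close> with \<open>t\<close>
  fixed, then, after the interchange of the integrals, \<open>t\<close> by \<open>q\<close> with \<open>p\<close> fixed.\<close>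

lemma fourier_wigner_test:
  assumes f: "f \<in> test_functions" and g: "g \<in> test_functions"
  shows "fourier (\<lambda>t. wigner_test a b c d f g (vector [a * u + b * v, t])) (c * u + d * v)
    = of_real (1 / \<bar>D\<bar>) * (fourier f u * fourier g v)"
proof -
  define x y where "x = a * u + b * v" and "y = c * u + d * v"
  \<comment> \<open>The character \<open>\<alpha> x + t y\<close>, with \<open>\<alpha>\<close> expressed by \<open>p\<close> and \<open>t\<close>.\<close>
  define E where "E p t = cis (- (2 * pi * ((p - c * t) / a * x + t * y)))" for p t
  have fs: "f \<in> schwartz" and gs: "g \<in> schwartz" using f g by (auto intro: test_schwartz)
  have inner: "wigner_test a b c d f g (vector [x, t]) * cis (- (2 * pi * y * t))
      = of_real (1 / \<bar>a\<bar>) * (LINT p|lborel. f p * g (b / a * p + D / a * t) * E p t)" for t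
  proof -
    have "wigner_test a b c d f g (vector [x, t]) =
        (LINT \<alpha>|lborel. f (a * \<alpha> + c * t) * g (b * \<alpha> + d * t) * cis (- (2 * pi * x * \<alpha>)))"
      by (simp add: wigner_test_def fourier_cis)
    also have "\<dots> = \<bar>1 / a\<bar> *\<^sub>R (LINT p|lborel. f (a * (- (c * t / a) + 1 / a * p) + c * t)
        * g (b * (- (c * t / a) + 1 / a * p) + d * t) * cis (- (2 * pi * x * (- (c * t / a) + 1 / a * p))))"
      using a by (subst lborel_integral_real_affine[of "1 / a" _ "- (c * t / a)"]) auto
    also have "(LINT p|lborel. f (a * (- (c * t / a) + 1 / a * p) + c * t)
        * g (b * (- (c * t / a) + 1 / a * p) + d * t) * cis (- (2 * pi * x * (- (c * t / a) + 1 / a * p))))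
      = (LINT p|lborel. f p * g (b / a * p + D / a * t) * cis (- (2 * pi * ((p - c * t) / a * x))))"
    proof (intro Bochner_Integration.integral_cong refl)
      fix p
      have "a * (- (c * t / a) + 1 / a * p) + c * t = p"
        "b * (- (c * t / a) + 1 / a * p) + d * t = b / a * p + D / a * t"
        "- (2 * pi * x * (- (c * t / a) + 1 / a * p)) = - (2 * pi * ((p - c * t) / a * x))"
        using a by (simp_all add: D(2) field_simps)
      then show "f (a * (- (c * t / a) + 1 / a * p) + c * t)
        * g (b * (- (c * t / a) + 1 / a * p) + d * t) * cis (- (2 * pi * x * (- (c * t / a) + 1 / a * p)))
        = f p * g (b / a * p + D / a * t) * cis (- (2 * pi * ((p - c * t) / a * x)))"
        by (simp only:)
    qed
    finally have "wigner_test a b c d f g (vector [x, t]) * cis (- (2 * pi * y * t))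
        = of_real (1 / \<bar>a\<bar>) * ((LINT p|lborel. f p * g (b / a * p + D / a * t) * cis (- (2 * pi * ((p - c * t) / a * x))))
          * cis (- (2 * pi * y * t)))"
      by (simp add: scaleR_conv_of_real)
    also have "(LINT p|lborel. f p * g (b / a * p + D / a * t) * cis (- (2 * pi * ((p - c * t) / a * x))))
          * cis (- (2 * pi * y * t)) = (LINT p|lborel. f p * g (b / a * p + D / a * t) * E p t)"
    proof -
      have "- (2 * pi * ((p - c * t) / a * x + t * y))
          = - (2 * pi * ((p - c * t) / a * x)) + - (2 * pi * y * t)" for p
        by (simp add: algebra_simps)
      then have "E p t = cis (- (2 * pi * ((p - c * t) / a * x))) * cis (- (2 * pi * y * t))" for p
        by (simp only: E_def cis_mult)
      then show ?thesis
        by (simp only: integral_mult_left_zero[symmetric] mult.assoc)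
    qed
    finally show ?thesis .
  qed
  have outer: "(LINT t|lborel. f p * g (b / a * p + D / a * t) * E p t)
      = of_real \<bar>a / D\<bar> * (f p * cis (- (2 * pi * u * p)) * fourier g v)" for p
  proof -
    have aD: "a / D \<noteq> 0" using a D(1) by simp
    have "(LINT t|lborel. f p * g (b / a * p + D / a * t) * E p t)
        = \<bar>a / D\<bar> *\<^sub>R (LINT q|lborel. f p * g (b / a * p + D / a * (- (b * p / D) + a / D * q))
            * E p (- (b * p / D) + a / D * q))"
      by (rule lborel_integral_real_affine[OF aD])
    also have "(LINT q|lborel. f p * g (b / a * p + D / a * (- (b * p / D) + a / D * q))
            * E p (- (b * p / D) + a / D * q))
        = (LINT q|lborel. f p * cis (- (2 * pi * u * p)) * (g q * cis (- (2 * pi * v * q))))"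
    proof (intro Bochner_Integration.integral_cong refl)
      fix q
      define t where "t = - (b * p / D) + a / D * q"
      have Dt: "D * t = a * q - b * p" using D(1) by (simp add: t_def field_simps)
      have q: "b / a * p + D / a * t = q" using a Dt by (simp add: field_simps)
      have "D * (p - c * t) = D * p - c * (D * t)"
        by (simp add: algebra_simps)
      also have "\<dots> = a * (d * p - c * q)"
        unfolding Dt by (simp add: D(2) algebra_simps)
      finally have "D * (p - c * t) = a * (d * p - c * q)" .
      then have "(p - c * t) / a = (d * p - c * q) / D"
        using a D(1) by (simp add: field_simps)
      moreover have "t = (a * q - b * p) / D"
        using Dt D(1) by (simp add: field_simps)
      ultimately have "(p - c * t) / a * x + t * y = ((d * p - c * q) * x + (a * q - b * p) * y) / D"
        by (simp add: add_divide_distrib)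
      also have "(d * p - c * q) * x + (a * q - b * p) * y = D * (p * u + q * v)"
        by (simp add: x_def y_def D(2) algebra_simps)
      finally have "(p - c * t) / a * x + t * y = p * u + q * v"
        using D(1) by simp
      then have "E p t = cis (- (2 * pi * u * p) + - (2 * pi * v * q))"
        by (simp add: E_def algebra_simps)
      then have "E p t = cis (- (2 * pi * u * p)) * cis (- (2 * pi * v * q))"
        by (simp only: cis_mult)
      then show "f p * g (b / a * p + D / a * (- (b * p / D) + a / D * q)) * E p (- (b * p / D) + a / D * q)
          = f p * cis (- (2 * pi * u * p)) * (g q * cis (- (2 * pi * v * q)))"
        unfolding t_def[symmetric] q by (simp only: mult_ac)
    qed
    also have "\<dots> = f p * cis (- (2 * pi * u * p)) * fourier g v"
      by (simp only: fourier_cis integral_mult_right_zero)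
    finally show ?thesis by (simp add: scaleR_conv_of_real)
  qed
  have "fourier (\<lambda>t. wigner_test a b c d f g (vector [x, t])) y
      = of_real (1 / \<bar>a\<bar>) * (LINT t|lborel. LINT p|lborel. f p * g (b / a * p + D / a * t) * E p t)"
    unfolding fourier_cis[of "\<lambda>t. wigner_test a b c d f g (vector [x, t])"] inner
    by (rule integral_mult_right_zero)
  also have "(LINT t|lborel. LINT p|lborel. f p * g (b / a * p + D / a * t) * E p t)
      = (LINT p|lborel. LINT t|lborel. f p * g (b / a * p + D / a * t) * E p t)"
  proof (rule schwartz_fubini[OF fs gs])
    show "D / a \<noteq> 0" using a D(1) by simp
    show "continuous_on UNIV (\<lambda>z. E (fst z) (snd z))"
      unfolding E_def using a by (intro continuous_intros) auto
  qed (simp add: E_def)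
  also have "\<dots> = of_real \<bar>a / D\<bar> * (fourier f u * fourier g v)"
    unfolding outer fourier_cis[of f]
    by (simp only: integral_mult_right_zero integral_mult_left_zero)
  finally show ?thesis
    using a by (simp add: x_def y_def abs_divide)
qed

end

section \<open>Discreteness of both factors\<close>

lemma cnj_fourier: "cnj (fourier f \<omega>) = fourier (\<lambda>t. cnj (f (- t))) \<omega>"
  by (rule fourier_cnj_reflect[symmetric])

lemma cnj_dist_fourier:
  "cnj_dist u (fourier f) = cnj (fourier_dist u (\<lambda>t. cnj (f (- t))))"
  by (simp add: cnj_dist_def fourier_dist_def cnj_fourier)

lemma test_cnj_reflect:
  "f \<in> test_functions \<Longrightarrow> (\<lambda>t::real. cnj (f (- t))) \<in> test_functions"
  using test_affine[OF test_cnj, of f "- 1" 0] by simp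

lemma test_linear_fourier_dist:
  assumes "tempered_distribution u"
  shows "test_linear (fourier_dist u)"
  unfolding test_linear_def fourier_dist_def
proof (intro conjI ballI allI)
  fix f g :: "real \<Rightarrow> complex" assume f: "f \<in> test_functions" and g: "g \<in> test_functions"
  have "fourier (\<lambda>x. f x + g x) = (\<lambda>\<omega>. fourier f \<omega> + fourier g \<omega>)"
    using fourier_add[OF test_schwartz[OF f] test_schwartz[OF g]] by blast
  then show "u (fourier (\<lambda>x. f x + g x)) = u (fourier f) + u (fourier g)"
    using tempered_add[OF assms fourier_schwartz[OF test_schwartz[OF f]]
        fourier_schwartz[OF test_schwartz[OF g]]] by simp
next
  fix f :: "real \<Rightarrow> complex" and c assume f: "f \<in> test_functions"
  have "fourier (\<lambda>x. c * f x) = (\<lambda>\<omega>. c * fourier f \<omega>)"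
    using fourier_cmult by blast
  then show "u (fourier (\<lambda>x. c * f x)) = c * u (fourier f)"
    using tempered_cmult[OF assms fourier_schwartz[OF test_schwartz[OF f]]] by simp
qed

lemma test_linear_cnj_dist_fourier:
  assumes "tempered_distribution u"
  shows "test_linear (\<lambda>f. cnj_dist u (fourier f))"
  unfolding test_linear_def cnj_dist_fourier
proof (intro conjI ballI allI)
  note S = test_linear_fourier_dist[OF assms]
  fix f g :: "real \<Rightarrow> complex" assume f: "f \<in> test_functions" and g: "g \<in> test_functions"
  show "cnj (fourier_dist u (\<lambda>t. cnj (f (- t) + g (- t)))) =
      cnj (fourier_dist u (\<lambda>t. cnj (f (- t)))) + cnj (fourier_dist u (\<lambda>t. cnj (g (- t))))"
    using test_linear_add[OF S test_cnj_reflect[OF f] test_cnj_reflect[OF g]] by simp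
next
  note S = test_linear_fourier_dist[OF assms]
  fix f :: "real \<Rightarrow> complex" and c assume f: "f \<in> test_functions"
  show "cnj (fourier_dist u (\<lambda>t. cnj (c * f (- t)))) = c * cnj (fourier_dist u (\<lambda>t. cnj (f (- t))))"
    using test_linear_cmult[OF S test_cnj_reflect[OF f], of "cnj c"] by simp
qed

lemma measure_if_local_eigenvalue:
  assumes "test_linear S" "\<epsilon> > 0"
    and "\<And>l. \<exists>\<kappa>. \<forall>f\<in>supp_in l (l + \<epsilon>). S (\<lambda>x. (of_real x - \<kappa>) * f x) = 0"
  shows "\<exists>\<kappa> \<Lambda>. given_by_measure S \<kappa> \<and> uniform_discrete \<Lambda> \<and> measure_supported_on \<kappa> \<Lambda>"
  by (rule discrete_representation[OF assms]) (use given_by_atomic_measure in blast)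

lemma matrix_wigner_test:
  fixes T :: "real^2 \<Rightarrow> real^2" and a b c d :: real
  assumes T: "linear T" "bij T" and M: "matrix (inv T) = vector [vector [a, b], vector [c, d]]"
    and a: "a \<noteq> 0" and D: "a * d - b * c \<noteq> 0"
    and \<mu>: "tempered_distribution \<mu>" and \<nu>: "tempered_distribution \<nu>"
    and f: "f \<in> test_functions" and g: "g \<in> test_functions"
  shows "matrix_wigner T \<mu> \<nu> (wigner_test a b c d f g) =
    fourier_dist \<mu> f * cnj_dist \<nu> (fourier g) / of_real (\<bar>a * d - b * c\<bar> * \<bar>det (matrix T)\<bar>)"
proof -
  define k where "k = \<bar>a * d - b * c\<bar>"
  have "linear (inv T)"
    using T by (intro inj_linear_imp_inv_linear bij_is_inj)
  then have "inv T z = matrix (inv T) *v z" for z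
    by (metis matrix_vector_mul(2))
  then have invT: "inv T (vector [u, v]) = vector [a * u + b * v, c * u + d * v]" for u v
    unfolding M by (simp add: vec_eq_iff forall_2 matrix_vector_mult_def sum_2)
  have comp: "(partial_fourier (wigner_test a b c d f g) \<circ> inv T) (vector [u, v])
      = of_real (1 / k) * fourier f u * fourier g v" for u v
    using fourier_wigner_test[OF D refl a f g, of u v] by (simp add: invT partial_fourier_def k_def)
  have fs: "fourier f \<in> schwartz" and gs: "fourier g \<in> schwartz"
    using f g by (auto intro: fourier_schwartz test_schwartz)
  have scale: "cnj_dist \<nu> (\<lambda>y. z * fourier g y) = z * cnj_dist \<nu> (fourier g)" for z
    using tempered_cmult[OF \<nu> schwartz_cnj[OF gs], of "cnj z"] by (simp add: cnj_dist_def)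
  have "tensor_dist \<mu> (cnj_dist \<nu>) (partial_fourier (wigner_test a b c d f g) \<circ> inv T)
      = \<mu> (\<lambda>x. (of_real (1 / k) * cnj_dist \<nu> (fourier g)) * fourier f x)"
    unfolding tensor_dist_def comp scale by (simp only: mult_ac)
  also have "\<dots> = of_real (1 / k) * cnj_dist \<nu> (fourier g) * fourier_dist \<mu> f"
    unfolding fourier_dist_def by (rule tempered_cmult[OF \<mu> fs])
  finally show ?thesis
    unfolding matrix_wigner_def partial_fourier_dist_def pullback_dist_def k_def[symmetric]
    by (simp add: mult_ac)
qed

theorem corollary17:
  fixes T :: "real^2 \<Rightarrow> real^2" and a b c d :: real
    and \<mu> \<nu> :: "real functional"
    and A B :: "real set" and coeff :: "real \<Rightarrow> real \<Rightarrow> complex"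
  assumes "linear T" and "bij T"
    and "matrix (inv T) = vector [vector [a, b], vector [c, d]]"
    and "a * b \<noteq> 0"
    and "tempered_distribution \<mu>" and "\<exists>\<phi>\<in>schwartz. \<mu> \<phi> \<noteq> 0"
    and "tempered_distribution \<nu>" and "\<exists>\<phi>\<in>schwartz. \<nu> \<phi> \<noteq> 0"
    and "uniform_discrete A" and "uniform_discrete B"
    and "dist_has_sum (\<lambda>(r, s) \<phi>. coeff r s * dirac (vector [r, s]) \<phi>)
           (matrix_wigner T \<mu> \<nu>) (A \<times> B)"
  shows "(\<exists>\<kappa> \<Lambda>. given_by_measure (fourier_dist \<mu>) \<kappa> \<and> uniform_discrete \<Lambda> \<and>
            measure_supported_on \<kappa> \<Lambda>) \<and>
         (\<exists>\<kappa> \<Lambda>. given_by_measure (fourier_dist \<nu>) \<kappa> \<and> uniform_discrete \<Lambda> \<and>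
            measure_supported_on \<kappa> \<Lambda>)"
proof -
  define D where "D = a * d - b * c"
  define S where "S = fourier_dist \<mu>"
  define R where "R f = cnj_dist \<nu> (fourier f)" for f
  have a: "a \<noteq> 0" and b: "b \<noteq> 0" using \<open>a * b \<noteq> 0\<close> by auto
  have detT: "det (matrix T) \<noteq> 0"
    using det_nz_iff_inj[OF \<open>linear T\<close>] bij_is_inj[OF \<open>bij T\<close>] by simp
  have "linear (inv T)"
    using assms(1,2) by (intro inj_linear_imp_inv_linear bij_is_inj)
  then have "det (matrix (inv T)) \<noteq> 0"
    using det_nz_iff_inj bij_is_inj[OF bij_imp_bij_inv[OF \<open>bij T\<close>]] by blast
  then have D: "D \<noteq> 0"
    unfolding assms(3) by (simp add: det_2 D_def)
  have S: "test_linear S" and S': "test_linear (fourier_dist \<nu>)"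
    unfolding S_def using assms(5,7) by (auto intro: test_linear_fourier_dist)
  have R: "test_linear R"
    unfolding R_def using assms(7) by (rule test_linear_cnj_dist_fourier)
  \<comment> \<open>Only the values \<open>wigner_test a b c d f g (r, s)\<close> with \<open>s\<close> in \<open>B\<close> enter the series, and they
    depend on \<open>f p * g q\<close> only along the lines \<open>(a q - b p) / D = s\<close>.\<close>
  have SR: "S f * R g1 = S f1 * R g"
    if tests: "f \<in> test_functions" "f1 \<in> test_functions" "g \<in> test_functions" "g1 \<in> test_functions"
      and agree: "\<And>p q. (- b / D) * p + (a / D) * q \<in> B \<Longrightarrow> f p * g1 q = f1 p * g q" for f f1 g g1
  proof -
    let ?W = "matrix_wigner T \<mu> \<nu>"
    have sum: "((\<lambda>(r, s). coeff r s * wigner_test a b c d f g (vector [r, s])) has_sum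
        ?W (wigner_test a b c d f g)) (A \<times> B)"
      if "f \<in> test_functions" "g \<in> test_functions" for f g
      using assms(11) wigner_test_schwartz[OF D D_def a that]
      unfolding dist_has_sum_def dirac_def by (auto simp: case_prod_unfold)
    have "wigner_test a b c d f g1 (vector [r, s]) = wigner_test a b c d f1 g (vector [r, s])"
      if "s \<in> B" for r s
    proof -
      have "f (a * \<alpha> + c * s) * g1 (b * \<alpha> + d * s) = f1 (a * \<alpha> + c * s) * g (b * \<alpha> + d * s)" for \<alpha>
      proof (rule agree)
        have "(- b / D) * (a * \<alpha> + c * s) + (a / D) * (b * \<alpha> + d * s) = s"
          using D by (simp add: field_simps) (simp add: D_def algebra_simps)
        then show "(- b / D) * (a * \<alpha> + c * s) + (a / D) * (b * \<alpha> + d * s) \<in> B"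
          using that by simp
      qed
      then show ?thesis by (simp add: wigner_test_def)
    qed
    then have "((\<lambda>(r, s). coeff r s * wigner_test a b c d f g1 (vector [r, s])) has_sum
        ?W (wigner_test a b c d f1 g)) (A \<times> B)"
      using sum[OF tests(2,3)] by (subst has_sum_cong) auto
    with sum[OF tests(1,4)] have "?W (wigner_test a b c d f g1) = ?W (wigner_test a b c d f1 g)"
      by (rule has_sum_unique)
    then show ?thesis
      using D detT matrix_wigner_test[OF assms(1-3) a D[unfolded D_def] assms(5,7)] tests
      by (simp add: S_def R_def D_def)
  qed
  obtain f0 where f0: "f0 \<in> test_functions" "S f0 \<noteq> 0"
    unfolding S_def using fourier_dist_nonzero[OF assms(5,6)] by blast
  obtain g where g: "g \<in> test_functions" "fourier_dist \<nu> g \<noteq> 0"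
    using fourier_dist_nonzero[OF assms(7,8)] by blast
  define g0 where "g0 t = cnj (g (- t))" for t
  have g0: "g0 \<in> test_functions" "R g0 \<noteq> 0"
    using test_cnj_reflect[OF g(1)] g(2) by (simp_all add: g0_def[abs_def] R_def cnj_dist_fourier)
  have slopes: "- b / D \<noteq> 0" "a / D \<noteq> 0" using a b D by auto
  obtain \<epsilon> where "\<epsilon> > 0"
    "\<And>l. \<exists>\<kappa>. \<forall>f\<in>supp_in l (l + \<epsilon>). S (\<lambda>x. (of_real x - \<kappa>) * f x) = 0"
    using local_eigenvalue[OF S R g0 slopes assms(10) SR] by blast
  then have \<mu>: "\<exists>\<kappa> \<Lambda>. given_by_measure S \<kappa> \<and> uniform_discrete \<Lambda> \<and> measure_supported_on \<kappa> \<Lambda>"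
    by (rule measure_if_local_eigenvalue[OF S])
  \<comment> \<open>The relation is symmetric in the two functionals, with the slopes exchanged.\<close>
  have RS: "R f * S g1 = R f1 * S g"
    if "f \<in> test_functions" "f1 \<in> test_functions" "g \<in> test_functions" "g1 \<in> test_functions"
      and agree: "\<And>p q. (a / D) * p + (- b / D) * q \<in> B \<Longrightarrow> f p * g1 q = f1 p * g q" for f f1 g g1
  proof -
    have "S g1 * R f = S g * R f1"
    proof (rule SR[OF that(4,3,2,1)])
      fix p q assume "(- b / D) * p + (a / D) * q \<in> B"
      then have "f q * g1 p = f1 q * g p" by (intro agree) (simp add: add.commute)
      then show "g1 p * f q = g p * f1 q" by (simp add: mult.commute)
    qed
    then show ?thesis by (simp add: mult.commute)
  qed
  obtain \<epsilon> where \<epsilon>: "\<epsilon> > 0"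
    and eig: "\<And>l. \<exists>\<kappa>. \<forall>f\<in>supp_in l (l + \<epsilon>). R (\<lambda>x. (of_real x - \<kappa>) * f x) = 0"
    using local_eigenvalue[OF R S f0 slopes(2,1) assms(10) RS] by blast
  \<comment> \<open>\<open>R\<close> is \<open>fourier_dist \<nu>\<close> after conjugation and reflection; this reflects the windows and
    turns \<open>\<kappa>\<close> into \<open>- cnj \<kappa>\<close>.\<close>
  have "\<exists>\<kappa>. \<forall>f\<in>supp_in l (l + \<epsilon>). fourier_dist \<nu> (\<lambda>x. (of_real x - \<kappa>) * f x) = 0" for l
  proof -
    obtain \<kappa> where \<kappa>: "\<And>f. f \<in> supp_in (- l - \<epsilon>) (- l - \<epsilon> + \<epsilon>) \<Longrightarrow>
        R (\<lambda>x. (of_real x - \<kappa>) * f x) = 0"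
      using eig[of "- l - \<epsilon>"] by blast
    have "fourier_dist \<nu> (\<lambda>x. (of_real x - (- cnj \<kappa>)) * f x) = 0" if f: "f \<in> supp_in l (l + \<epsilon>)" for f
    proof -
      have "(\<lambda>t. - cnj (f (- t))) \<in> supp_in (- l - \<epsilon>) (- l - \<epsilon> + \<epsilon>)"
        using f test_cmult[OF test_cnj_reflect, of f "- 1"] by (auto simp: supp_in_def)
      from \<kappa>[OF this] show ?thesis
        by (simp add: R_def cnj_dist_fourier algebra_simps)
    qed
    then show ?thesis by blast
  qed
  then have \<nu>: "\<exists>\<kappa> \<Lambda>. given_by_measure (fourier_dist \<nu>) \<kappa> \<and> uniform_discrete \<Lambda> \<and>
      measure_supported_on \<kappa> \<Lambda>"
    by (rule measure_if_local_eigenvalue[OF S' \<epsilon>])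
  show ?thesis using \<mu> \<nu> unfolding S_def by blast
qed

end
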